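(* Let $p\geq 2$, $q\geq 1$ and $k_1\geq k_2\geq \cdots \geq k_q\geq 1$ be integers. Then there exists $n_0$ such that for every $n\geq n_0$ the following holds: if $H$ has the maximum spectral radius among all $n$-vertex $S^{p+1}_{k_1,\dots,k_q}$-free graphs, then $H\in \mathrm{Ex}(n,S^{p+1}_{k_1,\dots,k_q})$, i.e. $H$ has the maximum number of edges among all $n$-vertex $S^{p+1}_{k_1,\dots,k_q}$-free graphs.
   Context: All graphs are simple. $S_k$ denotes the star with $k$ edges, and $S_{k_1,\dots,k_q}$ denotes the star forest which is the vertex-disjoint union $S_{k_1}\cup\cdots\cup S_{k_q}$. For a graph $G$ and an integer $p\geq 2$, the edge blow-up $G^{p+1}$ is the graph obtained by replacing each edge of $G$ with a clique of order $p+1$ (containing that edge), where the new vertices of the different cliques are all distinct. A graph is $F$-free if it contains no subgraph isomorphic to $F$. The spectral radius of a graph is the largest eigenvalue of its adjacency matrix. $\mathrm{Ex}(n,F)$ denotes the set of $n$-vertex $F$-free graphs with the maximum possible number of edges. *)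

theory Defs
  imports Complex_Main
begin

definition simple_graph :: "nat \<Rightarrow> nat set set \<Rightarrow> bool" where
  "simple_graph n G \<longleftrightarrow> G \<subseteq> {{u, v} | u v. u \<noteq> v \<and> u < n \<and> v < n}"

text \<open>Adjacency matrix and its eigenvalues (real, since it is symmetric).\<close>
definition adj :: "nat set set \<Rightarrow> nat \<Rightarrow> nat \<Rightarrow> real" where
  "adj G i j = (if {i, j} \<in> G then 1 else 0)"

definition is_eigenvalue :: "nat \<Rightarrow> nat set set \<Rightarrow> real \<Rightarrow> bool" where
  "is_eigenvalue n G mu \<longleftrightarrow>
     (\<exists>x :: nat \<Rightarrow> real. (\<exists>i<n. x i \<noteq> 0) \<and>
        (\<forall>i<n. (\<Sum>j<n. adj G i j * x j) = mu * x i))"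

definition spectral_radius :: "nat \<Rightarrow> nat set set \<Rightarrow> real" where
  "spectral_radius n G = Max {mu. is_eigenvalue n G mu}"

text \<open>The edge blow-up S^{p+1}_{k_1,...,k_q} of the star forest, ks = [k_1,...,k_q].
  Vertex (i,0,0) is the centre of star i; for 1 \<le> a \<le> k_i, the clique replacing
  the a-th edge of star i is {(i,0,0)} \<union> {(i,a,b) | b < p}, where (i,a,0) is the leaf.\<close>
definition blowup_clique :: "nat \<Rightarrow> nat \<Rightarrow> nat \<Rightarrow> (nat \<times> nat \<times> nat) set" where
  "blowup_clique p i a = insert (i, 0, 0) {(i, a, b) | b. b < p}"

definition SF_verts :: "nat \<Rightarrow> nat list \<Rightarrow> (nat \<times> nat \<times> nat) set" where
  "SF_verts p ks = (\<Union>i<length ks. \<Union>a\<in>{1..ks ! i}. blowup_clique p i a)"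

definition SF_adj :: "nat \<Rightarrow> nat list \<Rightarrow> (nat \<times> nat \<times> nat) \<Rightarrow> (nat \<times> nat \<times> nat) \<Rightarrow> bool" where
  "SF_adj p ks u v \<longleftrightarrow> u \<noteq> v \<and>
     (\<exists>i<length ks. \<exists>a\<in>{1..ks ! i}. u \<in> blowup_clique p i a \<and> v \<in> blowup_clique p i a)"

definition contains_SF :: "nat \<Rightarrow> nat list \<Rightarrow> nat \<Rightarrow> nat set set \<Rightarrow> bool" where
  "contains_SF p ks n G \<longleftrightarrow>
     (\<exists>f. inj_on f (SF_verts p ks) \<and> f ` SF_verts p ks \<subseteq> {..<n} \<and>
        (\<forall>u\<in>SF_verts p ks. \<forall>v\<in>SF_verts p ks. SF_adj p ks u v \<longrightarrow> {f u, f v} \<in> G))"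

definition SF_free :: "nat \<Rightarrow> nat list \<Rightarrow> nat \<Rightarrow> nat set set \<Rightarrow> bool" where
  "SF_free p ks n G \<longleftrightarrow> \<not> contains_SF p ks n G"

definition Ex_SF :: "nat \<Rightarrow> nat list \<Rightarrow> nat \<Rightarrow> nat set set set" where
  "Ex_SF p ks n = {H. simple_graph n H \<and> SF_free p ks n H \<and>
     (\<forall>G. simple_graph n G \<and> SF_free p ks n G \<longrightarrow> card G \<le> card H)}"

end

theory Submission
  imports Defs "HOL-Analysis.Analysis"
begin

text \<open>Let \<open>q\<close> be the number of stars and \<open>k = k\<^sub>q\<close>. A vertex with many disjoint \<open>p\<close>-cliques in its
  neighbourhood can serve as the centre of any star, so a free graph has fewer than \<open>q\<close> such vertices,
  and deleting \<open>O(n)\<close> edges makes it \<open>K\<^bsub>p+1\<^esub>\<close>-free. Hence a weighted form of Furedi's stability theorem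
  applies: it gives a \<open>p\<close>-partition with \<open>O(n)\<close> defects, and it makes the Perron vector \<open>z\<close>, scaled to
  \<open>\<Sum>z\<^sub>v\<^sup>2 = n\<close>, satisfy \<open>\<Sum>(z\<^sub>v - 1)\<^sup>2 = O(1)\<close>.

  Spectral and edge extremal graphs are treated alike: both maximise \<open>\<Sum>z\<^sub>uz\<^sub>v\<close> over the edges \<open>uv\<close>
  of a free graph, with \<open>z\<close> the Perron vector of the spectral extremal graph and \<open>z = 1\<close>
  respectively. Comparing such a graph with the join of \<open>q - 1\<close> vertices and a complete \<open>p\<close>-partite graph
  shows that it is this join up to a bounded number of extra and lacking pairs, that the rest without
  the \<open>q - 1\<close> vertices contains no \<open>S\<^sub>k\<^bsup>p+1\<^esup>\<close>, and conversely every such graph is free.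

  Finally, copying the bounded configuration of an edge extremal graph into the spectral extremal graph
  shows that the latter has the largest possible surplus of extra over lacking pairs, and moving a vertex
  between classes shows that its classes are balanced. Its number of edges is therefore maximal.\<close>

section \<open>Weighted stability for clique-free graphs\<close>

text \<open>Two quantities decide the number of edges: the squares of the class sizes and the
  surplus. Surpluses are easy to compare, since boundedly many pairs change, weights off L are
  within \<epsilon> of 1, and surpluses are integers. The class sizes are the obstacle. Stability
  gives them only up to order sqrt n, and for p = 2 the Rayleigh quotient of the old Perron vector
  does not detect the move of a vertex u between classes whose sizes differ by 2: with D the
  difference of the class weights, its gain is governed by \<open>2 * z u * (D - z u)\<close>, and D
  and \<open>z u\<close> are both about 1. Pairing the Perron vectors z and y of the two graphs
  cancels the products \<open>z u * y u\<close> and leaves \<open>z u * D' + y u * D\<close>, where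
  D' is the difference after the move, which is nearly nonnegative. The hypothesis p >= 2 is felt at
  several places: every edge of the forbidden graph lies in a triangle, a matching inside one class
  has common neighbours in another class, and a class has at most about half of the
  vertices.\<close>

declare sum_of_bool_mult_eq [simp del] sum_mult_of_bool_eq [simp del]

definition graph_on :: "nat \<Rightarrow> (nat \<Rightarrow> nat \<Rightarrow> bool) \<Rightarrow> bool" where
  "graph_on n E \<longleftrightarrow> (\<forall>u v. E u v \<longrightarrow> E v u \<and> u < n \<and> u \<noteq> v)"

definition clique :: "('a \<Rightarrow> 'a \<Rightarrow> bool) \<Rightarrow> 'a set \<Rightarrow> bool" where
  "clique E X \<longleftrightarrow> (\<forall>u\<in>X. \<forall>v\<in>X. u \<noteq> v \<longrightarrow> E u v)"

text \<open>The sum runs over ordered pairs, so each edge counts twice and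
  \<open>quad n E (\<lambda>_. 1)\<close> is twice the number of edges.\<close>

definition quad :: "nat \<Rightarrow> (nat \<Rightarrow> nat \<Rightarrow> bool) \<Rightarrow> (nat \<Rightarrow> real) \<Rightarrow> real" where
  "quad n E z = (\<Sum>u<n. \<Sum>v<n. of_bool (E u v) * z u * z v)"

definition edge_set :: "(nat \<Rightarrow> nat \<Rightarrow> bool) \<Rightarrow> nat set set" where
  "edge_set E = {{u, v} | u v. E u v}"

lemma graph_onD:
  assumes "graph_on n E" "E u v"
  shows "E v u" "u < n" "v < n" "u \<noteq> v"
  using assms unfolding graph_on_def by blast+

lemma graph_on_sym: "graph_on n E \<Longrightarrow> E u v \<longleftrightarrow> E v u"
  unfolding graph_on_def by blast

lemma mem_edge_set: "graph_on n E \<Longrightarrow> {u, v} \<in> edge_set E \<longleftrightarrow> E u v"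
  unfolding edge_set_def by (auto simp: doubleton_eq_iff dest: graph_onD)

lemma clique_subset: "clique E X \<Longrightarrow> Y \<subseteq> X \<Longrightarrow> clique E Y"
  unfolding clique_def by blast

text \<open>Furedi's argument with weights: take x of maximal weighted degree D, colour its
  neighbourhood A by induction and give everything outside A one new colour. Counting pairs inside a
  class a second time is what makes this work: the pairs touching B = V - A then add up to twice the
  weighted degrees over B, and each degree is at most D.\<close>

lemma weighted_furedi_Suc:
  fixes w :: "'a \<Rightarrow> real"
  assumes "finite V" and "\<And>u. u \<in> V \<Longrightarrow> 0 \<le> w u"
    and "\<And>u v. E u v \<Longrightarrow> E v u" and "\<And>u. \<not> E u u"
    and "\<And>X. X \<subseteq> V \<Longrightarrow> card X = m + 2 \<Longrightarrow> \<not> clique E X"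
  shows "\<exists>c. (\<forall>v. c v < Suc m) \<and>
    (\<Sum>u\<in>V. \<Sum>v\<in>V. (of_bool (E u v) + of_bool (E u v \<and> c u = c v)) * (w u * w v))
      \<le> (1 - 1 / Suc m) * (sum w V)\<^sup>2"
  using assms(1,2,5)
proof (induction m arbitrary: V)
  case 0
  have *: "\<not> E u v" if "u \<in> V" "v \<in> V" for u v
  proof
    assume e: "E u v"
    hence ne: "u \<noteq> v" using assms(4) by blast
    have "\<not> clique E {u, v}" using 0(3)[of "{u,v}"] that ne by simp
    thus False using e assms(3) by (auto simp: clique_def)
  qed
  show ?case
    by (rule exI[of _ "\<lambda>_. 0"]) (simp add: * cong: sum.cong)
next
  case (Suc m)
  show ?case
  proof (cases "V = {}")
    case True
    thus ?thesis by (intro exI[of _ "\<lambda>_. 0"]) simp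
  next
    case False
    define dg where "dg u = (\<Sum>v\<in>V. of_bool (E u v) * w v)" for u
    obtain x where x: "x \<in> V" "\<And>u. u \<in> V \<Longrightarrow> dg u \<le> dg x"
    proof -
      have "Max (dg ` V) \<in> dg ` V" using False Suc.prems(1) by (intro Max_in) auto
      then obtain x where "x \<in> V" "dg x = Max (dg ` V)" by auto
      moreover have "dg u \<le> Max (dg ` V)" if "u \<in> V" for u using that Suc.prems(1) by simp
      ultimately show ?thesis using that by metis
    qed
    define A where "A = {u \<in> V. E x u}"
    define B where "B = V - A"
    have fin: "finite A" "finite B" "A \<inter> B = {}" "V = A \<union> B"
      using Suc.prems(1) by (auto simp: A_def B_def)
    define D where "D = sum w A"
    have dgx: "dg x = D"
      unfolding dg_def D_def A_def using Suc.prems(1)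
      by (simp add: sum.inter_filter of_bool_def if_distrib if_distribR cong: if_cong)
    have "\<exists>c. (\<forall>v. c v < Suc m) \<and>
      (\<Sum>u\<in>A. \<Sum>v\<in>A. (of_bool (E u v) + of_bool (E u v \<and> c u = c v)) * (w u * w v))
      \<le> (1 - 1 / Suc m) * (sum w A)\<^sup>2"
    proof (rule Suc.IH)
      show "finite A" by fact
      show "0 \<le> w u" if "u \<in> A" for u using that Suc.prems(2) A_def by auto
      show "\<not> clique E X" if X: "X \<subseteq> A" "card X = m + 2" for X
      proof
        assume c: "clique E X"
        have "x \<notin> X" using X assms(4) by (auto simp: A_def)
        moreover have "finite X" using X fin finite_subset by blast
        ultimately have "card (insert x X) = Suc m + 2" using X by simp
        moreover have "insert x X \<subseteq> V" using X x by (auto simp: A_def)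
        moreover have "clique E (insert x X)" using c X assms(3) unfolding clique_def A_def by blast
        ultimately show False using Suc.prems(3) by blast
      qed
    qed
    then obtain c where c: "\<And>v. c v < Suc m"
      and cA: "(\<Sum>u\<in>A. \<Sum>v\<in>A. (of_bool (E u v) + of_bool (E u v \<and> c u = c v)) * (w u * w v))
      \<le> (1 - 1 / Suc m) * D\<^sup>2" unfolding D_def by blast
    define c' where "c' u = (if u \<in> A then c u else Suc m)" for u
    define g where "g u v = (of_bool (E u v) + of_bool (E u v \<and> c' u = c' v)) * (w u * w v)" for u v
    have gsym: "g u v = g v u" for u v 
    proof -
      have "E u v = E v u" "(c' u = c' v) = (c' v = c' u)" using assms(3) by auto
      thus ?thesis unfolding g_def by (simp add: mult.commute)
    qed
    have AA: "(\<Sum>u\<in>A. \<Sum>v\<in>A. g u v) \<le> (1 - 1 / Suc m) * D\<^sup>2"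
    proof -
      have "(\<Sum>u\<in>A. \<Sum>v\<in>A. g u v) = (\<Sum>u\<in>A. \<Sum>v\<in>A. (of_bool (E u v) + of_bool (E u v \<and> c u = c v)) * (w u * w v))"
        unfolding g_def c'_def by (intro sum.cong) auto
      thus ?thesis using cA by simp
    qed
    have AB: "(\<Sum>u\<in>A. \<Sum>v\<in>B. g u v) = (\<Sum>u\<in>B. \<Sum>v\<in>A. g u v)"
      by (subst sum.swap) (simp add: gsym[of _ _])
    have BA: "(\<Sum>u\<in>B. \<Sum>v\<in>A. g u v) = (\<Sum>u\<in>B. \<Sum>v\<in>A. of_bool (E u v) * (w u * w v))"
      using fin(3) c unfolding g_def c'_def by (intro sum.cong) (auto, metis less_irrefl)
    have BB: "(\<Sum>u\<in>B. \<Sum>v\<in>B. g u v) = (\<Sum>u\<in>B. \<Sum>v\<in>B. 2 * (of_bool (E u v) * (w u * w v)))"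
      using fin(3) unfolding g_def c'_def by (intro sum.cong) auto
    have "(\<Sum>u\<in>V. \<Sum>v\<in>V. g u v) = (\<Sum>u\<in>A. \<Sum>v\<in>A. g u v) + (\<Sum>u\<in>A. \<Sum>v\<in>B. g u v)
        + (\<Sum>u\<in>B. \<Sum>v\<in>A. g u v) + (\<Sum>u\<in>B. \<Sum>v\<in>B. g u v)"
      using fin by (simp add: sum.union_disjoint sum.distrib)
    also have "\<dots> = (\<Sum>u\<in>A. \<Sum>v\<in>A. g u v) + 2 * (\<Sum>u\<in>B. \<Sum>v\<in>V. of_bool (E u v) * (w u * w v))"
      using fin(1-3) unfolding AB BA BB fin(4)
      by (simp add: sum.union_disjoint sum.distrib sum_distrib_left)
    also have "(\<Sum>u\<in>B. \<Sum>v\<in>V. of_bool (E u v) * (w u * w v)) = (\<Sum>u\<in>B. w u * dg u)"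
      unfolding dg_def by (simp add: sum_distrib_left mult_ac)
    also have "(\<Sum>u\<in>B. w u * dg u) \<le> (\<Sum>u\<in>B. w u * D)"
      using x Suc.prems(2) unfolding dgx by (intro sum_mono mult_left_mono) (auto simp: B_def)
    also have "\<dots> = (sum w V - D) * D"
      using fin by (simp add: sum_distrib_right D_def sum.union_disjoint)
    also note AA
    finally have 1: "(\<Sum>u\<in>V. \<Sum>v\<in>V. g u v) \<le> (1 - 1 / Suc m) * D\<^sup>2 + 2 * ((sum w V - D) * D)" by simp
    also have "\<dots> \<le> (1 - 1 / Suc (Suc m)) * (sum w V)\<^sup>2"
    proof -
      define W where "W = sum w V"
      define r where "r = real (Suc m)"
      have r: "r > 0" "real (Suc (Suc m)) = r + 1" by (auto simp: r_def)
      \<comment> \<open>The slack is a complete square; it vanishes when A carries the share r / (r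
        + 1) of the total weight.\<close>
      have e: "(1 - 1 / (r+1)) * W\<^sup>2 - ((1 - 1 / r) * D\<^sup>2 + 2 * ((W - D) * D)) = (r * W - (r+1) * D)\<^sup>2 / (r * (r+1))"
        using r by (simp add: field_simps power2_eq_square)
      have "0 \<le> (1 - 1 / (r+1)) * W\<^sup>2 - ((1 - 1 / r) * D\<^sup>2 + 2 * ((W - D) * D))"
        unfolding e using r by simp
      thus ?thesis unfolding r(2) r_def[symmetric] W_def[symmetric] by simp
    qed
    finally have "(\<Sum>u\<in>V. \<Sum>v\<in>V. g u v) \<le> (1 - 1 / Suc (Suc m)) * (sum w V)\<^sup>2" .
    moreover have "c' v < Suc (Suc m)" for v unfolding c'_def using c[of v] by auto
    ultimately show ?thesis unfolding g_def by blast
  qed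
qed

lemma weighted_furedi:
  fixes w :: "'a \<Rightarrow> real"
  assumes "finite V" and "\<And>u. u \<in> V \<Longrightarrow> 0 \<le> w u"
    and "\<And>u v. E u v \<Longrightarrow> E v u" and "\<And>u. \<not> E u u"
    and "\<And>X. X \<subseteq> V \<Longrightarrow> card X = p + 1 \<Longrightarrow> \<not> clique E X" and "p \<ge> 1"
  shows "\<exists>c. (\<forall>v. c v < p) \<and>
    (\<Sum>u\<in>V. \<Sum>v\<in>V. (of_bool (E u v) + of_bool (E u v \<and> c u = c v)) * (w u * w v))
      \<le> (1 - 1 / p) * (sum w V)\<^sup>2"
proof -
  obtain m where m: "p = Suc m" using assms(6) by (cases p) auto
  show ?thesis unfolding m by (rule weighted_furedi_Suc) (use assms m in auto)
qed

section \<open>The spectral radius as a Rayleigh quotient\<close>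

lemma continuous_on_coordinate: "continuous_on S (\<lambda>x :: nat \<Rightarrow> real. x i)"
  using continuous_on_product_coordinates by (rule continuous_on_subset) simp

text \<open>Vectors are functions on the naturals that vanish from n on, so the sphere is a closed
  subset of a product of intervals and singletons, which is compact by Tychonoff's theorem.\<close>

lemma compact_coordinate_sphere:
  "compact {x :: nat \<Rightarrow> real. (\<forall>i\<ge>n. x i = 0) \<and> (\<Sum>i<n. (x i)\<^sup>2) = 1}"
proof -
  let ?S = "{x :: nat \<Rightarrow> real. (\<forall>i\<ge>n. x i = 0) \<and> (\<Sum>i<n. (x i)\<^sup>2) = 1}"
  let ?B = "PiE UNIV (\<lambda>i. if i < n then {-1..1} else {0}) :: (nat \<Rightarrow> real) set"
  have "compactin (product_topology (\<lambda>_. euclidean) UNIV) ?B"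
    by (subst compactin_PiE) auto
  hence B: "compact ?B" by (simp add: euclidean_product_topology)
  have sub: "?S \<subseteq> ?B"
  proof
    fix x assume x: "x \<in> ?S"
    have "x i \<in> (if i < n then {-1..1} else {0})" for i
    proof (cases "i < n")
      case True
      have "(x i)\<^sup>2 \<le> (\<Sum>i<n. (x i)\<^sup>2)" using True by (intro member_le_sum) auto
      hence "(x i)\<^sup>2 \<le> 1\<^sup>2" using x by simp
      hence "\<bar>x i\<bar> \<le> 1" using abs_le_square_iff[of "x i" 1] by simp
      thus ?thesis using True by auto
    qed (use x in auto)
    thus "x \<in> ?B" by auto
  qed
  have "closed ?S"
  proof -
    have "?S = (\<Inter>i\<in>{n..}. {x. x i = 0}) \<inter> {x. (\<Sum>i<n. (x i)\<^sup>2) = 1}" by auto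
    also have "closed \<dots>"
      by (intro closed_Int closed_INT ballI closed_Collect_eq continuous_intros continuous_on_coordinate)
    finally show ?thesis .
  qed
  hence "compact (?B \<inter> ?S)" using B by (rule compact_Int_closed[rotated])
  thus ?thesis using sub by (simp add: Int_absorb1)
qed

lemma quadratic_form_max:
  fixes A :: "nat \<Rightarrow> nat \<Rightarrow> real"
  assumes "n \<ge> 1"
  shows "\<exists>x :: nat \<Rightarrow> real. (\<Sum>i<n. (x i)\<^sup>2) = 1 \<and>
    (\<forall>y. (\<Sum>i<n. \<Sum>j<n. A i j * y i * y j) \<le> (\<Sum>i<n. \<Sum>j<n. A i j * x i * x j) * (\<Sum>i<n. (y i)\<^sup>2))"
proof -
  let ?S = "{x :: nat \<Rightarrow> real. (\<forall>i\<ge>n. x i = 0) \<and> (\<Sum>i<n. (x i)\<^sup>2) = 1}"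
  let ?Q = "\<lambda>y. \<Sum>i<n. \<Sum>j<n. A i j * y i * y j"
  have "(\<Sum>i<n. (if i = 0 then 1 else 0 :: real)\<^sup>2) = (\<Sum>i<n. if i = 0 then 1 else 0)"
    by (intro sum.cong) auto
  also have "\<dots> = 1" using assms by (simp add: sum.delta)
  finally have "(\<Sum>i<n. (if i = 0 then 1 else 0 :: real)\<^sup>2) = 1" .
  moreover have "\<forall>i\<ge>n. (if i = 0 then 1 else 0 :: real) = 0" using assms by simp
  ultimately have "(\<lambda>i. if i = 0 then 1 else 0) \<in> ?S"
    unfolding mem_Collect_eq by (intro conjI)
  hence ne: "?S \<noteq> {}" by (rule ex_in_conv[THEN iffD1, OF exI])
  have "continuous_on ?S ?Q" by (intro continuous_intros continuous_on_coordinate)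
  from continuous_attains_sup[OF compact_coordinate_sphere ne this]
  obtain x where x: "x \<in> ?S" "\<And>y. y \<in> ?S \<Longrightarrow> ?Q y \<le> ?Q x" by blast
  have "?Q y \<le> ?Q x * (\<Sum>i<n. (y i)\<^sup>2)" for y
  proof (cases "(\<Sum>i<n. (y i)\<^sup>2) = 0")
    case True
    hence "\<forall>i<n. y i = 0" by (simp add: sum_nonneg_eq_0_iff)
    thus ?thesis by simp
  next
    case False
    define s where "s = (\<Sum>i<n. (y i)\<^sup>2)"
    have s: "s > 0" using False unfolding s_def by (simp add: less_le sum_nonneg)
    define z where "z i = (if i < n then y i / sqrt s else 0)" for i
    have "(\<Sum>i<n. (z i)\<^sup>2) = (\<Sum>i<n. (y i)\<^sup>2) / s"
      using s by (simp add: z_def power_divide sum_divide_distrib)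
    hence "z \<in> ?S" using s by (simp add: z_def s_def)
    hence "?Q z \<le> ?Q x" by (rule x)
    moreover have "?Q z = ?Q y / s"
      using s by (simp add: z_def sum_divide_distrib)
    ultimately show ?thesis using s by (simp add: field_simps s_def)
  qed
  thus ?thesis using x(1) by blast
qed

text \<open>Perturb x by \<open>t * h\<close>, where h is the residual of the eigenvalue equation.
  The first-order gain is \<open>2 * t * S\<close> with S the squared norm of h, and maximality
  bounds it by the second-order term \<open>t\<^sup>2 * c\<close>. The choice
  \<open>t = S / (c + 1)\<close> then forces S = 0.\<close>

lemma quadratic_form_maximizer_eigen:
  fixes A :: "nat \<Rightarrow> nat \<Rightarrow> real"
  assumes sym: "\<And>i j. A i j = A j i"
    and max: "\<And>y. (\<Sum>i<n. \<Sum>j<n. A i j * y i * y j) \<le> l * (\<Sum>i<n. (y i)\<^sup>2)"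
    and att: "(\<Sum>i<n. \<Sum>j<n. A i j * x i * x j) = l * (\<Sum>i<n. (x i)\<^sup>2)"
    and i: "i < n"
  shows "(\<Sum>j<n. A i j * x j) = l * x i"
proof -
  define h where "h i = (\<Sum>j<n. A i j * x j) - l * x i" for i
  let ?Q = "\<lambda>y. \<Sum>i<n. \<Sum>j<n. A i j * y i * y j"
  define S where "S = (\<Sum>i<n. (h i)\<^sup>2)"
  define c where "c = l * (\<Sum>i<n. (h i)\<^sup>2) - ?Q h"
  have c: "c \<ge> 0" using max[of h] by (simp add: c_def)
  have cross: "(\<Sum>i<n. \<Sum>j<n. A i j * h i * x j) = S + l * (\<Sum>i<n. h i * x i)"
  proof -
    have "(\<Sum>i<n. \<Sum>j<n. A i j * h i * x j) = (\<Sum>i<n. h i * (\<Sum>j<n. A i j * x j))"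
      by (simp add: sum_distrib_left mult_ac)
    also have "\<dots> = (\<Sum>i<n. h i * (h i + l * x i))" by (simp add: h_def)
    finally show ?thesis
      by (simp add: S_def algebra_simps sum.distrib sum_distrib_left power2_eq_square)
  qed
  have cross2: "(\<Sum>i<n. \<Sum>j<n. A i j * x i * h j) = (\<Sum>i<n. \<Sum>j<n. A i j * h i * x j)"
    by (subst sum.swap) (intro sum.cong, auto simp: sym mult_ac)
  have main: "2 * t * S \<le> t\<^sup>2 * c" for t
  proof -
    let ?y = "\<lambda>i. x i + t * h i"
    have "?Q ?y = ?Q x + t * (\<Sum>i<n. \<Sum>j<n. A i j * h i * x j)
        + t * (\<Sum>i<n. \<Sum>j<n. A i j * x i * h j) + t\<^sup>2 * ?Q h"
      by (simp add: sum_distrib_left sum.distrib algebra_simps power2_eq_square)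
    moreover have "(\<Sum>i<n. (?y i)\<^sup>2) = (\<Sum>i<n. (x i)\<^sup>2) + 2 * t * (\<Sum>i<n. h i * x i) + t\<^sup>2 * (\<Sum>i<n. (h i)\<^sup>2)"
      by (simp add: sum_distrib_left sum.distrib algebra_simps power2_eq_square)
    ultimately show ?thesis using max[of ?y] cross cross2 att
      by (simp add: c_def algebra_simps)
  qed
  have "S \<le> 0"
  proof (rule ccontr)
    assume "\<not> S \<le> 0"
    hence S: "S > 0" by simp
    have "2 * (S / (c+1)) * S \<le> (S / (c+1))\<^sup>2 * c" by (rule main)
    also have "\<dots> = (S / (c+1)) * S * (c / (c+1))" by (simp add: power2_eq_square)
    also have "\<dots> \<le> (S / (c+1)) * S * 1"
      using S c by (intro mult_left_mono) auto
    finally have "(S / (c+1)) * S \<le> 0" by simp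
    moreover have "(S / (c+1)) * S > 0" using S c by simp
    ultimately show False by simp
  qed
  hence "S = 0" unfolding S_def by (simp add: order_antisym sum_nonneg)
  hence "h i = 0" using i unfolding S_def by (simp add: sum_nonneg_eq_0_iff)
  thus ?thesis by (simp add: h_def)
qed

section \<open>Eigenvalues of the adjacency matrix\<close>

lemma adj_sym: "adj G i j = adj G j i"
  unfolding adj_def by (simp add: insert_commute)

lemma eigenvectors_orthogonal:
  assumes "\<forall>i<n. (\<Sum>j<n. adj G i j * x j) = a * x i"
    and "\<forall>i<n. (\<Sum>j<n. adj G i j * y j) = b * y i" and "a \<noteq> b"
  shows "(\<Sum>i<n. x i * y i) = 0"
proof -
  have "a * (\<Sum>i<n. x i * y i) = (\<Sum>i<n. (\<Sum>j<n. adj G i j * x j) * y i)"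
    using assms(1) by (simp add: sum_distrib_left mult_ac)
  also have "\<dots> = (\<Sum>i<n. \<Sum>j<n. adj G i j * x j * y i)" by (simp add: sum_distrib_right)
  also have "\<dots> = (\<Sum>j<n. \<Sum>i<n. adj G i j * x j * y i)" by (rule sum.swap)
  also have "\<dots> = (\<Sum>j<n. x j * (\<Sum>i<n. adj G j i * y i))"
    by (simp add: sum_distrib_left mult_ac adj_sym)
  also have "\<dots> = b * (\<Sum>i<n. x i * y i)"
    using assms(2) by (simp add: sum_distrib_left mult_ac)
  finally show ?thesis using assms(3) by simp
qed

text \<open>Bessel's inequality for the unit vectors bounds the size of an orthonormal family by \<open>n\<close>.\<close>

lemma finite_eigenvalues: "finite {mu. is_eigenvalue n G mu}"
proof (rule ccontr)
  assume "infinite {mu. is_eigenvalue n G mu}"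
  then obtain T where T: "T \<subseteq> {mu. is_eigenvalue n G mu}" "finite T" "card T = n + 1"
    using infinite_arbitrarily_large by blast
  have "\<exists>x :: nat \<Rightarrow> real. (\<Sum>i<n. (x i)\<^sup>2) = 1 \<and> (\<forall>i<n. (\<Sum>j<n. adj G i j * x j) = mu * x i)" if mT: "mu \<in> T" for mu
  proof -
    obtain x :: "nat \<Rightarrow> real" where x: "\<exists>i<n. x i \<noteq> 0" "\<forall>i<n. (\<Sum>j<n. adj G i j * x j) = mu * x i"
    proof -
      have "is_eigenvalue n G mu" using mT T(1) by blast
      thus ?thesis using that unfolding is_eigenvalue_def by metis
    qed
    define s where "s = (\<Sum>i<n. (x i)\<^sup>2)"
    have "s \<noteq> 0" using x(1) unfolding s_def by (auto simp: sum_nonneg_eq_0_iff)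
    hence s: "s > 0" unfolding s_def by (simp add: less_le sum_nonneg)
    have "(\<Sum>i<n. (x i / sqrt s)\<^sup>2) = (\<Sum>i<n. (x i)\<^sup>2) / s"
      using s by (simp add: power_divide sum_divide_distrib)
    hence "(\<Sum>i<n. (x i / sqrt s)\<^sup>2) = 1" using s s_def by simp
    moreover have "\<forall>i<n. (\<Sum>j<n. adj G i j * (x j / sqrt s)) = mu * (x i / sqrt s)"
      using x(2) by (simp add: sum_divide_distrib[symmetric])
    ultimately show ?thesis by (intro exI[of _ "\<lambda>i. x i / sqrt s"] conjI)
  qed
  then obtain f where f: "\<And>mu. mu \<in> T \<Longrightarrow> (\<Sum>i<n. (f mu i)\<^sup>2) = 1"
      "\<And>mu. mu \<in> T \<Longrightarrow> \<forall>i<n. (\<Sum>j<n. adj G i j * f mu j) = mu * f mu i" by metis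
  have on: "(\<Sum>i<n. f a i * f b i) = of_bool (a = b)" if "a \<in> T" "b \<in> T" for a b
  proof (cases "a = b")
    case True thus ?thesis using f(1)[OF that(1)] by (simp add: power2_eq_square)
  next
    case False thus ?thesis using eigenvectors_orthogonal[OF f(2)[OF that(1)] f(2)[OF that(2)]] by simp
  qed
  have bessel: "(\<Sum>a\<in>T. (f a k)\<^sup>2) \<le> 1" if k: "k < n" for k
  proof -
    define g where "g i = (\<Sum>a\<in>T. f a k * f a i)" for i
    have 1: "(\<Sum>i<n. of_bool (i = k) * g i) = (\<Sum>a\<in>T. (f a k)\<^sup>2)"
    proof -
      have "(\<Sum>i<n. of_bool (i = k) * g i) = (\<Sum>i<n. if i = k then g i else 0)"
        by (intro sum.cong) auto
      also have "\<dots> = g k" using k by (simp add: sum.delta)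
      finally show ?thesis by (simp add: g_def power2_eq_square)
    qed
    have 2: "(\<Sum>i<n. g i * g i) = (\<Sum>a\<in>T. (f a k)\<^sup>2)"
    proof -
      have "(\<Sum>i<n. g i * g i) = (\<Sum>i<n. \<Sum>a\<in>T. \<Sum>b\<in>T. f a k * f b k * (f a i * f b i))"
        unfolding g_def sum_product by (intro sum.cong) auto
      also have "\<dots> = (\<Sum>a\<in>T. \<Sum>i<n. \<Sum>b\<in>T. f a k * f b k * (f a i * f b i))" by (rule sum.swap)
      also have "\<dots> = (\<Sum>a\<in>T. \<Sum>b\<in>T. \<Sum>i<n. f a k * f b k * (f a i * f b i))"
        by (intro sum.cong refl sum.swap)
      also have "\<dots> = (\<Sum>a\<in>T. \<Sum>b\<in>T. f a k * f b k * of_bool (a = b))"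
        by (simp add: sum_distrib_left[symmetric] on cong: sum.cong)
      also have "\<dots> = (\<Sum>a\<in>T. \<Sum>b\<in>T. if b = a then f a k * f b k else 0)"
        by (intro sum.cong) auto
      also have "\<dots> = (\<Sum>a\<in>T. f a k * f a k)" using T(2) by (intro sum.cong) (auto simp: sum.delta)
      finally show ?thesis by (simp add: power2_eq_square)
    qed
    have 3: "(\<Sum>i<n. (of_bool (i = k))\<^sup>2) = (1::real)"
    proof -
      have "(\<Sum>i<n. (of_bool (i = k))\<^sup>2) = (\<Sum>i<n. if i = k then 1 else (0::real))"
        by (intro sum.cong) auto
      thus ?thesis using k by (simp add: sum.delta)
    qed
    have "0 \<le> (\<Sum>i<n. (of_bool (i = k) - g i)\<^sup>2)" by (intro sum_nonneg) auto
    also have "\<dots> = (\<Sum>i<n. (of_bool (i = k))\<^sup>2) - 2 * (\<Sum>i<n. of_bool (i = k) * g i) + (\<Sum>i<n. g i * g i)"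
      unfolding power2_eq_square sum_distrib_left sum_subtractf[symmetric] sum.distrib[symmetric]
      by (intro sum.cong) (auto simp: algebra_simps)
    finally show ?thesis using 1 2 3 by simp
  qed
  have "real (n + 1) = (\<Sum>a\<in>T. \<Sum>k<n. (f a k)\<^sup>2)" using T f(1) by simp
  also have "\<dots> = (\<Sum>k<n. \<Sum>a\<in>T. (f a k)\<^sup>2)" by (rule sum.swap)
  also have "\<dots> \<le> (\<Sum>k<n. 1)" by (intro sum_mono) (auto intro: bessel)
  finally show False by simp
qed

text \<open>The maximum of the Rayleigh quotient is an eigenvalue and bounds all others; as there
  are finitely many, \<open>Max\<close> in \<open>spectral_radius\<close> is a genuine maximum. For
  the second part, absolute values do not lower the form because the entries of the matrix are
  nonnegative. Scaling to total square n makes the all-ones vector the model case.\<close>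

lemma spectral_radius_variational:
  assumes "n \<ge> 1"
  shows "(\<Sum>i<n. \<Sum>j<n. adj G i j * y i * y j) \<le> spectral_radius n G * (\<Sum>i<n. (y i)\<^sup>2)"
    and "\<exists>x :: nat \<Rightarrow> real. (\<forall>i. 0 \<le> x i) \<and> (\<Sum>i<n. (x i)\<^sup>2) = n \<and>
          (\<Sum>i<n. \<Sum>j<n. adj G i j * x i * x j) = spectral_radius n G * n"
proof -
  let ?Q = "\<lambda>y. \<Sum>i<n. \<Sum>j<n. adj G i j * y i * y j"
  obtain x where x: "(\<Sum>i<n. (x i)\<^sup>2) = 1" "\<And>y. ?Q y \<le> ?Q x * (\<Sum>i<n. (y i)\<^sup>2)"
    using quadratic_form_max[OF assms, of "adj G"] by blast
  define l where "l = ?Q x"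
  have "(\<Sum>j<n. adj G i j * x j) = l * x i" if "i < n" for i
    by (rule quadratic_form_maximizer_eigen[OF adj_sym])
      (use x that in \<open>auto simp: l_def\<close>)
  moreover have "\<exists>i<n. x i \<noteq> 0"
  proof (rule ccontr)
    assume "\<not> (\<exists>i<n. x i \<noteq> 0)"
    hence "(\<Sum>i<n. (x i)\<^sup>2) = 0" by simp
    thus False using x(1) by simp
  qed
  ultimately have ev: "is_eigenvalue n G l" unfolding is_eigenvalue_def by blast
  have "mu \<le> l" if mu: "is_eigenvalue n G mu" for mu
  proof -
    obtain y where y: "\<exists>i<n. y i \<noteq> 0" "\<forall>i<n. (\<Sum>j<n. adj G i j * y j) = mu * y i"
      using mu unfolding is_eigenvalue_def by blast
    have "(\<Sum>i<n. (y i)\<^sup>2) \<noteq> 0" using y(1) by (auto simp: sum_nonneg_eq_0_iff)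
    hence s: "(\<Sum>i<n. (y i)\<^sup>2) > 0" by (simp add: less_le sum_nonneg)
    have "?Q y = (\<Sum>i<n. y i * (\<Sum>j<n. adj G i j * y j))"
      by (simp add: sum_distrib_left mult_ac)
    also have "\<dots> = mu * (\<Sum>i<n. (y i)\<^sup>2)"
      using y(2) by (simp add: sum_distrib_left power2_eq_square mult_ac)
    finally show ?thesis using x(2)[of y] s by (simp add: l_def)
  qed
  hence sr: "spectral_radius n G = l"
    unfolding spectral_radius_def using ev by (intro Max_eqI finite_eigenvalues) auto
  show "?Q y \<le> spectral_radius n G * (\<Sum>i<n. (y i)\<^sup>2)" using x(2) sr l_def by simp
  define z where "z i = sqrt n * \<bar>x i\<bar>" for i
  have z1: "(\<Sum>i<n. (z i)\<^sup>2) = n"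
    using x(1) by (simp add: z_def power_mult_distrib sum_distrib_left[symmetric])
  have "?Q z = n * ?Q (\<lambda>i. \<bar>x i\<bar>)"
  proof -
    have "adj G i j * z i * z j = n * (adj G i j * \<bar>x i\<bar> * \<bar>x j\<bar>)" for i j
    proof -
      have "adj G i j * z i * z j = (sqrt n * sqrt n) * (adj G i j * \<bar>x i\<bar> * \<bar>x j\<bar>)"
        unfolding z_def by (simp only: mult_ac)
      thus ?thesis by simp
    qed
    hence "?Q z = (\<Sum>i<n. \<Sum>j<n. n * (adj G i j * \<bar>x i\<bar> * \<bar>x j\<bar>))"
      by (intro sum.cong refl) blast
    thus ?thesis by (simp add: sum_distrib_left)
  qed
  moreover have "l * n \<le> ?Q (\<lambda>i. \<bar>x i\<bar>) * n" unfolding l_def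
  proof (intro sum_mono mult_right_mono)
    fix i j
    have "x i * x j \<le> \<bar>x i\<bar> * \<bar>x j\<bar>" by (metis abs_ge_self abs_mult)
    thus "adj G i j * x i * x j \<le> adj G i j * \<bar>x i\<bar> * \<bar>x j\<bar>" by (simp add: adj_def)
  qed simp
  moreover have "?Q z \<le> l * n" using x(2)[of z] z1 by (simp add: l_def)
  ultimately have "?Q z = l * n" by (simp add: mult.commute)
  thus "\<exists>x :: nat \<Rightarrow> real. (\<forall>i. 0 \<le> x i) \<and> (\<Sum>i<n. (x i)\<^sup>2) = n \<and> ?Q x = spectral_radius n G * n"
    using z1 sr by (intro exI[of _ z]) (auto simp: z_def)
qed

section \<open>Perron vectors of adjacency relations\<close>

definition lam :: "nat \<Rightarrow> (nat \<Rightarrow> nat \<Rightarrow> bool) \<Rightarrow> real" where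
  "lam n E = spectral_radius n (edge_set E)"

lemma adj_edge_set: "graph_on n E \<Longrightarrow> adj (edge_set E) u v = of_bool (E u v)"
  by (simp add: adj_def mem_edge_set)

lemma quad_le_lam:
  assumes "n \<ge> 1" "graph_on n E"
  shows "quad n E y \<le> lam n E * (\<Sum>i<n. (y i)\<^sup>2)"
  using spectral_radius_variational(1)[OF assms(1), of "edge_set E" y]
  by (simp add: quad_def lam_def adj_edge_set[OF assms(2)])

lemma quad_maximizer_eigen:
  assumes "n \<ge> 1" "graph_on n E" "quad n E x = lam n E * (\<Sum>i<n. (x i)\<^sup>2)" "i < n"
  shows "(\<Sum>j<n. of_bool (E i j) * x j) = lam n E * x i"
proof (rule quadratic_form_maximizer_eigen)
  show "of_bool (E i j) = (of_bool (E j i) :: real)" for i j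
    using graph_on_sym[OF assms(2), of i j] by simp
qed (use assms quad_le_lam[OF assms(1,2)] in \<open>auto simp: quad_def\<close>)

lemma perron_vector:
  assumes "n \<ge> 1" "graph_on n E"
  obtains z :: "nat \<Rightarrow> real" where "\<And>i. 0 \<le> z i" "(\<Sum>i<n. (z i)\<^sup>2) = n" "quad n E z = lam n E * n"
    "\<And>i. i < n \<Longrightarrow> (\<Sum>j<n. of_bool (E i j) * z j) = lam n E * z i"
proof -
  obtain z :: "nat \<Rightarrow> real" where z: "\<And>i. 0 \<le> z i" "(\<Sum>i<n. (z i)\<^sup>2) = n" "quad n E z = lam n E * n"
    using spectral_radius_variational(2)[OF assms(1), of "edge_set E"]
    by (auto simp: quad_def lam_def adj_edge_set[OF assms(2)])
  moreover have "(\<Sum>j<n. of_bool (E i j) * z j) = lam n E * z i" if "i < n" for i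
    by (rule quad_maximizer_eigen[OF assms]) (use z that in auto)
  ultimately show ?thesis using that by blast
qed

section \<open>Fans and star forests of cliques\<close>

text \<open>The blow-up of a star with k edges and centre v, where each petal \<open>X a\<close> is
  one of its cliques without the centre. Only the petals have to avoid Y; the centre may lie in Y,
  so that Y can contain all centres of a star forest.\<close>

definition fan :: "nat \<Rightarrow> (nat \<Rightarrow> nat \<Rightarrow> bool) \<Rightarrow> nat \<Rightarrow> nat set \<Rightarrow> nat \<Rightarrow> (nat \<Rightarrow> nat set) \<Rightarrow> bool" where
  "fan p E k Y v X \<longleftrightarrow>
     (\<forall>a<k. finite (X a) \<and> card (X a) = p \<and> v \<notin> X a \<and> X a \<inter> Y = {} \<and> clique E (insert v (X a))) \<and>
     (\<forall>a<k. \<forall>b<k. a \<noteq> b \<longrightarrow> X a \<inter> X b = {})"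

definition has_fan :: "nat \<Rightarrow> (nat \<Rightarrow> nat \<Rightarrow> bool) \<Rightarrow> nat \<Rightarrow> nat set \<Rightarrow> nat \<Rightarrow> bool" where
  "has_fan p E k Y v \<longleftrightarrow> (\<exists>X. fan p E k Y v X)"

lemma fanD:
  assumes "fan p E k Y v X" "a < k"
  shows "finite (X a)" "card (X a) = p" "v \<notin> X a" "X a \<inter> Y = {}" "clique E (insert v (X a))"
    "\<And>b. b < k \<Longrightarrow> a \<noteq> b \<Longrightarrow> X a \<inter> X b = {}"
  using assms unfolding fan_def by blast+

lemma cliqueD: "clique E X \<Longrightarrow> u \<in> X \<Longrightarrow> v \<in> X \<Longrightarrow> u \<noteq> v \<Longrightarrow> E u v"
  unfolding clique_def by blast

lemma fan_mono: "fan p E k Y v X \<Longrightarrow> k' \<le> k \<Longrightarrow> Y' \<subseteq> Y \<Longrightarrow> fan p E k' Y' v X"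
  unfolding fan_def by (meson disjoint_iff order_less_le_trans subsetD)

text \<open>If a disjoint family cannot be extended, its union meets every member of F.\<close>

lemma disjoint_family_or_hitting_set:
  assumes "\<And>X. X \<in> F \<Longrightarrow> finite X \<and> card X = s"
  shows "(\<exists>X :: nat \<Rightarrow> 'a set. (\<forall>a<M. X a \<in> F) \<and> (\<forall>a<M. \<forall>b<M. a \<noteq> b \<longrightarrow> X a \<inter> X b = {})) \<or>
    (\<exists>T. finite T \<and> card T \<le> s * M \<and> (\<forall>X\<in>F. X \<inter> T \<noteq> {}))"
proof (induction M)
  case 0 thus ?case by auto
next
  case (Suc M)
  show ?case
  proof (cases "\<exists>X :: nat \<Rightarrow> 'a set. (\<forall>a<M. X a \<in> F) \<and> (\<forall>a<M. \<forall>b<M. a \<noteq> b \<longrightarrow> X a \<inter> X b = {})")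
    case True
    then obtain X :: "nat \<Rightarrow> 'a set" where X: "\<And>a. a < M \<Longrightarrow> X a \<in> F"
      "\<And>a b. a < M \<Longrightarrow> b < M \<Longrightarrow> a \<noteq> b \<Longrightarrow> X a \<inter> X b = {}" by blast
    define T where "T = (\<Union>a<M. X a)"
    have fT: "finite T" unfolding T_def using X(1) assms by auto
    have "card T \<le> (\<Sum>a<M. card (X a))" unfolding T_def by (rule card_UN_le) simp
    also have "\<dots> = s * M" using X(1) assms by simp
    finally have cT: "card T \<le> s * Suc M" by simp
    show ?thesis
    proof (cases "\<forall>Y\<in>F. Y \<inter> T \<noteq> {}")
      case True thus ?thesis using fT cT by blast
    next
      case False
      then obtain Y where Y: "Y \<in> F" "Y \<inter> T = {}" by blast
      have "(X(M := Y)) a \<in> F" if "a < Suc M" for a using that X Y by (auto simp: less_Suc_eq)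
      moreover have "(X(M := Y)) a \<inter> (X(M := Y)) b = {}" if "a < Suc M" "b < Suc M" "a \<noteq> b" for a b
        using that X(2)[of a b] Y(2) unfolding T_def by (auto simp: less_Suc_eq)
      ultimately show ?thesis by (intro disjI1 exI[of _ "X(M := Y)"]) auto
    qed
  next
    case False
    then obtain T where "finite T" "card T \<le> s * M" "\<forall>X\<in>F. X \<inter> T \<noteq> {}" using Suc by blast
    moreover from this have "card T \<le> s * Suc M" by simp
    ultimately show ?thesis by blast
  qed
qed

text \<open>Petals are disjoint, so each element of Y spoils at most one of them.\<close>

lemma fan_avoid:
  assumes f: "fan p E M {} v X" and Y: "finite Y" "card Y + k \<le> M"
  shows "has_fan p E k Y v"
proof -
  define B where "B = {a. a < M \<and> X a \<inter> Y \<noteq> {}}"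
  have "\<exists>g. \<forall>a\<in>B. g a \<in> X a \<inter> Y" unfolding B_def by (intro bchoice) blast
  then obtain g where g: "\<And>a. a \<in> B \<Longrightarrow> g a \<in> X a \<inter> Y" by blast
  have "inj_on g B"
  proof (rule inj_onI)
    fix a b assume ab: "a \<in> B" "b \<in> B" "g a = g b"
    show "a = b"
    proof (rule ccontr)
      assume "a \<noteq> b"
      hence "X a \<inter> X b = {}" using fanD(6)[OF f] ab by (auto simp: B_def)
      thus False using g[OF ab(1)] g[OF ab(2)] ab(3) by auto
    qed
  qed
  moreover have "g ` B \<subseteq> Y" using g by blast
  ultimately have cB: "card B \<le> card Y" using Y(1) card_inj_on_le by blast
  have "finite B" "B \<subseteq> {..<M}" unfolding B_def by auto
  hence "card ({..<M} - B) = M - card B" by (simp add: card_Diff_subset)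
  hence "k \<le> card ({..<M} - B)" using cB Y(2) by simp
  then obtain S where S: "S \<subseteq> {..<M} - B" "card S = k" "finite S"
    by (meson obtain_subset_with_card_n)
  obtain h where h: "bij_betw h {0..<k} S" using ex_bij_betw_nat_finite[OF S(3)] S(2) by blast
  have hS: "h a < M \<and> X (h a) \<inter> Y = {}" if "a < k" for a
  proof -
    have "h a \<in> S" using h that by (auto simp: bij_betw_def)
    thus ?thesis using S(1) unfolding B_def by auto
  qed
  have "fan p E k Y v (\<lambda>a. X (h a))"
    unfolding fan_def
  proof (intro conjI allI impI)
    fix a b assume ab: "a < k" "b < k" "a \<noteq> b"
    have "h a \<noteq> h b" using h ab unfolding bij_betw_def inj_on_def by auto
    thus "X (h a) \<inter> X (h b) = {}" using fanD(6)[OF f] hS ab by blast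
  qed (use fanD[OF f] hS in auto)
  thus ?thesis unfolding has_fan_def by blast
qed

text \<open>The fans are chosen one after another out of the M petals at each centre, avoiding Y and
  the petals already taken.\<close>

lemma greedy_fans:
  fixes m :: nat and k :: "nat \<Rightarrow> nat"
  assumes "finite Y" "\<And>i. i < m \<Longrightarrow> has_fan p E M {} (c i)"
    and "card Y + (p + 1) * (\<Sum>i<m. k i) \<le> M"
  shows "\<exists>X. (\<forall>i<m. fan p E (k i) Y (c i) (X i)) \<and>
    (\<forall>i<m. \<forall>j<m. i \<noteq> j \<longrightarrow> (\<Union>a<k i. X i a) \<inter> (\<Union>a<k j. X j a) = {})"
  using assms(2,3)
proof (induction m)
  case 0 thus ?case by auto
next
  case (Suc m)
  have "\<exists>X. (\<forall>i<m. fan p E (k i) Y (c i) (X i)) \<and>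
    (\<forall>i<m. \<forall>j<m. i \<noteq> j \<longrightarrow> (\<Union>a<k i. X i a) \<inter> (\<Union>a<k j. X j a) = {})"
  proof (rule Suc.IH)
    have "(p + 1) * (\<Sum>i<m. k i) \<le> (p + 1) * (\<Sum>i<Suc m. k i)" by (intro mult_le_mono2) simp
    thus "card Y + (p + 1) * (\<Sum>i<m. k i) \<le> M" using Suc.prems(2) by linarith
  qed (use Suc.prems(1) in simp)
  then obtain X where X0: "\<forall>i<m. fan p E (k i) Y (c i) (X i)"
    "\<forall>i<m. \<forall>j<m. i \<noteq> j \<longrightarrow> (\<Union>a<k i. X i a) \<inter> (\<Union>a<k j. X j a) = {}" by (elim exE conjE)
  note X = X0(1)[rule_format] X0(2)[rule_format]
  define U where "U = (\<Union>i<m. \<Union>a<k i. X i a)"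
  have fU: "finite U" unfolding U_def using fanD(1)[OF X(1)] by auto
  have "card U \<le> (\<Sum>i<m. card (\<Union>a<k i. X i a))" unfolding U_def by (rule card_UN_le) simp
  also have "\<dots> \<le> (\<Sum>i<m. p * k i)"
  proof (rule sum_mono)
    fix i assume i: "i \<in> {..<m}"
    have "card (\<Union>a<k i. X i a) \<le> (\<Sum>a<k i. card (X i a))" by (rule card_UN_le) simp
    also have "\<dots> = p * k i" using fanD(2)[OF X(1)] i by simp
    finally show "card (\<Union>a<k i. X i a) \<le> p * k i" .
  qed
  finally have cU: "card U \<le> p * (\<Sum>i<m. k i)" by (simp add: sum_distrib_left)
  obtain Z0 where Z0: "fan p E M {} (c m) Z0" using Suc.prems(1)[of m] unfolding has_fan_def by auto
  have "card (Y \<union> U) + k m \<le> M"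
  proof -
    have "card (Y \<union> U) \<le> card Y + card U" by (rule card_Un_le)
    thus ?thesis using cU Suc.prems(2) by (simp add: algebra_simps)
  qed
  then obtain Z where Z: "fan p E (k m) (Y \<union> U) (c m) Z"
    using fan_avoid[OF Z0, of "Y \<union> U" "k m"] assms(1) fU unfolding has_fan_def by auto
  have ZU: "(\<Union>a<k m. Z a) \<inter> (\<Union>a<k i. X i a) = {}" if "i < m" for i
    using fanD(4)[OF Z] that unfolding U_def by blast
  let ?X = "X(m := Z)"
  have "fan p E (k i) Y (c i) (?X i)" if "i < Suc m" for i
  proof (cases "i = m")
    case True thus ?thesis using fan_mono[OF Z, of "k m" Y] by simp
  next
    case False thus ?thesis using X(1) that by simp
  qed
  moreover have "(\<Union>a<k i. ?X i a) \<inter> (\<Union>a<k j. ?X j a) = {}" if ij: "i < Suc m" "j < Suc m" "i \<noteq> j" for i j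
  proof -
    consider "i = m" "j < m" | "j = m" "i < m" | "i < m" "j < m" using ij by linarith
    thus ?thesis
    proof cases
      case 1 thus ?thesis using ZU[of j] by simp
    next
      case 2 thus ?thesis using ZU[of i] by (simp add: Int_commute)
    next
      case 3 thus ?thesis using X(2)[of i j] ij(3) by simp
    qed
  qed
  ultimately show ?case by blast
qed

section \<open>Blow-ups of star forests as families of disjoint fans\<close>

lemma SF_verts_iff:
  "(i, a, b) \<in> SF_verts p ks \<longleftrightarrow>
    i < length ks \<and> ((a = 0 \<and> b = 0 \<and> ks ! i \<ge> 1) \<or> (1 \<le> a \<and> a \<le> ks ! i \<and> b < p))"
  unfolding SF_verts_def blowup_clique_def by (auto intro: bexI[of _ 1] bexI[of _ a])

lemma finite_SF_verts: "finite (SF_verts p ks)"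
proof -
  have "blowup_clique p i a = insert (i, 0, 0) ((\<lambda>b. (i, a, b)) ` {..<p})" for i a
    unfolding blowup_clique_def by auto
  thus ?thesis unfolding SF_verts_def by auto
qed

definition star_support :: "nat \<Rightarrow> nat \<Rightarrow> (nat \<Rightarrow> nat set) \<Rightarrow> nat set" where
  "star_support k v X = insert v (\<Union>a<k. X a)"

text \<open>With \<open>contains_SF_D\<close> this translates containment of the encoded blow-up
  into pairwise disjoint fans. Cliques of the blow-up are numbered from 1, the index 0 being
  reserved for the centre, whereas petals are numbered from 0; hence the shift
  \<open>a - 1\<close>.\<close>

lemma contains_SF_I:
  assumes g: "graph_on n E" and p: "p \<ge> 1" and ks: "\<And>i. i < length ks \<Longrightarrow> ks ! i \<ge> 1"
    and f: "\<And>i. i < length ks \<Longrightarrow> fan p E (ks ! i) {} (c i) (X i)"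
    and d: "\<And>i j. i < length ks \<Longrightarrow> j < length ks \<Longrightarrow> i \<noteq> j \<Longrightarrow>
      star_support (ks ! i) (c i) (X i) \<inter> star_support (ks ! j) (c j) (X j) = {}"
  shows "contains_SF p ks n (edge_set E)"
proof -
  have "\<exists>h. bij_betw h {0..<p} (X i a)" if "i < length ks" "a < ks ! i" for i a
    using ex_bij_betw_nat_finite fanD(1,2)[OF f[OF that(1)] that(2)] by metis
  then obtain h where h: "\<And>i a. i < length ks \<Longrightarrow> a < ks ! i \<Longrightarrow> bij_betw (h i a) {0..<p} (X i a)"
    by metis
  define \<phi> where "\<phi> = (\<lambda>(i, a, b). if a = 0 then c i else h i (a - 1) b)"
  have mem: "\<phi> (i, a, b) \<in> X i (a - 1)" if "i < length ks" "1 \<le> a" "a \<le> ks ! i" "b < p" for i a b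
  proof -
    have "a - 1 < ks ! i" using that by simp
    hence "bij_betw (h i (a - 1)) {0..<p} (X i (a - 1))" by (rule h[OF that(1)])
    hence "h i (a - 1) b \<in> X i (a - 1)" using that(4) bij_betwE by fastforce
    thus ?thesis using that(2) unfolding \<phi>_def by simp
  qed
  have c: "\<phi> (i, 0, b) = c i" for i b unfolding \<phi>_def by simp
  have sup: "\<phi> (i, a, b) \<in> star_support (ks ! i) (c i) (X i)" if "(i, a, b) \<in> SF_verts p ks" for i a b
  proof (cases "a = 0")
    case True thus ?thesis by (simp add: c star_support_def)
  next
    case False
    hence "i < length ks" "1 \<le> a" "a \<le> ks ! i" "b < p" using that by (auto simp: SF_verts_iff)
    moreover from this have "a - 1 < ks ! i" by simp
    ultimately show ?thesis using mem unfolding star_support_def by blast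
  qed
  have inj: "inj_on \<phi> (SF_verts p ks)"
  proof (rule inj_onI)
    fix u v assume uv: "u \<in> SF_verts p ks" "v \<in> SF_verts p ks" "\<phi> u = \<phi> v"
    obtain i a b i' a' b' where tup: "u = (i, a, b)" "v = (i', a', b')" by (cases u; cases v) auto
    have A: "(i, a, b) \<in> SF_verts p ks" "(i', a', b') \<in> SF_verts p ks" "\<phi> (i, a, b) = \<phi> (i', a', b')"
      using uv unfolding tup by auto
    have il: "i < length ks" "i' < length ks" using A by (auto simp: SF_verts_iff)
    have ii: "i = i'"
    proof (rule ccontr)
      assume "i \<noteq> i'"
      thus False using d[OF il] sup[OF A(1)] sup[OF A(2)] A(3) by auto
    qed
    have nc: "\<phi> (i, x, y) \<noteq> c i" if "(i, x, y) \<in> SF_verts p ks" "x \<noteq> 0" for x y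
    proof -
      have "1 \<le> x" "x \<le> ks ! i" "y < p" using that by (auto simp: SF_verts_iff)
      thus ?thesis using mem[OF il(1), of x y] fanD(3)[OF f[OF il(1)], of "x - 1"] by auto
    qed
    have "i = i' \<and> a = a' \<and> b = b'"
    proof (cases "a = 0 \<or> a' = 0")
      case True
      have "a = 0 \<longleftrightarrow> a' = 0" using nc A ii c by metis
      hence "a = 0" "a' = 0" using True by auto
      thus ?thesis using A ii by (auto simp: SF_verts_iff)
    next
      case False
      hence B: "1 \<le> a" "a \<le> ks ! i" "b < p" "1 \<le> a'" "a' \<le> ks ! i" "b' < p"
        using A ii by (auto simp: SF_verts_iff)
      have "a - 1 = a' - 1"
      proof (rule ccontr)
        assume "a - 1 \<noteq> a' - 1"
        hence "X i (a - 1) \<inter> X i (a' - 1) = {}" using fanD(6)[OF f[OF il(1)]] B by auto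
        thus False using mem[OF il(1) B(1-3)] mem[OF il(1) B(4-6)] A(3) ii by auto
      qed
      hence aa: "a = a'" using B by simp
      have "h i (a - 1) b = h i (a - 1) b'" using A(3) ii aa False unfolding \<phi>_def by simp
      moreover have "inj_on (h i (a - 1)) {0..<p}" using h[OF il(1), of "a - 1"] B by (auto simp: bij_betw_def)
      ultimately have "b = b'" using B by (auto simp: inj_on_def)
      thus ?thesis using ii aa by simp
    qed
    thus "u = v" unfolding tup by simp
  qed
  have adj: "E (\<phi> u) (\<phi> v)" if uv: "u \<in> SF_verts p ks" "v \<in> SF_verts p ks" "SF_adj p ks u v" for u v
  proof -
    obtain i a where ia: "i < length ks" "1 \<le> a" "a \<le> ks ! i" "u \<in> blowup_clique p i a" "v \<in> blowup_clique p i a"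
      and ne: "u \<noteq> v" using uv(3) unfolding SF_adj_def by auto
    have "\<phi> w \<in> insert (c i) (X i (a - 1))" if "w \<in> blowup_clique p i a" for w
      using that mem[OF ia(1-3)] c unfolding blowup_clique_def by auto
    hence "\<phi> u \<in> insert (c i) (X i (a - 1))" "\<phi> v \<in> insert (c i) (X i (a - 1))" using ia by auto
    moreover have "\<phi> u \<noteq> \<phi> v" using inj uv ne by (auto simp: inj_on_def)
    moreover have "clique E (insert (c i) (X i (a - 1)))" using fanD(5)[OF f[OF ia(1)]] ia by auto
    ultimately show ?thesis unfolding clique_def by blast
  qed
  have "\<phi> u < n" if u: "u \<in> SF_verts p ks" for u
  proof -
    obtain i a b where uu: "u = (i, a, b)" by (cases u) auto
    have i: "i < length ks" "ks ! i \<ge> 1" using u ks uu by (auto simp: SF_verts_iff)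
    \<comment> \<open>A fan does not bound its vertices by definition, so
      \<open>\<phi> u < n\<close> is derived from an edge at u. A centre has a = 0 and is then
      viewed as a member of its first clique.\<close>
    define a' where "a' = max a 1"
    have a': "1 \<le> a'" "a' \<le> ks ! i" "u \<in> blowup_clique p i a'"
      using u i uu by (auto simp: SF_verts_iff a'_def blowup_clique_def)
    obtain v where v: "v \<in> blowup_clique p i a'" "u \<noteq> v"
    proof (cases "a = 0")
      case True
      have "(i, a', 0) \<in> blowup_clique p i a'" using p by (auto simp: blowup_clique_def)
      thus ?thesis using that True uu a' by auto
    next
      case False
      have "(i, 0, 0) \<in> blowup_clique p i a'" by (auto simp: blowup_clique_def)
      thus ?thesis using that False uu by auto
    qed
    have "v \<in> SF_verts p ks" using v(1) i(1) a' unfolding SF_verts_def by (intro UN_I[of i] UN_I[of a']) auto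
    moreover have "SF_adj p ks u v" using v i(1) a' unfolding SF_adj_def
      by (intro conjI exI[of _ i] bexI[of _ a']) auto
    ultimately have "E (\<phi> u) (\<phi> v)" using adj u by blast
    thus ?thesis using graph_onD[OF g] by blast
  qed
  hence "\<phi> ` SF_verts p ks \<subseteq> {..<n}" by auto
  moreover have "{\<phi> u, \<phi> v} \<in> edge_set E" if "u \<in> SF_verts p ks" "v \<in> SF_verts p ks" "SF_adj p ks u v" for u v
    using adj[OF that] unfolding edge_set_def by blast
  ultimately show ?thesis using inj unfolding contains_SF_def by blast
qed

lemma contains_SF_D:
  assumes g: "graph_on n E" and ks: "\<And>i. i < length ks \<Longrightarrow> ks ! i \<ge> 1"
    and c: "contains_SF p ks n (edge_set E)"
  shows "\<exists>c X. (\<forall>i<length ks. fan p E (ks ! i) {} (c i) (X i)) \<and>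
    (\<forall>i<length ks. \<forall>j<length ks. i \<noteq> j \<longrightarrow>
      star_support (ks ! i) (c i) (X i) \<inter> star_support (ks ! j) (c j) (X j) = {})"
proof -
  obtain f where f: "inj_on f (SF_verts p ks)" 
    "\<And>u v. u \<in> SF_verts p ks \<Longrightarrow> v \<in> SF_verts p ks \<Longrightarrow> SF_adj p ks u v \<Longrightarrow> {f u, f v} \<in> edge_set E"
    using c unfolding contains_SF_def by blast
  have adj: "E (f u) (f v)" if "u \<in> SF_verts p ks" "v \<in> SF_verts p ks" "SF_adj p ks u v" for u v
    using f(2)[OF that] by (simp add: mem_edge_set[OF g])
  define S where "S i a = (\<lambda>b. (i, Suc a, b)) ` {..<p}" for i a :: nat
  have Sv: "S i a \<subseteq> SF_verts p ks" if "i < length ks" "a < ks ! i" for i a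
    using that by (auto simp: S_def SF_verts_iff)
  have cv: "(i, 0, 0) \<in> SF_verts p ks" if "i < length ks" for i using that ks by (auto simp: SF_verts_iff)
  define c where "c i = f (i, 0, 0)" for i
  define X where "X i a = f ` S i a" for i a
  have 1: "fan p E (ks ! i) {} (c i) (X i)" if i: "i < length ks" for i
    unfolding fan_def
  proof (intro conjI allI impI)
    fix a assume a: "a < ks ! i"
    show "finite (X i a)" by (simp add: X_def S_def)
    have "card (X i a) = card (S i a)" unfolding X_def using Sv[OF i a] f(1)
      by (intro card_image) (auto intro: inj_on_subset)
    also have "\<dots> = p" unfolding S_def by (subst card_image) (auto simp: inj_on_def)
    finally show "card (X i a) = p" .
    show "c i \<notin> X i a"
    proof
      assume "c i \<in> X i a"
      then obtain s where s: "s \<in> S i a" "f (i, 0, 0) = f s" unfolding c_def X_def by auto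
      hence "(i, 0, 0) = s" using f(1) cv[OF i] Sv[OF i a] unfolding inj_on_def by blast
      thus False using s(1) by (auto simp: S_def)
    qed
    show "X i a \<inter> {} = {}" by simp
    show "clique E (insert (c i) (X i a))" unfolding clique_def
    proof (intro ballI impI)
      fix x y assume xy: "x \<in> insert (c i) (X i a)" "y \<in> insert (c i) (X i a)" "x \<noteq> y"
      obtain s t where st: "s \<in> insert (i, 0, 0) (S i a)" "t \<in> insert (i, 0, 0) (S i a)" "x = f s" "y = f t"
        using xy unfolding c_def X_def by blast
      have "s \<in> blowup_clique p i (Suc a)" "t \<in> blowup_clique p i (Suc a)"
        using st unfolding S_def blowup_clique_def by auto
      hence "SF_adj p ks s t" using xy st i a unfolding SF_adj_def by (auto intro!: exI[of _ i] bexI[of _ "Suc a"])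
      moreover have "s \<in> SF_verts p ks" "t \<in> SF_verts p ks" using st cv[OF i] Sv[OF i a] by auto
      ultimately show "E x y" using adj st by blast
    qed
  next
    fix a b assume ab: "a < ks ! i" "b < ks ! i" "a \<noteq> b"
    have "S i a \<inter> S i b = {}" using ab by (auto simp: S_def)
    thus "X i a \<inter> X i b = {}" unfolding X_def
      using inj_on_image_Int[OF f(1) Sv[OF i ab(1)] Sv[OF i ab(2)]] by simp
  qed
  have 2: "star_support (ks ! i) (c i) (X i) \<inter> star_support (ks ! j) (c j) (X j) = {}"
    if ij: "i < length ks" "j < length ks" "i \<noteq> j" for i j
  proof -
    define W where "W i = insert (i, 0, 0) (\<Union>a<ks ! i. S i a)" for i
    have ss: "star_support (ks ! i) (c i) (X i) = f ` W i" for i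
      unfolding star_support_def c_def X_def W_def by auto
    have "W i \<subseteq> SF_verts p ks" if "i < length ks" for i using cv[OF that] Sv[OF that] unfolding W_def by auto
    moreover have "W i \<inter> W j = {}" using ij by (auto simp: W_def S_def)
    ultimately show ?thesis unfolding ss using inj_on_image_Int[OF f(1), of "W i" "W j"] ij by simp
  qed
  show ?thesis by (intro exI[of _ c] exI[of _ X] conjI allI impI 1 2)
qed

text \<open>The disjoint stars outnumber the elements of L, so one of them avoids L; since k is at
  most every star size, it contains a k-fan off L whose centre is off L as well.\<close>

lemma SF_free_by_pigeonhole:
  assumes g: "graph_on n E" and k: "1 \<le> k" "\<forall>k'\<in>set ks. k \<le> k'"
    and L: "finite L" "card L < length ks"
    and nf: "\<And>v. v \<notin> L \<Longrightarrow> \<not> has_fan p E k L v"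
  shows "SF_free p ks n (edge_set E)"
  unfolding SF_free_def
proof
  assume con: "contains_SF p ks n (edge_set E)"
  have ks: "1 \<le> k \<and> k \<le> ks ! i" if "i < length ks" for i using k nth_mem[OF that] by auto
  have ks1: "1 \<le> ks ! i" if "i < length ks" for i using ks[OF that] by simp
  obtain c X where f0: "\<forall>i<length ks. fan p E (ks ! i) {} (c i) (X i)"
    and d0: "\<forall>i<length ks. \<forall>j<length ks. i \<noteq> j \<longrightarrow>
      star_support (ks ! i) (c i) (X i) \<inter> star_support (ks ! j) (c j) (X j) = {}"
  proof -
    have "\<exists>c X. (\<forall>i<length ks. fan p E (ks ! i) {} (c i) (X i)) \<and>
      (\<forall>i<length ks. \<forall>j<length ks. i \<noteq> j \<longrightarrow>
        star_support (ks ! i) (c i) (X i) \<inter> star_support (ks ! j) (c j) (X j) = {})"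
      by (rule contains_SF_D[OF g _ con]) (rule ks1)
    thus ?thesis using that by (elim exE conjE)
  qed
  note f = f0[rule_format] and d = d0[rule_format]
  have "\<exists>i<length ks. star_support (ks ! i) (c i) (X i) \<inter> L = {}"
  proof (rule ccontr)
    assume "\<not> ?thesis"
    hence "\<forall>i\<in>{..<length ks}. \<exists>x. x \<in> star_support (ks ! i) (c i) (X i) \<inter> L" by blast
    then obtain h where h: "\<And>i. i < length ks \<Longrightarrow> h i \<in> star_support (ks ! i) (c i) (X i) \<inter> L"
      by (metis lessThan_iff)
    have "inj_on h {..<length ks}"
    proof (rule inj_onI)
      fix i j assume "i \<in> {..<length ks}" "j \<in> {..<length ks}" "h i = h j"
      thus "i = j" using d[of i j] h[of i] h[of j] by (cases "i = j") auto
    qed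
    moreover have "h ` {..<length ks} \<subseteq> L" using h by auto
    ultimately have "card {..<length ks} \<le> card L" using L(1) card_inj_on_le by blast
    thus False using L(2) by simp
  qed
  then obtain i where i: "i < length ks" "star_support (ks ! i) (c i) (X i) \<inter> L = {}" by blast
  have "fan p E k L (c i) (X i)"
    unfolding fan_def
  proof (intro conjI allI impI)
    fix a assume "a < k"
    hence a: "a < ks ! i" using ks[OF i(1)] by simp
    show "finite (X i a)" "card (X i a) = p" "c i \<notin> X i a" "clique E (insert (c i) (X i a))"
      using fanD[OF f[OF i(1)] a] by auto
    show "X i a \<inter> L = {}" using i(2) a unfolding star_support_def by blast
  next
    fix a b assume "a < k" "b < k" "a \<noteq> b"
    thus "X i a \<inter> X i b = {}" using fanD(6)[OF f[OF i(1)], of a b] ks[OF i(1)] by simp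
  qed
  moreover have "c i \<notin> L" using i(2) unfolding star_support_def by blast
  ultimately show False using nf unfolding has_fan_def by blast
qed

text \<open>A vertex with M petals still has room for its star after all others are placed, so
  \<open>length ks\<close> such vertices would yield the whole forest.\<close>

lemma centres_lt:
  assumes g: "graph_on n E" and p: "p \<ge> 1" and ks1: "\<forall>k\<in>set ks. 1 \<le> k"
    and free: "SF_free p ks n (edge_set E)"
    and M: "length ks + (p + 1) * sum_list ks \<le> M"
    and S: "finite S" "\<And>v. v \<in> S \<Longrightarrow> has_fan p E M {} v"
  shows "card S < length ks"
proof (rule ccontr)
  have ks: "1 \<le> ks ! i" if "i < length ks" for i using ks1 nth_mem[OF that] by auto
  assume "\<not> card S < length ks"
  then obtain S' where S': "S' \<subseteq> S" "card S' = length ks" "finite S'"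
    by (meson linorder_not_less obtain_subset_with_card_n)
  obtain c where c: "bij_betw c {0..<length ks} S'" using ex_bij_betw_nat_finite[OF S'(3)] S'(2) by auto
  have cS: "c i \<in> S'" if "i < length ks" for i using c that by (auto simp: bij_betw_def)
  have sl: "(\<Sum>i<length ks. ks ! i) = sum_list ks" by (simp add: sum_list_sum_nth atLeast0LessThan)
  have "\<exists>X. (\<forall>i<length ks. fan p E (ks ! i) S' (c i) (X i)) \<and>
    (\<forall>i<length ks. \<forall>j<length ks. i \<noteq> j \<longrightarrow> (\<Union>a<ks ! i. X i a) \<inter> (\<Union>a<ks ! j. X j a) = {})"
    using S' S(2) cS M by (intro greedy_fans[where M = M]) (auto simp: sl)
  then obtain X where X0: "\<forall>i<length ks. fan p E (ks ! i) S' (c i) (X i)"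
    "\<forall>i<length ks. \<forall>j<length ks. i \<noteq> j \<longrightarrow> (\<Union>a<ks ! i. X i a) \<inter> (\<Union>a<ks ! j. X j a) = {}"
    by (elim exE conjE)
  note X = X0(1)[rule_format] X0(2)[rule_format]
  have "contains_SF p ks n (edge_set E)"
  proof (rule contains_SF_I[OF g p ks])
    show "fan p E (ks ! i) {} (c i) (X i)" if "i < length ks" for i using fan_mono[OF X(1)[OF that]] by simp
    fix i j assume ij: "i < length ks" "j < length ks" "i \<noteq> j"
    have "c i \<noteq> c j" using c ij by (auto simp: bij_betw_def inj_on_def)
    moreover have "c i \<notin> (\<Union>a<ks ! j. X j a)" if "i < length ks" "j < length ks" for i j
      using fanD(4)[OF X(1)[OF that(2)]] cS[OF that(1)] by blast
    ultimately show "star_support (ks ! i) (c i) (X i) \<inter> star_support (ks ! j) (c j) (X j) = {}"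
      using X(2)[OF ij] ij unfolding star_support_def by blast
  qed
  thus False using free unfolding SF_free_def by simp
qed

text \<open>The fan at v would supply the last star, and the elements of L, each with M petals,
  would supply the others away from it.\<close>

lemma no_fan_off_centres:
  assumes g: "graph_on n E" and p: "p \<ge> 1" and ks0: "\<forall>k\<in>set ks. 1 \<le> k" "ks \<noteq> []"
    and free: "SF_free p ks n (edge_set E)"
    and M: "length ks + (p + 2) * sum_list ks \<le> M"
    and L: "finite L" "card L = length ks - 1" "\<And>v. v \<in> L \<Longrightarrow> has_fan p E M {} v"
    and v: "v \<notin> L"
  shows "\<not> has_fan p E (last ks) L v"
proof
  have ks: "1 \<le> ks ! i" if "i < length ks" for i using ks0 nth_mem[OF that] by auto
  assume "has_fan p E (last ks) L v"
  then obtain Z where Z: "fan p E (last ks) L v Z" unfolding has_fan_def by blast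
  define m where "m = length ks - 1"
  have len: "length ks = Suc m" using ks0(2) by (simp add: m_def)
  have lst: "last ks = ks ! m" using ks0(2) by (simp add: last_conv_nth m_def)
  obtain c where c: "bij_betw c {0..<m} L" using ex_bij_betw_nat_finite[OF L(1)] L(2) m_def by auto
  have cS: "c i \<in> L" if "i < m" for i using c that by (auto simp: bij_betw_def)
  have sl: "(\<Sum>i<m. ks ! i) + ks ! m = sum_list ks" by (simp add: sum_list_sum_nth atLeast0LessThan len)
  define Y where "Y = L \<union> insert v (\<Union>a<ks ! m. Z a)"
  have "card (\<Union>a<ks ! m. Z a) \<le> (\<Sum>a<ks ! m. card (Z a))" by (rule card_UN_le) simp
  also have "\<dots> = p * ks ! m" using fanD(2)[OF Z] lst by simp
  finally have cZ: "card (\<Union>a<ks ! m. Z a) \<le> p * ks ! m" .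
  have fZ: "finite (\<Union>a<ks ! m. Z a)" using fanD(1)[OF Z] lst by auto
  have cY: "card Y \<le> m + (1 + p * ks ! m)"
  proof -
    have "card Y \<le> card L + card (insert v (\<Union>a<ks ! m. Z a))" unfolding Y_def by (rule card_Un_le)
    also have "card (insert v (\<Union>a<ks ! m. Z a)) \<le> 1 + card (\<Union>a<ks ! m. Z a)"
      using fZ by (simp add: card_insert_if)
    finally show ?thesis using cZ L(2) m_def by simp
  qed
  have bnd: "card Y + (p + 1) * (\<Sum>i<m. ks ! i) \<le> M"
  proof -
    have "(p + 1) * (\<Sum>i<m. ks ! i) + p * ks ! m \<le> (p + 2) * sum_list ks"
      unfolding sl[symmetric] by (simp add: algebra_simps)
    thus ?thesis using cY M len by linarith
  qed
  have fY: "finite Y" using L(1) fZ unfolding Y_def by simp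
  have "\<exists>X. (\<forall>i<m. fan p E (ks ! i) Y (c i) (X i)) \<and>
    (\<forall>i<m. \<forall>j<m. i \<noteq> j \<longrightarrow> (\<Union>a<ks ! i. X i a) \<inter> (\<Union>a<ks ! j. X j a) = {})"
    by (rule greedy_fans[OF fY _ bnd]) (use cS L(3) in auto)
  then obtain X where X0: "\<forall>i<m. fan p E (ks ! i) Y (c i) (X i)"
    "\<forall>i<m. \<forall>j<m. i \<noteq> j \<longrightarrow> (\<Union>a<ks ! i. X i a) \<inter> (\<Union>a<ks ! j. X j a) = {}"
    by (elim exE conjE)
  note X = X0(1)[rule_format] X0(2)[rule_format]
  have LZ: "L \<inter> insert v (\<Union>a<ks ! m. Z a) = {}" using v fanD(4)[OF Z] lst by auto
  have XY: "(\<Union>a<ks ! i. X i a) \<inter> Y = {}" if "i < m" for i using fanD(4)[OF X(1)[OF that]] by blast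
  have s1: "star_support (ks ! i) (c i) (X i) \<inter> star_support (ks ! m) v Z = {}" if "i < m" for i
    using XY[OF that] cS[OF that] LZ unfolding star_support_def Y_def by blast
  have s2: "star_support (ks ! i) (c i) (X i) \<inter> star_support (ks ! j) (c j) (X j) = {}"
    if ij: "i < m" "j < m" "i \<noteq> j" for i j
  proof -
    have "c i \<noteq> c j" using c ij by (auto simp: bij_betw_def inj_on_def)
    thus ?thesis using XY[OF ij(1)] XY[OF ij(2)] cS[OF ij(1)] cS[OF ij(2)] X(2)[OF ij]
      unfolding star_support_def Y_def by blast
  qed
  have "contains_SF p ks n (edge_set E)"
  proof (rule contains_SF_I[OF g p ks, of "c(m := v)" "X(m := Z)"])
    show "fan p E (ks ! i) {} ((c(m := v)) i) ((X(m := Z)) i)" if "i < length ks" for i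
      using that fan_mono[OF X(1), of i "ks ! i" "{}"] fan_mono[OF Z, of "ks ! m" "{}"] lst
      by (cases "i = m") (auto simp: len)
    fix i j assume ij: "i < length ks" "j < length ks" "i \<noteq> j"
    consider "i = m" "j < m" | "j = m" "i < m" | "i < m" "j < m" using ij len by linarith
    thus "star_support (ks ! i) ((c(m := v)) i) ((X(m := Z)) i) \<inter>
      star_support (ks ! j) ((c(m := v)) j) ((X(m := Z)) j) = {}"
      by cases (use s1 s2 ij in \<open>auto simp: Int_commute\<close>)
  qed
  thus False using free unfolding SF_free_def by simp
qed

section \<open>Perron vectors of dense free graphs\<close>

text \<open>Delete all edges at the few vertices with an M-fan. For any other v there are no M
  disjoint p-sets completing v to a clique, so a set \<open>T v\<close> of at most p * M vertices
  meets all such p-sets, and deleting the edges from v to \<open>T v\<close> destroys every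
  (p+1)-clique through v. The factor 2 is due to ordered pairs.\<close>

lemma remove_to_clique_free:
  assumes g: "graph_on n E" and p: "p \<ge> 1" and ks: "\<forall>k\<in>set ks. 1 \<le> k"
    and free: "SF_free p ks n (edge_set E)"
    and M: "length ks + (p + 1) * sum_list ks \<le> M"
  shows "\<exists>E0. graph_on n E0 \<and> (\<forall>u v. E0 u v \<longrightarrow> E u v) \<and> (\<forall>X. card X = p + 1 \<longrightarrow> \<not> clique E0 X) \<and>
    (\<Sum>u<n. \<Sum>v<n. of_bool (E u v \<and> \<not> E0 u v)) \<le> 2 * (real (length ks) + p * M) * n"
proof -
  define C0 where "C0 = {v. v < n \<and> has_fan p E M {} v}"
  have C0: "finite C0" "card C0 < length ks"
  proof -
    show "finite C0" by (simp add: C0_def)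
    show "card C0 < length ks"
      by (rule centres_lt[OF g p ks free M \<open>finite C0\<close>]) (simp add: C0_def)
  qed
  define F where "F v = {Y. finite Y \<and> card Y = p \<and> v \<notin> Y \<and> clique E (insert v Y)}" for v
  have hit: "\<exists>T. finite T \<and> card T \<le> p * M \<and> (\<forall>X\<in>F v. X \<inter> T \<noteq> {})" if "\<not> has_fan p E M {} v" for v
  proof -
    have "\<not> (\<exists>X :: nat \<Rightarrow> nat set. (\<forall>a<M. X a \<in> F v) \<and> (\<forall>a<M. \<forall>b<M. a \<noteq> b \<longrightarrow> X a \<inter> X b = {}))"
    proof
      assume "\<exists>X :: nat \<Rightarrow> nat set. (\<forall>a<M. X a \<in> F v) \<and> (\<forall>a<M. \<forall>b<M. a \<noteq> b \<longrightarrow> X a \<inter> X b = {})"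
      then obtain X :: "nat \<Rightarrow> nat set" where "\<forall>a<M. X a \<in> F v" "\<forall>a<M. \<forall>b<M. a \<noteq> b \<longrightarrow> X a \<inter> X b = {}"
        by (elim exE conjE)
      hence "fan p E M {} v X" unfolding fan_def F_def by simp
      thus False using that unfolding has_fan_def by blast
    qed
    thus ?thesis using disjoint_family_or_hitting_set[of "F v" p M] unfolding F_def by blast
  qed
  then obtain T where T: "\<And>v. \<not> has_fan p E M {} v \<Longrightarrow> finite (T v) \<and> card (T v) \<le> p * M \<and> (\<forall>X\<in>F v. X \<inter> T v \<noteq> {})"
    by metis
  define P where "P u v \<longleftrightarrow> u \<in> C0 \<or> v \<in> T u" for u v
  define E0 where "E0 u v \<longleftrightarrow> E u v \<and> \<not> P u v \<and> \<not> P v u" for u v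
  have g0: "graph_on n E0" using g unfolding graph_on_def E0_def by blast
  have cf: "\<not> clique E0 X" if X: "card X = p + 1" for X
  proof
    assume cl: "clique E0 X"
    have fX: "finite X" using X by (metis Suc_eq_plus1 card.infinite nat.simps(3))
    obtain x where x: "x \<in> X" using X by fastforce
    have cx: "card (X - {x}) = p" using fX x X by simp
    have "X - {x} \<noteq> {}" using cx p by force
    then obtain y0 where "y0 \<in> X" "y0 \<noteq> x" by blast
    hence "E0 x y0" using cliqueD[OF cl x] by metis
    hence nx: "\<not> has_fan p E M {} x" using graph_onD[OF g] unfolding E0_def P_def C0_def by blast
    have "clique E (insert x (X - {x}))" using cl x unfolding clique_def E0_def by blast
    hence "X - {x} \<in> F x" using fX cx unfolding F_def by simp
    then obtain y where "y \<in> X" "y \<noteq> x" "y \<in> T x" using T[OF nx] by blast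
    moreover from this have "E0 x y" using cliqueD[OF cl x] by metis
    ultimately show False unfolding E0_def P_def by blast
  qed
  have row: "(\<Sum>v<n. of_bool (P u v)) \<le> n * of_bool (u \<in> C0) + real (p * M)" if u: "u < n" for u
  proof (cases "u \<in> C0")
    case True thus ?thesis by (simp add: P_def)
  next
    case False
    hence nf: "\<not> has_fan p E M {} u" using u by (simp add: C0_def)
    have "(\<Sum>v<n. of_bool (P u v)) = (\<Sum>v<n. of_bool (v \<in> T u) :: real)"
      using False by (simp add: P_def)
    also have "\<dots> = card ({..<n} \<inter> T u)" by (simp add: Int_def)
    also have "\<dots> \<le> p * M" using T[OF nf] by (meson card_mono inf_le2 of_nat_le_iff order_trans)
    finally show ?thesis using False by simp
  qed
  have S: "(\<Sum>u<n. \<Sum>v<n. of_bool (P u v)) \<le> (real (length ks) + p * M) * n"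
  proof -
    have "(\<Sum>u<n. \<Sum>v<n. of_bool (P u v)) \<le> (\<Sum>u<n. n * of_bool (u \<in> C0) + real (p * M))"
      by (intro sum_mono row) simp
    also have "\<dots> = n * card ({..<n} \<inter> C0) + n * real (p * M)"
      by (simp add: sum.distrib sum_distrib_left[symmetric] Int_def)
    also have "\<dots> \<le> n * real (length ks) + n * real (p * M)"
    proof -
      have "card ({..<n} \<inter> C0) \<le> length ks" using C0 by (meson card_mono inf_le2 le_trans less_imp_le)
      hence "real n * real (card ({..<n} \<inter> C0)) \<le> real n * real (length ks)" by (intro mult_left_mono) auto
      thus ?thesis by simp
    qed
    finally show ?thesis by (simp add: algebra_simps)
  qed
  have "(\<Sum>u<n. \<Sum>v<n. of_bool (E u v \<and> \<not> E0 u v)) \<le> (\<Sum>u<n. \<Sum>v<n. of_bool (P u v) + of_bool (P v u) :: real)"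
    by (intro sum_mono) (auto simp: E0_def)
  also have "\<dots> = (\<Sum>u<n. \<Sum>v<n. of_bool (P u v)) + (\<Sum>u<n. \<Sum>v<n. of_bool (P v u))"
    by (simp add: sum.distrib)
  also have "(\<Sum>u<n. \<Sum>v<n. of_bool (P v u) :: real) = (\<Sum>u<n. \<Sum>v<n. of_bool (P u v))" by (rule sum.swap)
  finally have "(\<Sum>u<n. \<Sum>v<n. of_bool (E u v \<and> \<not> E0 u v)) \<le> 2 * (real (length ks) + p * M) * n"
    using S by linarith
  thus ?thesis using g0 cf by (intro exI[of _ E0]) (auto simp: E0_def)
qed

lemma furedi_quad:
  assumes g: "graph_on n E0" and p: "p \<ge> 1" and cf: "\<And>X. card X = p + 1 \<Longrightarrow> \<not> clique E0 X"
    and w: "\<And>i. i < n \<Longrightarrow> 0 \<le> w i"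
  shows "\<exists>c. (\<forall>v. c v < p) \<and> quad n E0 w + quad n (\<lambda>u v. E0 u v \<and> c u = c v) w \<le> (1 - 1 / p) * (\<Sum>i<n. w i)\<^sup>2"
proof -
  have "\<exists>c. (\<forall>v. c v < p) \<and>
    (\<Sum>u\<in>{..<n}. \<Sum>v\<in>{..<n}. (of_bool (E0 u v) + of_bool (E0 u v \<and> c u = c v)) * (w u * w v))
      \<le> (1 - 1 / p) * (sum w {..<n})\<^sup>2"
    using g p cf w by (intro weighted_furedi) (auto dest: graph_onD)
  thus ?thesis unfolding quad_def by (simp add: sum.distrib algebra_simps)
qed

lemma quad_nonneg: "(\<And>i. i < n \<Longrightarrow> 0 \<le> w i) \<Longrightarrow> 0 \<le> quad n E w"
  unfolding quad_def by (intro sum_nonneg) auto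

lemma quad_split_sub:
  assumes "\<And>u v. E0 u v \<Longrightarrow> E u v"
  shows "quad n E w = quad n E0 w + quad n (\<lambda>u v. E u v \<and> \<not> E0 u v) w"
  unfolding quad_def sum.distrib[symmetric] using assms by (intro sum.cong) auto

lemma quad_bound:
  assumes "\<And>i. i < n \<Longrightarrow> 0 \<le> w i \<and> w i \<le> K"
  shows "quad n D w \<le> K\<^sup>2 * (\<Sum>u<n. \<Sum>v<n. of_bool (D u v))"
  unfolding quad_def sum_distrib_left
proof (intro sum_mono)
  fix u v assume "u \<in> {..<n}" "v \<in> {..<n}"
  hence "w u * w v \<le> K * K" using assms by (intro mult_mono) (auto intro: order_trans)
  thus "of_bool (D u v) * w u * w v \<le> K\<^sup>2 * of_bool (D u v)" by (simp add: power2_eq_square)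
qed

text \<open>Cauchy-Schwarz over ordered pairs, using that \<open>of_bool\<close> is idempotent.
  Combined with an upper bound on the form at the squared weights it turns a large value at w into a
  large number of edges.\<close>

lemma quad_cauchy:
  "(quad n E w)\<^sup>2 \<le> quad n E (\<lambda>_. 1) * quad n E (\<lambda>i. (w i)\<^sup>2)"
proof -
  let ?I = "{..<n} \<times> {..<n}"
  have r: "quad n E f = (\<Sum>x\<in>?I. of_bool (E (fst x) (snd x)) * f (fst x) * f (snd x))" for f
    unfolding quad_def by (simp add: sum.cartesian_product case_prod_beta)
  have "(\<Sum>x\<in>?I. of_bool (E (fst x) (snd x)) * (of_bool (E (fst x) (snd x)) * w (fst x) * w (snd x)))\<^sup>2
    \<le> (\<Sum>x\<in>?I. (of_bool (E (fst x) (snd x)))\<^sup>2) * (\<Sum>x\<in>?I. (of_bool (E (fst x) (snd x)) * w (fst x) * w (snd x))\<^sup>2)"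
    by (rule Cauchy_Schwarz_ineq_sum)
  moreover have "(\<Sum>x\<in>?I. of_bool (E (fst x) (snd x)) * (of_bool (E (fst x) (snd x)) * w (fst x) * w (snd x))) = quad n E w"
    unfolding r by (intro sum.cong) auto
  moreover have "(\<Sum>x\<in>?I. (of_bool (E (fst x) (snd x)))\<^sup>2) = quad n E (\<lambda>_. 1)"
    unfolding r by (intro sum.cong) auto
  moreover have "(\<Sum>x\<in>?I. (of_bool (E (fst x) (snd x)) * w (fst x) * w (snd x))\<^sup>2) = quad n E (\<lambda>i. (w i)\<^sup>2)"
    unfolding r by (intro sum.cong) (auto simp: power_mult_distrib)
  ultimately show ?thesis by simp
qed

lemma half_le_turan_density: "p \<ge> 2 \<Longrightarrow> 1 / 2 \<le> 1 - 1 / real p" "p \<ge> 1 \<Longrightarrow> 1 - 1 / real p \<le> 1"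
  by (auto simp: field_simps)

text \<open>One constant serves all bounds, so that it can be enlarged freely. The last clause
  concerns the edges instead of z and is the input of \<open>exists_stable_partition\<close>;
  \<open>n \<le> 4 * lam n E\<close> is there for dividing eigenvalue equations by the spectral
  radius.\<close>

definition near_perron :: "nat \<Rightarrow> nat \<Rightarrow> (nat \<Rightarrow> nat \<Rightarrow> bool) \<Rightarrow> real \<Rightarrow> (nat \<Rightarrow> real) \<Rightarrow> bool" where
  "near_perron p n E K z \<longleftrightarrow> (\<forall>i<n. 0 \<le> z i \<and> z i \<le> K) \<and> (\<Sum>i<n. (z i)\<^sup>2) = n \<and>
     (\<forall>i<n. (\<Sum>j<n. of_bool (E i j) * z j) = lam n E * z i) \<and> quad n E z = lam n E * n \<and>
     (\<Sum>i<n. (z i - 1)\<^sup>2) \<le> K \<and> \<bar>lam n E - (1 - 1 / p) * n\<bar> \<le> K \<and> n \<le> 4 * lam n E \<and> lam n E \<le> n \<and>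
     quad n E (\<lambda>_. 1) \<ge> (1 - 1 / p) * (real n)\<^sup>2 - K * n"

text \<open>Let E0 be the clique-free part, l the spectral radius and S the sum of z. The form of E0
  at z is at least \<open>l * n\<close> minus a multiple of n, and at most \<alpha> * S^2, so S is
  within a constant of n. As z and the all-ones vector both have total square n, the squared
  distance between them is 2 * (n - S). The entries are bounded because l * z i <= S <= n <= 4 *
  l.\<close>

lemma exists_near_perron:
  fixes c :: real
  assumes p: "p \<ge> 2" and ks: "\<forall>k\<in>set ks. 1 \<le> k" and c: "c \<ge> 0"
  shows "\<exists>K n0. \<forall>n\<ge>n0. \<forall>E. graph_on n E \<and> SF_free p ks n (edge_set E) \<and> lam n E \<ge> (1 - 1 / p) * n - c
    \<longrightarrow> (\<exists>z. near_perron p n E K z)"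
proof -
  define M where "M = length ks + (p + 1) * sum_list ks"
  define K1 where "K1 = 2 * (real (length ks) + p * M)"
  have K1: "K1 \<ge> 0" by (simp add: K1_def)
  define K2 where "K2 = c + 16 * K1"
  have K2: "K2 \<ge> 0" "c \<le> K2" "16 * K1 \<le> K2" using c K1 by (auto simp: K2_def)
  define \<alpha> where "\<alpha> = 1 - 1 / real p"
  have a: "1 / 2 \<le> \<alpha>" "\<alpha> \<le> 1" using half_le_turan_density[of p] p unfolding \<alpha>_def by auto
  define K where "K = 4 + 4 * K2"
  obtain n0 where n0: "real n0 \<ge> 4 * K2 + 4" using real_arch_simple by blast
  have "\<exists>z. near_perron p n E K z"
    if n: "n \<ge> n0" and g: "graph_on n E" and free: "SF_free p ks n (edge_set E)" and lam: "lam n E \<ge> \<alpha> * n - c"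
    for n E
  proof -
    have nn: "real n \<ge> 4 * K2 + 4" using n n0 by linarith
    hence n1: "n \<ge> 1" using K2 by simp
    define l where "l = lam n E"
    have "\<alpha> * n \<ge> (1 / 2) * n" using a(1) by (intro mult_right_mono) auto
    hence l4: "l \<ge> n / 4" using lam nn K2 unfolding l_def by linarith
    hence l0: "l > 0" using n1 by simp
    obtain z :: "nat \<Rightarrow> real" where z: "\<And>i. 0 \<le> z i" "(\<Sum>i<n. (z i)\<^sup>2) = n" "quad n E z = l * n"
      "\<And>i. i < n \<Longrightarrow> (\<Sum>j<n. of_bool (E i j) * z j) = l * z i"
      using perron_vector[OF n1 g] unfolding l_def by blast
    define S where "S = (\<Sum>i<n. z i)"
    have "(\<Sum>i<n. 1 * z i)\<^sup>2 \<le> (\<Sum>i<n. 1\<^sup>2) * (\<Sum>i<n. (z i)\<^sup>2)" by (rule Cauchy_Schwarz_ineq_sum)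
    hence S2: "S\<^sup>2 \<le> (real n)\<^sup>2" using z(2) by (simp add: S_def power2_eq_square)
    hence S: "S \<le> n" by (rule power2_le_imp_le) simp
    have S0: "S \<ge> 0" unfolding S_def using z(1) by (simp add: sum_nonneg)
    have z4: "z i \<le> 4" if i: "i < n" for i
    proof -
      have "l * z i \<le> S" unfolding z(4)[OF i, symmetric] S_def by (intro sum_mono) (auto simp: z(1))
      also note S
      also have "real n \<le> l * 4" using l4 by simp
      finally show ?thesis using l0 by simp
    qed
    have "\<exists>E0. graph_on n E0 \<and> (\<forall>u v. E0 u v \<longrightarrow> E u v) \<and> (\<forall>X. card X = p + 1 \<longrightarrow> \<not> clique E0 X) \<and>
      (\<Sum>u<n. \<Sum>v<n. of_bool (E u v \<and> \<not> E0 u v)) \<le> K1 * n"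
      unfolding K1_def by (rule remove_to_clique_free[OF g _ ks free]) (use p in \<open>auto simp: M_def\<close>)
    then obtain E0 where E0: "graph_on n E0" "\<And>u v. E0 u v \<Longrightarrow> E u v" "\<And>X. card X = p + 1 \<Longrightarrow> \<not> clique E0 X"
      "(\<Sum>u<n. \<Sum>v<n. of_bool (E u v \<and> \<not> E0 u v)) \<le> K1 * n"
      by blast
    have "quad n (\<lambda>u v. E u v \<and> \<not> E0 u v) z \<le> 4\<^sup>2 * (\<Sum>u<n. \<Sum>v<n. of_bool (E u v \<and> \<not> E0 u v))"
      by (rule quad_bound) (use z z4 in auto)
    also have "\<dots> \<le> 4\<^sup>2 * (K1 * n)" by (intro mult_left_mono E0(4)) auto
    finally have q0: "quad n E0 z \<ge> l * n - 16 * K1 * n"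
      using quad_split_sub[OF E0(2), where w = z and n = n] z(3) by simp
    have fur: "quad n E0 w \<le> \<alpha> * (\<Sum>i<n. w i)\<^sup>2" if w: "\<And>i. i < n \<Longrightarrow> 0 \<le> w i" for w
    proof -
      have "\<exists>c. (\<forall>v. c v < p) \<and> quad n E0 w + quad n (\<lambda>u v. E0 u v \<and> c u = c v) w \<le> \<alpha> * (\<Sum>i<n. w i)\<^sup>2"
        unfolding \<alpha>_def by (rule furedi_quad[OF E0(1) _ _ w]) (use p E0(3) in auto)
      then obtain cc where "\<forall>v. cc v < p"
        "quad n E0 w + quad n (\<lambda>u v. E0 u v \<and> cc u = cc v) w \<le> \<alpha> * (\<Sum>i<n. w i)\<^sup>2"
        by (elim exE conjE)
      moreover have "0 \<le> quad n (\<lambda>u v. E0 u v \<and> cc u = cc v) w" by (rule quad_nonneg[OF w])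
      ultimately show ?thesis by linarith
    qed
    have fS: "quad n E0 z \<le> \<alpha> * S\<^sup>2" using fur[of z] z(1) by (simp add: S_def)
    also have "\<dots> \<le> \<alpha> * n\<^sup>2" using S2 a by (intro mult_left_mono) auto
    finally have "l * n \<le> (\<alpha> * n + 16 * K1) * n" using q0 by (simp add: algebra_simps power2_eq_square)
    hence lup: "l \<le> \<alpha> * n + 16 * K1" using n1 by simp
    have ql: "\<alpha> * n\<^sup>2 - K2 * n \<le> quad n E0 z"
    proof -
      have "(\<alpha> * n - c) * n \<le> l * n" using lam unfolding l_def by (intro mult_right_mono) auto
      thus ?thesis using q0 by (simp add: K2_def algebra_simps power2_eq_square)
    qed
    define X where "X = (real n)\<^sup>2 - S\<^sup>2"
    have X0: "X \<ge> 0" using S2 by (simp add: X_def)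
    have "\<alpha> * X \<le> K2 * n" using ql fS by (simp add: algebra_simps X_def)
    moreover have "(1 / 2) * X \<le> \<alpha> * X" using a(1) X0 by (intro mult_right_mono)
    moreover have "X = (n - S) * (n + S)" by (simp add: power2_eq_square algebra_simps X_def)
    moreover have "(n - S) * n \<le> (n - S) * (n + S)" using S S0 by (intro mult_left_mono) auto
    ultimately have "(n - S) * n \<le> (2 * K2) * n" by linarith
    hence nS: "n - S \<le> 2 * K2" using n1 by simp
    have "(\<Sum>i<n. (z i - 1)\<^sup>2) = (\<Sum>i<n. (z i)\<^sup>2) - 2 * S + n"
      by (simp add: power2_diff sum.distrib sum_subtractf S_def sum_distrib_left)
    hence dev: "(\<Sum>i<n. (z i - 1)\<^sup>2) \<le> K" using nS z(2) unfolding K_def by simp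
    have "(\<alpha> * n\<^sup>2 - K2 * n)\<^sup>2 \<le> (quad n E0 z)\<^sup>2"
    proof (rule power_mono[OF ql])
      have "K2 \<le> \<alpha> * n" using nn K2 \<open>\<alpha> * n \<ge> (1 / 2) * n\<close> by linarith
      hence "K2 * n \<le> \<alpha> * n * n" by (intro mult_right_mono) auto
      thus "0 \<le> \<alpha> * n\<^sup>2 - K2 * n" by (simp add: power2_eq_square)
    qed
    also have "\<dots> \<le> quad n E0 (\<lambda>_. 1) * quad n E0 (\<lambda>i. (z i)\<^sup>2)" by (rule quad_cauchy)
    \<comment> \<open>Furedi's bound is applied to the weights \<open>(z i)\<^sup>2\<close>, whose
      sum is exactly n.\<close>
    also have "\<dots> \<le> quad n E0 (\<lambda>_. 1) * (\<alpha> * n\<^sup>2)"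
      using fur[of "\<lambda>i. (z i)\<^sup>2"] z(2) by (intro mult_left_mono quad_nonneg) auto
    finally have "(\<alpha> * n - K2)\<^sup>2 * n\<^sup>2 \<le> (quad n E0 (\<lambda>_. 1) * \<alpha>) * n\<^sup>2"
      by (simp add: power2_eq_square algebra_simps)
    hence "(\<alpha> * n - K2)\<^sup>2 \<le> quad n E0 (\<lambda>_. 1) * \<alpha>" using n1 by simp
    moreover have "\<alpha> * (\<alpha> * n\<^sup>2 - 2 * K2 * n) \<le> (\<alpha> * n - K2)\<^sup>2"
      by (simp add: power2_eq_square algebra_simps)
    ultimately have "\<alpha> * (\<alpha> * n\<^sup>2 - 2 * K2 * n) \<le> \<alpha> * quad n E0 (\<lambda>_. 1)" by (simp add: mult.commute)
    hence "\<alpha> * n\<^sup>2 - 2 * K2 * n \<le> quad n E0 (\<lambda>_. 1)" using a by simp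
    also have "\<dots> \<le> quad n E (\<lambda>_. 1)"
      using quad_split_sub[OF E0(2), where w = "\<lambda>_. 1" and n = n]
        quad_nonneg[where w = "\<lambda>_. 1" and E = "\<lambda>u v. E u v \<and> \<not> E0 u v" and n = n] by simp
    finally have e: "quad n E (\<lambda>_. 1) \<ge> \<alpha> * n\<^sup>2 - K * n"
    proof -
      assume A: "\<alpha> * real (n\<^sup>2) - 2 * K2 * real n \<le> quad n E (\<lambda>_. 1)"
      have "2 * K2 * real n \<le> K * n" using K2 by (intro mult_right_mono) (auto simp: K_def)
      thus ?thesis using A by simp
    qed
    have ln: "l \<le> n"
    proof -
      have "l * n \<le> 1 * n\<^sup>2"
      proof -
        have "quad n E z \<le> S * S"
          unfolding quad_def S_def sum_product
          by (intro sum_mono) (use z(1) in \<open>auto intro: mult_nonneg_nonneg\<close>)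
        also have "\<dots> \<le> n\<^sup>2" using S2 by (simp add: power2_eq_square)
        finally show ?thesis using z(3) by simp
      qed
      thus ?thesis using n1 by (simp add: power2_eq_square)
    qed
    have "near_perron p n E K z" unfolding near_perron_def \<alpha>_def[symmetric] l_def[symmetric]
      using z z4 dev e l4 lup lam K2 c a ln
      by (auto simp: K_def l_def abs_le_iff intro: order_trans[of _ 4])
    thus ?thesis by blast
  qed
  thus ?thesis unfolding \<alpha>_def by blast
qed

section \<open>Stable partitions\<close>

declare sum_of_bool_eq [simp del]

lemma card_eq_sum_of_bool: "real (card {u. u < (n::nat) \<and> P u}) = (\<Sum>u<n. of_bool (P u))"
  by (simp add: sum_of_bool_eq Int_def)

lemma sum_over_filter: "(\<Sum>u\<in>{u. u < (n::nat) \<and> P u}. f u :: real) = (\<Sum>u<n. of_bool (P u) * f u)"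
proof -
  have "(\<Sum>u\<in>{u. u < n \<and> P u}. f u) = (\<Sum>u\<in>{..<n}. if P u then f u else 0)"
    by (subst sum.inter_filter[symmetric]) (auto intro: sum.cong)
  also have "\<dots> = (\<Sum>u<n. of_bool (P u) * f u)" by (intro sum.cong) auto
  finally show ?thesis .
qed

section \<open>Changing a graph at a single vertex\<close>

lemma quad_at_vertex:
  assumes sym: "\<And>a b. D a b \<Longrightarrow> D b a" and irr: "\<not> D v v" and v: "v < n"
  shows "quad n D w = (\<Sum>a\<in>{..<n} - {v}. \<Sum>b\<in>{..<n} - {v}. of_bool (D a b) * w a * w b)
    + 2 * w v * (\<Sum>b<n. of_bool (D v b) * w b)"
proof -
  let ?A = "{..<n} - {v}"
  have r: "(\<Sum>b<n. f b) = f v + (\<Sum>b\<in>?A. f b)" for f :: "nat \<Rightarrow> real"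
    using v by (intro sum.remove) auto
  have "quad n D w = (\<Sum>b\<in>?A. of_bool (D v b) * w v * w b) + (\<Sum>a\<in>?A. of_bool (D a v) * w a * w v)
    + (\<Sum>a\<in>?A. \<Sum>b\<in>?A. of_bool (D a b) * w a * w b)"
    unfolding quad_def r by (simp add: irr sum.distrib)
  also have "(\<Sum>a\<in>?A. of_bool (D a v) * w a * w v) = (\<Sum>b\<in>?A. of_bool (D v b) * w v * w b)"
  proof (intro sum.cong refl)
    fix a have "D a v = D v a" using sym by blast
    thus "of_bool (D a v) * w a * w v = of_bool (D v a) * w v * w a" by simp
  qed
  finally show ?thesis unfolding r by (simp add: irr sum_distrib_left algebra_simps)
qed

lemma quad_change_vertex:
  assumes "\<And>a b. D a b \<Longrightarrow> D b a" "\<not> D v v" "\<And>a b. D' a b \<Longrightarrow> D' b a" "\<not> D' v v" "v < n"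
    and eq: "\<And>a b. a \<noteq> v \<Longrightarrow> b \<noteq> v \<Longrightarrow> D' a b = D a b"
  shows "quad n D' w - quad n D w =
    2 * w v * ((\<Sum>b<n. of_bool (D' v b) * w b) - (\<Sum>b<n. of_bool (D v b) * w b))"
proof -
  have "(\<Sum>a\<in>{..<n} - {v}. \<Sum>b\<in>{..<n} - {v}. of_bool (D' a b) * w a * w b) =
    (\<Sum>a\<in>{..<n} - {v}. \<Sum>b\<in>{..<n} - {v}. of_bool (D a b) * w a * w b)"
    by (intro sum.cong) (auto simp: eq)
  thus ?thesis using quad_at_vertex[of D v n w] quad_at_vertex[of D' v n w] assms
    by (simp add: algebra_simps)
qed

section \<open>Pairs inside colour classes and deviations of class sizes\<close>

lemma same_colour_pairs:
  fixes c :: "'a \<Rightarrow> nat"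
  assumes "finite V" "\<And>v. v \<in> V \<Longrightarrow> c v < p"
  shows "(\<Sum>u\<in>V. \<Sum>v\<in>V. of_bool (c u = c v)) = (\<Sum>j<p. (real (card {v \<in> V. c v = j}))\<^sup>2)"
proof -
  have card: "real (card {v \<in> V. c v = j}) = (\<Sum>v\<in>V. of_bool (c v = j))" for j
    using assms(1) by (simp add: sum_of_bool_eq Int_def)
  have "of_bool (c u = c v) = (\<Sum>j<p. of_bool (c u = j) * of_bool (c v = j) :: real)" if "u \<in> V" for u v
  proof -
    have "(\<Sum>j<p. of_bool (c u = j) * of_bool (c v = j) :: real) = (\<Sum>j<p. if j = c u then of_bool (c v = c u) else 0)"
      by (intro sum.cong) auto
    also have "\<dots> = of_bool (c v = c u)" using assms(2)[OF that] by (simp add: sum.delta)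
    finally show ?thesis by (simp add: eq_commute)
  qed
  hence "(\<Sum>u\<in>V. \<Sum>v\<in>V. of_bool (c u = c v)) = (\<Sum>u\<in>V. \<Sum>v\<in>V. \<Sum>j<p. of_bool (c u = j) * of_bool (c v = j) :: real)"
    by (intro sum.cong refl)
  also have "\<dots> = (\<Sum>u\<in>V. \<Sum>j<p. \<Sum>v\<in>V. of_bool (c u = j) * of_bool (c v = j))"
    by (intro sum.cong refl sum.swap)
  also have "\<dots> = (\<Sum>j<p. \<Sum>u\<in>V. \<Sum>v\<in>V. of_bool (c u = j) * of_bool (c v = j))" by (rule sum.swap)
  also have "\<dots> = (\<Sum>j<p. (real (card {v \<in> V. c v = j}))\<^sup>2)"
    unfolding card power2_eq_square sum_product by (intro sum.cong) auto
  finally show ?thesis .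
qed

lemma sum_colour_classes:
  fixes c :: "'a \<Rightarrow> nat"
  assumes "finite V" "\<And>v. v \<in> V \<Longrightarrow> c v < p"
  shows "(\<Sum>j<p. real (card {v \<in> V. c v = j})) = card V"
proof -
  have "card V = card (\<Union>j<p. {v \<in> V. c v = j})" using assms(2) by (intro arg_cong[of _ _ card]) auto
  also have "\<dots> = (\<Sum>j<p. card {v \<in> V. c v = j})" using assms(1) by (intro card_UN_disjoint) auto
  finally show ?thesis by simp
qed

lemma sum_sq_deviation:
  assumes "p \<ge> 1" "(\<Sum>j<p. f j) = s"
  shows "(\<Sum>j<p. (f j - s / p)\<^sup>2) = (\<Sum>j<p. (f j)\<^sup>2) - s\<^sup>2 / real p"
proof -
  have "(\<Sum>j<p. (f j - s / p)\<^sup>2) = (\<Sum>j<p. (f j)\<^sup>2) - (\<Sum>j<p. 2 * (s / p) * f j) + (\<Sum>j<p. (s / p)\<^sup>2)"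
    unfolding sum_subtractf[symmetric] sum.distrib[symmetric]
    by (intro sum.cong) (auto simp: power2_diff)
  also have "(\<Sum>j<p. 2 * (s / p) * f j) = 2 * (s / p) * s" by (simp only: sum_distrib_left[symmetric] assms(2))
  finally show ?thesis using assms(1) by (simp add: power2_eq_square field_simps)
qed

text \<open>The missing cross pairs are bounded in total, not at each vertex. The last clause is
  local optimality of a partition with fewest inner edges: a vertex with many neighbours in its own
  class has at least as many in every class, which makes it a centre of large fans.\<close>

definition stable_partition ::
    "nat \<Rightarrow> nat \<Rightarrow> (nat \<Rightarrow> nat \<Rightarrow> bool) \<Rightarrow> real \<Rightarrow> (nat \<Rightarrow> nat) \<Rightarrow> bool" where
  "stable_partition p n E K c \<longleftrightarrow> (\<forall>v. c v < p) \<and>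
     (\<Sum>v<n. real (card {u. u < n \<and> c u \<noteq> c v \<and> \<not> E v u})) \<le> K * n \<and>
     (\<forall>j<p. (real (card {v. v < n \<and> c v = j}) - n / p)\<^sup>2 \<le> K * n) \<and>
     (\<forall>v<n. \<forall>j<p. card {u. u < n \<and> E v u \<and> c u = c v} \<le> card {u. u < n \<and> E v u \<and> c u = j})"

lemma exists_stable_partition:
  assumes p: "p \<ge> 1" and ks: "\<forall>k\<in>set ks. 1 \<le> k"
  shows "\<exists>K'. \<forall>n E. graph_on n E \<and> SF_free p ks n (edge_set E) \<and> quad n E (\<lambda>_. 1) \<ge> (1 - 1 / p) * (real n)\<^sup>2 - K * n
    \<longrightarrow> (\<exists>c. stable_partition p n E K' c)"
proof -
  define M where "M = length ks + (p + 1) * sum_list ks"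
  define K1 where "K1 = 2 * (real (length ks) + p * M)"
  have K1: "K1 \<ge> 0" by (simp add: K1_def)
  define \<alpha> where "\<alpha> = 1 - 1 / real p"
  have "\<exists>c. stable_partition p n E (2 * K + 2 * K1) c"
    if g: "graph_on n E" and free: "SF_free p ks n (edge_set E)" and e: "quad n E (\<lambda>_. 1) \<ge> \<alpha> * (real n)\<^sup>2 - K * n"
    for n E
  proof -
    have "\<exists>E0. graph_on n E0 \<and> (\<forall>u v. E0 u v \<longrightarrow> E u v) \<and> (\<forall>X. card X = p + 1 \<longrightarrow> \<not> clique E0 X) \<and>
      (\<Sum>u<n. \<Sum>v<n. of_bool (E u v \<and> \<not> E0 u v)) \<le> K1 * n"
      unfolding K1_def by (rule remove_to_clique_free[OF g _ ks free]) (use p in \<open>auto simp: M_def\<close>)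
    then obtain E0 where E0: "graph_on n E0" "\<And>u v. E0 u v \<Longrightarrow> E u v" "\<And>X. card X = p + 1 \<Longrightarrow> \<not> clique E0 X"
      "(\<Sum>u<n. \<Sum>v<n. of_bool (E u v \<and> \<not> E0 u v)) \<le> K1 * n"
      by blast
    have "\<exists>c. (\<forall>v. c v < p) \<and> quad n E0 (\<lambda>_. 1) + quad n (\<lambda>u v. E0 u v \<and> c u = c v) (\<lambda>_. 1) \<le> \<alpha> * (\<Sum>i<n. 1)\<^sup>2"
      unfolding \<alpha>_def by (rule furedi_quad[OF E0(1)]) (use p E0(3) in auto)
    then obtain c1 where c1: "\<forall>v. c1 v < p"
      "quad n E0 (\<lambda>_. 1) + quad n (\<lambda>u v. E0 u v \<and> c1 u = c1 v) (\<lambda>_. 1) \<le> \<alpha> * (\<Sum>i<n. 1)\<^sup>2"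
      by (elim exE conjE)
    have rem: "quad n E (\<lambda>_. 1) \<le> quad n E0 (\<lambda>_. 1) + K1 * n"
      using quad_split_sub[OF E0(2), where n = n and w = "\<lambda>_. 1"] E0(4) by (simp add: quad_def)
    have "quad n (\<lambda>u v. E u v \<and> c1 u = c1 v) (\<lambda>_. 1) \<le> quad n (\<lambda>u v. E0 u v \<and> c1 u = c1 v) (\<lambda>_. 1)
      + (\<Sum>u<n. \<Sum>v<n. of_bool (E u v \<and> \<not> E0 u v))"
      unfolding quad_def sum.distrib[symmetric] by (intro sum_mono) auto
    hence in1: "quad n (\<lambda>u v. E u v \<and> c1 u = c1 v) (\<lambda>_. 1) \<le> (K + 2 * K1) * n"
      using c1(2) rem e E0(4) by (simp add: algebra_simps)
    \<comment> \<open>The colouring from Furedi's theorem has few inner edges. Passing to a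
      colouring with the fewest keeps this bound and adds local optimality.\<close>
    define I where "I c = (\<Sum>u<n. card {v. v < n \<and> E u v \<and> c u = c v})" for c :: "nat \<Rightarrow> nat"
    have Iq: "real (I c) = quad n (\<lambda>u v. E u v \<and> c u = c v) (\<lambda>_. 1)" for c
      unfolding I_def quad_def by (simp add: card_eq_sum_of_bool)
    obtain c where c: "\<forall>v. c v < p" "\<And>c'. \<forall>v. c' v < p \<Longrightarrow> I c \<le> I c'"
      using ex_has_least_nat[of "\<lambda>c. \<forall>v. c v < p" c1 I] c1(1) by blast
    have "real (I c) \<le> real (I c1)" using c(2)[OF c1(1)] by simp
    hence inn: "quad n (\<lambda>u v. E u v \<and> c u = c v) (\<lambda>_. 1) \<le> (K + 2 * K1) * n" using in1 by (simp add: Iq)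
    define S where "S = (\<Sum>j<p. (real (card {v \<in> {..<n}. c v = j}))\<^sup>2)"
    have S: "(\<Sum>u<n. \<Sum>v<n. of_bool (c u = c v)) = S"
      unfolding S_def using c(1) by (intro same_colour_pairs) auto
    have sumn: "(\<Sum>j<p. real (card {v \<in> {..<n}. c v = j})) = real n"
      using sum_colour_classes[of "{..<n}" c p] c(1) by simp
    have dev: "(\<Sum>j<p. (real (card {v \<in> {..<n}. c v = j}) - n / p)\<^sup>2) = S - (real n)\<^sup>2 / p"
      unfolding S_def by (rule sum_sq_deviation[OF p sumn])
    \<comment> \<open>All ordered pairs are classified by colour and adjacency. Few inner edges and
      many edges in total then force both few missing cross pairs and nearly equal classes.\<close>
    have tot: "(\<Sum>u<n. \<Sum>v<n. of_bool (c u \<noteq> c v \<and> \<not> E u v)) + quad n E (\<lambda>_. 1) + S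
      = quad n (\<lambda>u v. E u v \<and> c u = c v) (\<lambda>_. 1) + (real n)\<^sup>2"
    proof -
      have "(\<Sum>u<n. \<Sum>v<n. of_bool (c u \<noteq> c v \<and> \<not> E u v)) + quad n E (\<lambda>_. 1) + S
        = (\<Sum>u<n. \<Sum>v<n. of_bool (E u v \<and> c u = c v) + 1)"
        unfolding quad_def S[symmetric] sum.distrib[symmetric] by (intro sum.cong) auto
      thus ?thesis by (simp add: sum.distrib quad_def power2_eq_square)
    qed
    have mis0: "0 \<le> (\<Sum>u<n. \<Sum>v<n. of_bool (c u \<noteq> c v \<and> \<not> E u v) :: real)" by (intro sum_nonneg) auto
    have dev0: "0 \<le> S - (real n)\<^sup>2 / p" unfolding dev[symmetric] by (intro sum_nonneg) auto
    have al: "\<alpha> * (real n)\<^sup>2 = (real n)\<^sup>2 - (real n)\<^sup>2 / p" by (simp add: \<alpha>_def algebra_simps)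
    have bound: "(\<Sum>u<n. \<Sum>v<n. of_bool (c u \<noteq> c v \<and> \<not> E u v)) + (S - (real n)\<^sup>2 / p) \<le> (2 * K + 2 * K1) * n"
      using tot inn e al by (simp add: algebra_simps)
    have "(\<Sum>v<n. real (card {u. u < n \<and> c u \<noteq> c v \<and> \<not> E v u})) = (\<Sum>u<n. \<Sum>v<n. of_bool (c u \<noteq> c v \<and> \<not> E u v))"
      by (simp only: card_eq_sum_of_bool) (intro sum.cong, auto)
    hence 1: "(\<Sum>v<n. real (card {u. u < n \<and> c u \<noteq> c v \<and> \<not> E v u})) \<le> (2 * K + 2 * K1) * n"
      using bound dev0 by linarith
    have 2: "(real (card {v. v < n \<and> c v = j}) - n / p)\<^sup>2 \<le> (2 * K + 2 * K1) * n" if j: "j < p" for j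
    proof -
      have "(real (card {v \<in> {..<n}. c v = j}) - n / p)\<^sup>2 \<le> (\<Sum>j<p. (real (card {v \<in> {..<n}. c v = j}) - n / p)\<^sup>2)"
        using j by (intro member_le_sum) auto
      thus ?thesis using dev bound mis0 by simp
    qed
    have 3: "card {u. u < n \<and> E v u \<and> c u = c v} \<le> card {u. u < n \<and> E v u \<and> c u = j}"
      if v: "v < n" and j: "j < p" for v j
    proof (cases "j = c v")
      case False
      let ?c = "c(v := j)"
      have "I c \<le> I ?c" using c j by (intro c(2)) auto
      hence "real (I c) \<le> real (I ?c)" by (simp only: of_nat_le_iff)
      hence "0 \<le> quad n (\<lambda>a b. E a b \<and> ?c a = ?c b) (\<lambda>_. 1) - quad n (\<lambda>a b. E a b \<and> c a = c b) (\<lambda>_. 1)"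
        unfolding Iq by (simp only: diff_ge_0_iff_ge)
      also have "\<dots> = 2 * 1 * ((\<Sum>b<n. of_bool (E v b \<and> ?c v = ?c b) * 1) - (\<Sum>b<n. of_bool (E v b \<and> c v = c b) * 1))"
        using g v by (intro quad_change_vertex) (auto dest: graph_onD)
      finally have "(\<Sum>b<n. of_bool (E v b \<and> c v = c b)) \<le> (\<Sum>b<n. of_bool (E v b \<and> ?c v = ?c b) :: real)" by simp
      also have "\<dots> = (\<Sum>b<n. of_bool (E v b \<and> c b = j))"
        by (intro sum.cong) (auto dest: graph_onD[OF g])
      finally have "real (card {u. u < n \<and> E v u \<and> c v = c u}) \<le> real (card {u. u < n \<and> E v u \<and> c u = j})"
        by (simp only: card_eq_sum_of_bool)
      thus ?thesis by (simp add: eq_commute)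
    qed simp
    show ?thesis unfolding stable_partition_def using c(1) 1 2 3 by blast
  qed
  thus ?thesis unfolding \<alpha>_def by blast
qed

text \<open>Colours are treated one at a time: each vertex chosen so far misses at most D vertices
  of other classes, so \<open>A j\<close> still contains a vertex outside Y adjacent to all of them.
  The induction moves this vertex into X, which keeps \<open>card X + card J\<close> fixed.\<close>

lemma transversal_clique:
  fixes D :: real
  assumes "finite J" and g: "graph_on n E"
    and A: "\<And>j y. j \<in> J \<Longrightarrow> y \<in> A j \<Longrightarrow> c y = j \<and> y < n \<and> real (card {u. u < n \<and> c u \<noteq> c y \<and> \<not> E y u}) \<le> D"
    and D: "D \<ge> 0" and Y: "finite Y"
    and "finite X" "clique E X"
    and "\<And>x. x \<in> X \<Longrightarrow> c x \<notin> J \<and> real (card {u. u < n \<and> c u \<noteq> c x \<and> \<not> E x u}) \<le> D"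
    and "\<And>j. j \<in> J \<Longrightarrow> finite (A j) \<and> real (card X + card J) * D + real (card Y) < real (card (A j))"
  shows "\<exists>Z. finite Z \<and> card Z = card J \<and> Z \<inter> Y = {} \<and> clique E (X \<union> Z) \<and> Z \<subseteq> (\<Union>j\<in>J. A j)"
  using assms(1) A assms(6-9)
proof (induction J arbitrary: X)
  case empty
  thus ?case by (intro exI[of _ "{}"]) auto
next
  case (insert j J)
  define ms where "ms x = {u. u < n \<and> c u \<noteq> c x \<and> \<not> E x u}" for x
  have fms: "finite (ms x)" for x by (simp add: ms_def)
  have Xms: "c x \<notin> insert j J" "real (card (ms x)) \<le> D" if "x \<in> X" for x
    using insert.prems(4)[OF that] unfolding ms_def by auto
  have "real (card (Y \<union> (\<Union>x\<in>X. ms x))) \<le> real (card Y) + real (card X) * D"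
  proof -
    have "card (Y \<union> (\<Union>x\<in>X. ms x)) \<le> card Y + (\<Sum>x\<in>X. card (ms x))"
      using card_Un_le[of Y "\<Union>x\<in>X. ms x"] card_UN_le[OF insert.prems(2), of ms] by linarith
    hence "real (card (Y \<union> (\<Union>x\<in>X. ms x))) \<le> real (card Y) + (\<Sum>x\<in>X. real (card (ms x)))"
      by (metis of_nat_add of_nat_le_iff of_nat_sum)
    also have "(\<Sum>x\<in>X. real (card (ms x))) \<le> (\<Sum>x\<in>X. D)" using Xms(2) by (intro sum_mono)
    finally show ?thesis by simp
  qed
  also have "\<dots> \<le> real (card X + card (insert j J)) * D + real (card Y)"
    using D by (simp add: algebra_simps)
  also have "\<dots> < real (card (A j))" using insert.prems(5)[of j] by simp
  finally have "\<not> A j \<subseteq> Y \<union> (\<Union>x\<in>X. ms x)"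
    using card_mono[of "Y \<union> (\<Union>x\<in>X. ms x)" "A j"] Y insert.prems(2) fms by (auto simp: not_le)
  then obtain y where y: "y \<in> A j" "y \<notin> Y" "\<And>x. x \<in> X \<Longrightarrow> y \<notin> ms x" by blast
  have yA: "c y = j" "y < n" "real (card (ms y)) \<le> D" using insert.prems(1)[of j y] y(1) unfolding ms_def by auto
  have yX: "y \<notin> X" using Xms(1)[of y] yA(1) by auto
  have adj: "E x y" if "x \<in> X" for x
    using y(3)[OF that] Xms(1)[OF that] yA unfolding ms_def by auto
  have cl: "clique E (insert y X)"
    using insert.prems(3) adj graph_on_sym[OF g] unfolding clique_def by auto
  have "\<exists>Z. finite Z \<and> card Z = card J \<and> Z \<inter> Y = {} \<and> clique E (insert y X \<union> Z) \<and> Z \<subseteq> (\<Union>j\<in>J. A j)"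
  proof (rule insert.IH)
    show "finite (insert y X)" "clique E (insert y X)" using insert.prems(2) cl by auto
    show "c x \<notin> J \<and> real (card {u. u < n \<and> c u \<noteq> c x \<and> \<not> E x u}) \<le> D" if "x \<in> insert y X" for x
    proof (cases "x = y")
      case True thus ?thesis using yA insert.hyps(2) unfolding ms_def by auto
    next
      case False thus ?thesis using that Xms[of x] unfolding ms_def by auto
    qed
    show "finite (A i) \<and> real (card (insert y X) + card J) * D + real (card Y) < real (card (A i))" if "i \<in> J" for i
      using insert.prems(5)[of i] that insert.hyps insert.prems(2) yX by simp
  qed (use insert.prems(1) in auto)
  then obtain Z where Z: "finite Z" "card Z = card J" "Z \<inter> Y = {}" "clique E (insert y X \<union> Z)" "Z \<subseteq> (\<Union>j\<in>J. A j)"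
    by blast
  have "y \<notin> Z" using Z(5) insert.prems(1) insert.hyps(2) yA(1) by blast
  hence "card (insert y Z) = card (insert j J)" using Z(1,2) insert.hyps by simp
  moreover have "X \<union> insert y Z = insert y X \<union> Z" by blast
  ultimately show ?case using Z y yA(1) by (intro exI[of _ "insert y Z"]) auto
qed

text \<open>Each seed \<open>X a\<close> is completed to a petal by one vertex from each class in J.
  It is used with empty seeds, with neighbours of v in its own class, and with edges inside a class
  other than that of v; J consists of the classes that remain.\<close>

lemma fan_from_transversals:
  fixes D :: real
  assumes g: "graph_on n E" and D: "D \<ge> 0" and J: "finite J"
    and X: "\<And>a. a < M \<Longrightarrow> finite (X a) \<and> card (X a) + card J = p \<and> v \<notin> X a \<and> clique E (insert v (X a))"
    and Xd: "\<And>a b. a < M \<Longrightarrow> b < M \<Longrightarrow> a \<noteq> b \<Longrightarrow> X a \<inter> X b = {}"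
    and Xc: "\<And>a x. a < M \<Longrightarrow> x \<in> X a \<Longrightarrow> c x \<notin> J \<and> real (card {u. u < n \<and> c u \<noteq> c x \<and> \<not> E x u}) \<le> D"
    and A: "\<And>j y. j \<in> J \<Longrightarrow> y \<in> A j \<Longrightarrow> E v y \<and> c y = j \<and> real (card {u. u < n \<and> c u \<noteq> c y \<and> \<not> E y u}) \<le> D"
    and cA: "\<And>j. j \<in> J \<Longrightarrow> real p * D + real (M * p) < real (card (A j))"
  shows "has_fan p E M {} v"
proof -
  have An: "y < n" if "j \<in> J" "y \<in> A j" for j y using A[OF that] graph_onD[OF g] by blast
  have fA: "finite (A j)" if "j \<in> J" for j using An[OF that] by (meson bounded_nat_set_is_finite)
  have "\<exists>Z. (\<forall>a<m. finite (Z a) \<and> card (Z a) = card J \<and> clique E (X a \<union> Z a) \<and> Z a \<subseteq> (\<Union>j\<in>J. A j)) \<and>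
    (\<forall>a<m. \<forall>b<m. a \<noteq> b \<longrightarrow> Z a \<inter> Z b = {})" if "m \<le> M" for m
    using that
  proof (induction m)
    case 0 thus ?case by auto
  next
    case (Suc m)
    then obtain Z where Z0: "\<forall>a<m. finite (Z a) \<and> card (Z a) = card J \<and> clique E (X a \<union> Z a) \<and> Z a \<subseteq> (\<Union>j\<in>J. A j)"
      "\<forall>a<m. \<forall>b<m. a \<noteq> b \<longrightarrow> Z a \<inter> Z b = {}" by (metis Suc_leD)
    note Z = Z0[rule_format]
    have mM: "m < M" using Suc.prems by simp
    define Y where "Y = (\<Union>a<m. Z a)"
    have fY: "finite Y" using Z(1) unfolding Y_def by auto
    have "card Y \<le> (\<Sum>a<m. card (Z a))" unfolding Y_def by (rule card_UN_le) simp
    also have "\<dots> = m * card J" using Z(1) by simp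
    also have "\<dots> \<le> M * p" using X[OF mM] mM by (intro mult_le_mono) auto
    finally have cY: "real (card Y) \<le> real (M * p)" by (simp only: of_nat_le_iff)
    have "\<exists>W. finite W \<and> card W = card J \<and> W \<inter> Y = {} \<and> clique E (X m \<union> W) \<and> W \<subseteq> (\<Union>j\<in>J. A j)"
    proof (rule transversal_clique[OF J g _ D fY])
      show "c y = j \<and> y < n \<and> real (card {u. u < n \<and> c u \<noteq> c y \<and> \<not> E y u}) \<le> D" if "j \<in> J" "y \<in> A j" for j y
        using A[OF that] An[OF that] by blast
      show "finite (X m)" "clique E (X m)" using X[OF mM] clique_subset by blast+
      show "c x \<notin> J \<and> real (card {u. u < n \<and> c u \<noteq> c x \<and> \<not> E x u}) \<le> D" if "x \<in> X m" for x
        using Xc[OF mM that] .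
      show "finite (A j) \<and> real (card (X m) + card J) * D + real (card Y) < real (card (A j))" if "j \<in> J" for j
      proof -
        have "card (X m) + card J = p" using X[OF mM] by simp
        thus ?thesis using cA[OF that] cY fA[OF that] by simp
      qed
    qed
    then obtain W where W: "finite W \<and> card W = card J \<and> clique E (X m \<union> W) \<and> W \<subseteq> (\<Union>j\<in>J. A j)" "W \<inter> Y = {}" by blast
    have WZ: "W \<inter> Z a = {}" if "a < m" for a using W(2) that unfolding Y_def by blast
    show ?case
    proof (intro exI[of _ "Z(m := W)"] conjI allI impI)
      fix a assume "a < Suc m"
      thus "finite ((Z(m := W)) a)" "card ((Z(m := W)) a) = card J" "clique E (X a \<union> (Z(m := W)) a)"
        "(Z(m := W)) a \<subseteq> (\<Union>j\<in>J. A j)" using W(1) Z(1)[of a] by (cases "a = m"; simp)+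
    next
      fix a b assume "a < Suc m" "b < Suc m" "a \<noteq> b"
      thus "(Z(m := W)) a \<inter> (Z(m := W)) b = {}"
        using WZ[of a] WZ[of b] Z(2)[of a b] by (cases "a = m"; cases "b = m"; simp add: Int_commute)
    qed
  qed
  from this[of M] obtain Z where Z0: "\<forall>a<M. finite (Z a) \<and> card (Z a) = card J \<and> clique E (X a \<union> Z a) \<and> Z a \<subseteq> (\<Union>j\<in>J. A j)"
      "\<forall>a<M. \<forall>b<M. a \<noteq> b \<longrightarrow> Z a \<inter> Z b = {}" by (metis order_refl)
  note Z = Z0[rule_format]
  have ZA: "E v y \<and> c y \<in> J" if ay: "a < M" "y \<in> Z a" for a y
  proof -
    obtain j where "j \<in> J" "y \<in> A j" using Z(1)[OF ay(1)] ay(2) by blast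
    thus ?thesis using A by auto
  qed
  have XZ: "X a \<inter> Z b = {}" if "a < M" "b < M" for a b using Xc[OF that(1)] ZA[OF that(2)] by blast
  have "fan p E M {} v (\<lambda>a. X a \<union> Z a)"
    unfolding fan_def
  proof (intro conjI allI impI)
    fix a assume a: "a < M"
    show "finite (X a \<union> Z a)" using X[OF a] Z(1)[OF a] by simp
    show "card (X a \<union> Z a) = p" using X[OF a] Z(1)[OF a] XZ[OF a a] by (simp add: card_Un_disjoint)
    show "v \<notin> X a \<union> Z a" using X[OF a] ZA[OF a, of v] graph_onD(4)[OF g, of v v] by auto
    show "(X a \<union> Z a) \<inter> {} = {}" by simp
    show "clique E (insert v (X a \<union> Z a))" unfolding clique_def
    proof (intro ballI impI)
      fix x y assume xy: "x \<in> insert v (X a \<union> Z a)" "y \<in> insert v (X a \<union> Z a)" "x \<noteq> y"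
      have nb: "E v y" if "y \<in> X a \<union> Z a" "y \<noteq> v" for y
        using that ZA[OF a, of y] cliqueD[of E "insert v (X a)" v y] X[OF a] by auto
      show "E x y"
      proof (cases "x = v \<or> y = v")
        case True thus ?thesis using xy nb graph_on_sym[OF g] by auto
      next
        case False thus ?thesis using xy cliqueD[of E "X a \<union> Z a" x y] Z(1)[OF a] by auto
      qed
    qed
  next
    fix a b assume "a < M" "b < M" "a \<noteq> b"
    thus "(X a \<union> Z a) \<inter> (X b \<union> Z b) = {}" using Xd[of a b] Z(2)[of a b] XZ[of a b] XZ[of b a] by blast
  qed
  thus ?thesis unfolding has_fan_def by blast
qed

section \<open>Structure of weighted extremal graphs\<close>

text \<open>The forbidden graph is finite, so only vertex sets of bounded size matter, and the
  injection into E may depend on the set.\<close>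

lemma contains_SF_transfer:
  assumes g: "graph_on n E'"
    and con: "contains_SF p ks n (edge_set E')"
    and h: "\<And>S. finite S \<Longrightarrow> card S \<le> card (SF_verts p ks) \<Longrightarrow> S \<subseteq> {..<n} \<Longrightarrow>
      \<exists>h. inj_on h S \<and> h ` S \<subseteq> {..<n} \<and> (\<forall>x\<in>S. \<forall>y\<in>S. E' x y \<longrightarrow> E (h x) (h y))"
  shows "contains_SF p ks n (edge_set E)"
proof -
  obtain f where f: "inj_on f (SF_verts p ks)" "f ` SF_verts p ks \<subseteq> {..<n}"
    "\<forall>u\<in>SF_verts p ks. \<forall>v\<in>SF_verts p ks. SF_adj p ks u v \<longrightarrow> {f u, f v} \<in> edge_set E'"
    using con unfolding contains_SF_def by blast
  obtain h where h: "inj_on h (f ` SF_verts p ks)" "h ` f ` SF_verts p ks \<subseteq> {..<n}"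
    "\<forall>x\<in>f ` SF_verts p ks. \<forall>y\<in>f ` SF_verts p ks. E' x y \<longrightarrow> E (h x) (h y)"
    using h[of "f ` SF_verts p ks"] finite_SF_verts[of p ks] f(2) card_image_le[OF finite_SF_verts, of f p ks]
    by blast
  have "inj_on (h \<circ> f) (SF_verts p ks)" using comp_inj_on[OF f(1) h(1)] .
  moreover have "(h \<circ> f) ` SF_verts p ks \<subseteq> {..<n}" using h(2) by (simp add: image_comp)
  moreover have "{(h \<circ> f) u, (h \<circ> f) v} \<in> edge_set E"
    if "u \<in> SF_verts p ks" "v \<in> SF_verts p ks" "SF_adj p ks u v" for u v
  proof -
    have "E' (f u) (f v)" using f(3) that mem_edge_set[OF g] by blast
    hence "E (h (f u)) (h (f v))" using h(3) that by blast
    thus ?thesis unfolding edge_set_def by auto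
  qed
  ultimately show ?thesis unfolding contains_SF_def by blast
qed

text \<open>Outside L the members of a clique have distinct colours, so L meets every (p+1)-clique;
  fewer than \<open>length ks\<close> vertices cannot meet that many disjoint stars.\<close>

lemma multipartite_join_free:
  assumes p: "p \<ge> 1" and ks: "\<forall>k\<in>set ks. 1 \<le> k" and L: "finite L" "card L < length ks" and c: "\<And>v. c v < p"
  shows "SF_free p ks n (edge_set (\<lambda>a b. a \<noteq> b \<and> a < n \<and> b < n \<and> (a \<in> L \<or> b \<in> L \<or> c a \<noteq> c b)))"
proof (rule SF_free_by_pigeonhole[where k = 1])
  let ?E = "\<lambda>a b. a \<noteq> b \<and> a < n \<and> b < n \<and> (a \<in> L \<or> b \<in> L \<or> c a \<noteq> c b)"
  show "graph_on n ?E" unfolding graph_on_def by auto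
  show "\<not> has_fan p ?E 1 L v" if v: "v \<notin> L" for v
  proof
    assume "has_fan p ?E 1 L v"
    then obtain X where X: "fan p ?E 1 L v X" unfolding has_fan_def by blast
    note X0 = fanD[OF X, of 0, simplified]
    have "c x \<noteq> c y" if "x \<in> insert v (X 0)" "y \<in> insert v (X 0)" "x \<noteq> y" for x y
      using cliqueD[OF X0(5) that] that(1,2) v X0(4) by auto
    hence "inj_on c (insert v (X 0))" by (auto simp: inj_on_def)
    moreover have "c ` insert v (X 0) \<subseteq> {..<p}" using c by auto
    ultimately have "card (insert v (X 0)) \<le> card {..<p}" by (intro card_inj_on_le) auto
    thus False using X0(1,2,3) by simp
  qed
qed (use ks L in auto)

text \<open>By Cauchy-Schwarz a bounded total squared deviation costs at most order sqrt n on any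
  set, whatever its size.\<close>

lemma deviation_bound:
  fixes z :: "nat \<Rightarrow> real" and n :: nat
  assumes "(\<Sum>i<n. (z i - 1)\<^sup>2) \<le> (K :: real)" "A \<subseteq> {..<n}"
  shows "\<bar>sum z A - card A\<bar> \<le> sqrt (K * n)"
proof -
  have "(\<Sum>i\<in>A. 1 * (z i - 1))\<^sup>2 \<le> (\<Sum>i\<in>A. 1\<^sup>2) * (\<Sum>i\<in>A. (z i - 1)\<^sup>2)"
    by (rule Cauchy_Schwarz_ineq_sum)
  also have "\<dots> = card A * (\<Sum>i\<in>A. (z i - 1)\<^sup>2)" by simp
  also have "\<dots> \<le> n * K"
  proof (intro mult_mono)
    show "real (card A) \<le> n" using card_mono[OF _ assms(2)] by simp
    show "(\<Sum>i\<in>A. (z i - 1)\<^sup>2) \<le> K"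
      using assms(1) sum_mono2[OF _ assms(2), of "\<lambda>i. (z i - 1)\<^sup>2"] by simp
  qed (auto intro: sum_nonneg)
  finally have "(sum z A - card A)\<^sup>2 \<le> K * n" by (simp add: sum_subtractf mult.commute)
  hence "sqrt ((sum z A - card A)\<^sup>2) \<le> sqrt (K * n)" by (rule real_sqrt_le_mono)
  thus ?thesis by simp
qed

text \<open>\<open>M\<close> is large enough for the greedy embeddings, and \<delta> is chosen so
  that an average class has \<open>n / p = 4 * M * w\<close> vertices with
  \<open>w = \<delta> * n\<close>: removing what 2 * M good vertices miss, at most w each, leaves
  half of a class. \<open>zdeg\<close> replaces the eigenvalue equation by an inequality that the
  constant vector satisfies too, and \<open>big\<close> collects all demands on n.\<close>

locale weighted_extremal =
  fixes p :: nat and ks :: "nat list" and n :: nat and E :: "nat \<Rightarrow> nat \<Rightarrow> bool"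
    and z :: "nat \<Rightarrow> real" and c :: "nat \<Rightarrow> nat" and K \<delta> :: real and M :: nat
  assumes p2: "p \<ge> 2" and ks: "\<forall>k\<in>set ks. 1 \<le> k" "ks \<noteq> []" "\<forall>k\<in>set ks. last ks \<le> k"
    and g: "graph_on n E" and free: "SF_free p ks n (edge_set E)"
    and M: "M = length ks + (p + 2) * sum_list ks + card (SF_verts p ks) + p + 2"
    and \<delta>: "\<delta> = 1 / (4 * real p * real M)"
    and K1: "K \<ge> 1"
    and part: "stable_partition p n E K c"
    and z: "\<And>i. i < n \<Longrightarrow> 0 < z i \<and> z i \<le> K"
    and dev: "(\<Sum>i<n. (z i - 1)\<^sup>2) \<le> K"
    and zdeg: "\<And>v. v < n \<Longrightarrow> (\<Sum>u<n. of_bool (E v u) * z u) \<le> n * z v"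
    and max: "\<And>G. graph_on n G \<Longrightarrow> SF_free p ks n (edge_set G) \<Longrightarrow> quad n G z \<le> quad n E z"
    and big: "K * K / \<delta> + 6 * p * K / \<delta> + real (M * p) + real M + 64 * p * (real M)\<^sup>2 * K\<^sup>2 + 1 + 4 * sqrt (K * n)
      \<le> \<delta> / 12 * n"
begin

section \<open>Good vertices, missing cross pairs and centres of large fans\<close>

definition w :: real where "w = \<delta> * n"
definition s :: real where "s = sqrt (K * n)"
definition miss :: "nat \<Rightarrow> nat set" where "miss v = {u. u < n \<and> c u \<noteq> c v \<and> \<not> E v u}"
definition own :: "nat \<Rightarrow> nat set" where "own v = {u. u < n \<and> E v u \<and> c u = c v}"
definition cls :: "nat \<Rightarrow> nat set" where "cls j = {v. v < n \<and> c v = j}"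
definition Gd :: "nat set" where "Gd = {v. v < n \<and> card (miss v) \<le> w}"

lemma M_ge: "M \<ge> p + 2" "M \<ge> card (SF_verts p ks)" "M \<ge> length ks" "M \<ge> 4"
  "length ks + (p + 1) * sum_list ks \<le> M" "length ks + (p + 2) * sum_list ks \<le> M"
  unfolding M using p2 by (auto simp: algebra_simps)

lemma \<delta>_pos: "\<delta> > 0" using M_ge p2 by (auto simp: \<delta>)

lemma numeric:
  "K * K / \<delta> \<ge> 0" "p * K / \<delta> \<ge> 0" "64 * p * (real M)\<^sup>2 * K\<^sup>2 \<ge> 0" "s \<ge> 0" "w > 0"
  "K * K / \<delta> + 6 * (p * K / \<delta>) + real M * p + M + 64 * p * (real M)\<^sup>2 * K\<^sup>2 + 1 + 4 * s \<le> w / 12"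
  "n / p = 4 * real M * w" "M * w \<ge> 4 * w" "M * w \<ge> p * w + 2 * w" "K / \<delta> \<le> K * K / \<delta>"
proof -
  show A: "K * K / \<delta> \<ge> 0" "p * K / \<delta> \<ge> 0" "64 * p * (real M)\<^sup>2 * K\<^sup>2 \<ge> 0" "s \<ge> 0"
    using K1 \<delta>_pos unfolding s_def by auto
  show B: "K * K / \<delta> + 6 * (p * K / \<delta>) + real M * p + M + 64 * p * (real M)\<^sup>2 * K\<^sup>2 + 1 + 4 * s \<le> w / 12"
    using big unfolding w_def s_def by (simp add: algebra_simps)
  have "real M * p \<ge> 0" "real M \<ge> 0" by auto
  thus w: "w > 0" using A B by linarith
  have "w = n / (4 * real p * real M)" unfolding w_def by (subst \<delta>) simp
  thus "n / p = 4 * real M * w" using M_ge p2 by simp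
  show "M * w \<ge> 4 * w" using M_ge(4) w by (intro mult_right_mono) auto
  have "(p + 2) * w \<le> M * w" using M_ge(1) w by (intro mult_right_mono) (auto simp flip: of_nat_add)
  thus "M * w \<ge> p * w + 2 * w" by (simp add: algebra_simps)
  have "K * 1 \<le> K * K" using K1 by (intro mult_left_mono) auto
  thus "K / \<delta> \<le> K * K / \<delta>" using \<delta>_pos by (intro divide_right_mono) auto
qed

lemma n_pos: "n > 0" using numeric(5) unfolding w_def by (cases "n = 0") auto

lemma c_lt: "c v < p" using part unfolding stable_partition_def by blast

lemma fin: "finite (miss v)" "finite (own v)" "finite (cls j)" "finite Gd"
  unfolding miss_def own_def cls_def Gd_def by auto

lemma cls_size:
  assumes "j < p" shows "\<bar>real (card (cls j)) - n / p\<bar> \<le> s"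
proof -
  have "(real (card (cls j)) - n / p)\<^sup>2 \<le> K * n"
    using part assms unfolding stable_partition_def cls_def by blast
  hence "sqrt ((real (card (cls j)) - n / p)\<^sup>2) \<le> s" unfolding s_def by (rule real_sqrt_le_mono)
  thus ?thesis by simp
qed

lemma weight: "A \<subseteq> {..<n} \<Longrightarrow> \<bar>sum z A - card A\<bar> \<le> s"
  unfolding s_def by (rule deviation_bound[OF dev])

lemma bad_count:
  fixes t :: real
  assumes t: "t > 0" shows "card {v. v < n \<and> \<not> real (card (miss v)) \<le> t * n} \<le> K / t"
proof -
  let ?B = "{v. v < n \<and> \<not> real (card (miss v)) \<le> t * n}"
  have "card ?B * (t * n) = (\<Sum>v\<in>?B. t * n)" by simp
  also have "\<dots> \<le> (\<Sum>v\<in>?B. real (card (miss v)))" by (intro sum_mono) auto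
  also have "\<dots> \<le> (\<Sum>v<n. real (card (miss v)))" by (intro sum_mono2) auto
  also have "\<dots> \<le> K * n" using part unfolding stable_partition_def miss_def by blast
  finally have "(card ?B * t) * n \<le> K * n" by (simp add: mult_ac)
  hence "card ?B * t \<le> K" using n_pos by simp
  thus ?thesis using t by (simp add: field_simps)
qed

lemma not_Gd_count: "card ({..<n} - Gd) \<le> K / \<delta>"
proof -
  have "{..<n} - Gd = {v. v < n \<and> \<not> real (card (miss v)) \<le> \<delta> * n}" by (auto simp: Gd_def w_def)
  thus ?thesis using bad_count[OF \<delta>_pos] by simp
qed

lemma card_Diff_ge: "finite B \<Longrightarrow> real (card (A - B)) \<ge> real (card A) - real (card B)"
  using diff_card_le_card_Diff[of B A] by linarith

text \<open>By local optimality v has at least w / 3 neighbours in every class, hence many disjoint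
  transversal cliques in its neighbourhood. The threshold t makes the loss
  \<open>p * (t * n)\<close> equal to w / 6, half of what is available.\<close>

lemma inside_heavy_is_centre:
  assumes v: "v < n" and o: "real (card (own v)) \<ge> w / 3"
  shows "has_fan p E M {} v"
proof -
  define t where "t = \<delta> / (6 * p)"
  have t: "t > 0" using \<delta>_pos p2 by (simp add: t_def)
  define B where "B = {v. v < n \<and> \<not> real (card (miss v)) \<le> t * n}"
  have B: "card B \<le> 6 * (p * K / \<delta>)" "finite B"
    using bad_count[OF t] unfolding B_def t_def by (auto simp: field_simps)
  define A where "A j = {u. u < n \<and> E v u \<and> c u = j} - B" for j
  show ?thesis
  proof (rule fan_from_transversals[OF g, where D = "t * n" and J = "{..<p}" and X = "\<lambda>_. {}" and A = A and c = c])
    show "E v y \<and> c y = j \<and> real (card {u. u < n \<and> c u \<noteq> c y \<and> \<not> E y u}) \<le> t * n"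
      if "j \<in> {..<p}" "y \<in> A j" for j y
      using that unfolding A_def B_def miss_def by auto
    show "real p * (t * n) + real (M * p) < real (card (A j))" if "j \<in> {..<p}" for j
    proof -
      have "card (own v) \<le> card {u. u < n \<and> E v u \<and> c u = j}"
        using part that v unfolding stable_partition_def own_def by auto
      hence "real (card (A j)) \<ge> w / 3 - card B"
        using card_Diff_ge[OF B(2), of "{u. u < n \<and> E v u \<and> c u = j}"] o unfolding A_def by linarith
      moreover have "real p * (t * n) = w / 6" using p2 by (simp add: t_def w_def)
      moreover have "real (M * p) = real M * p" by simp
      ultimately show ?thesis using B(1) numeric by linarith
    qed
  qed (use t in \<open>auto simp: clique_def\<close>)
qed

text \<open>A class has at least \<open>4 * M * w - s\<close> vertices, and each good vertex misses
  at most w of them.\<close>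

lemma class_minus_missing:
  assumes j: "j < p" and X: "X \<subseteq> Gd" "finite X" and cX: "\<And>x. x \<in> X \<Longrightarrow> c x \<noteq> j" and F: "finite F"
    and sz: "real (card X) * w + real (card F) < 4 * real M * w - s"
  shows "\<exists>u. u < n \<and> c u = j \<and> u \<notin> F \<and> (\<forall>x\<in>X. E x u)"
proof -
  have "card (F \<union> (\<Union>x\<in>X. miss x)) \<le> card F + (\<Sum>x\<in>X. card (miss x))"
    using card_Un_le[of F "\<Union>x\<in>X. miss x"] card_UN_le[OF X(2), of miss] by linarith
  hence "real (card (F \<union> (\<Union>x\<in>X. miss x))) \<le> real (card F) + (\<Sum>x\<in>X. real (card (miss x)))"
    by (metis of_nat_add of_nat_le_iff of_nat_sum)
  also have "(\<Sum>x\<in>X. real (card (miss x))) \<le> (\<Sum>x\<in>X. w)" using X(1) by (intro sum_mono) (auto simp: Gd_def)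
  also have "real (card F) + (\<Sum>x\<in>X. w) < card (cls j)" using sz cls_size[OF j] numeric(7) by simp
  finally have "\<not> cls j \<subseteq> F \<union> (\<Union>x\<in>X. miss x)"
    using card_mono[of "F \<union> (\<Union>x\<in>X. miss x)" "cls j"] F X(2) fin by (auto simp: not_le)
  then obtain u where u: "u \<in> cls j" "u \<notin> F" "\<forall>x\<in>X. u \<notin> miss x" by blast
  have "E x u" if "x \<in> X" for x using u that cX[OF that] unfolding miss_def cls_def by auto
  thus ?thesis using u unfolding cls_def by auto
qed

text \<open>Joining a vertex that misses many cross edges to all good vertices of the other classes keeps
  the graph free, since an unused good vertex of its class can replace it, and raises the weight.\<close>

lemma inside_light_is_good:
  assumes v: "v < n" and o: "real (card (own v)) < w / 3"
  shows "v \<in> Gd"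
proof (rule ccontr)
  assume "v \<notin> Gd"
  hence mv: "real (card (miss v)) > w" using v by (auto simp: Gd_def)
  define E' where "E' a b \<longleftrightarrow> (a \<noteq> v \<and> b \<noteq> v \<and> E a b) \<or> (a = v \<and> b \<in> Gd \<and> c b \<noteq> c v) \<or> (b = v \<and> a \<in> Gd \<and> c a \<noteq> c v)" for a b
  have g': "graph_on n E'" using v graph_onD[OF g] unfolding graph_on_def E'_def Gd_def by blast
  have "SF_free p ks n (edge_set E')"
    unfolding SF_free_def
  proof
    assume con: "contains_SF p ks n (edge_set E')"
    have "contains_SF p ks n (edge_set E)"
    proof (rule contains_SF_transfer[OF g' con])
      fix S :: "nat set" assume S: "finite S" "card S \<le> card (SF_verts p ks)" "S \<subseteq> {..<n}"
      define X where "X = {x \<in> S. x \<in> Gd \<and> c x \<noteq> c v}"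
      have "card X \<le> card S" unfolding X_def using S(1) by (intro card_mono) auto
      hence cXM: "card X \<le> M" "card S \<le> M" using S(2) M_ge(2) by auto
      have "\<exists>u. u < n \<and> c u = c v \<and> u \<notin> S \<and> (\<forall>x\<in>X. E x u)"
      proof (rule class_minus_missing[OF c_lt])
        have "real (card X) * w \<le> M * w" using cXM numeric(5) by (intro mult_right_mono) auto
        moreover have "real (card S) \<le> M" using cXM by simp
        moreover have "real M * p \<ge> 0" by simp
        ultimately show "real (card X) * w + real (card S) < 4 * real M * w - s" using numeric by linarith
      qed (use S in \<open>auto simp: X_def\<close>)
      then obtain u where u: "u < n" "c u = c v" "u \<notin> S" "\<forall>x\<in>X. E x u" by blast
      define h where "h x = (if x = v then u else x)" for x
      have "inj_on h S" using u(3) by (auto simp: inj_on_def h_def)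
      moreover have "h ` S \<subseteq> {..<n}" using S(3) u(1) by (auto simp: h_def)
      moreover have "E (h x) (h y)" if "x \<in> S" "y \<in> S" "E' x y" for x y
      proof -
        have "E a u" if "a \<in> S" "a \<in> Gd" "c a \<noteq> c v" for a using u(4) that by (auto simp: X_def)
        thus ?thesis using that graph_on_sym[OF g] unfolding E'_def h_def by auto
      qed
      ultimately show "\<exists>h. inj_on h S \<and> h ` S \<subseteq> {..<n} \<and> (\<forall>x\<in>S. \<forall>y\<in>S. E' x y \<longrightarrow> E (h x) (h y))" by blast
    qed
    thus False using free unfolding SF_free_def by blast
  qed
  hence "quad n E' z \<le> quad n E z" by (rule max[OF g'])
  moreover have "quad n E' z - quad n E z =
    2 * z v * ((\<Sum>b<n. of_bool (E' v b) * z b) - (\<Sum>b<n. of_bool (E v b) * z b))"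
  proof (rule quad_change_vertex)
    show "E a b \<Longrightarrow> E b a" "E' a b \<Longrightarrow> E' b a" for a b using graph_onD(1)[OF g] graph_onD(1)[OF g'] by blast+
    show "\<not> E v v" "\<not> E' v v" using graph_onD(4)[OF g] graph_onD(4)[OF g'] by blast+
    show "E' a b = E a b" if "a \<noteq> v" "b \<noteq> v" for a b using that by (simp add: E'_def)
  qed (rule v)
  ultimately have "2 * z v * ((\<Sum>b<n. of_bool (E' v b) * z b) - (\<Sum>b<n. of_bool (E v b) * z b)) \<le> 0" by linarith
  hence le: "(\<Sum>b<n. of_bool (E' v b) * z b) \<le> (\<Sum>b<n. of_bool (E v b) * z b)"
    using z[OF v] by (simp add: mult_le_0_iff)
  \<comment> \<open>Both neighbourhoods of v are compared with \<open>cross\<close>: the new one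
    lacks only the bad vertices, of bounded weight, while the old one lacks \<open>miss v\<close>,
    of weight above w - s, and gains \<open>own v\<close>, of weight below w / 3 + s.\<close>
  define cross where "cross = {u. u < n \<and> c u \<noteq> c v}"
  have "(\<Sum>b<n. of_bool (E' v b) * z b) = sum z {u. u < n \<and> E' v u}" by (simp add: sum_over_filter)
  also have "{u. u < n \<and> E' v u} = cross \<inter> Gd" unfolding E'_def cross_def Gd_def by auto
  also have "sum z (cross \<inter> Gd) = sum z cross - sum z (cross - Gd)"
    using sum.Int_Diff[of cross z Gd] by (simp add: cross_def)
  finally have new: "(\<Sum>b<n. of_bool (E' v b) * z b) = sum z cross - sum z (cross - Gd)" .
  have "(\<Sum>b<n. of_bool (E v b) * z b) = sum z {u. u < n \<and> E v u}" by (simp add: sum_over_filter)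
  also have "{u. u < n \<and> E v u} = own v \<union> (cross - miss v)" unfolding own_def cross_def miss_def by auto
  also have "sum z \<dots> = sum z (own v) + sum z (cross - miss v)"
    by (intro sum.union_disjoint) (auto simp: own_def cross_def)
  also have "sum z (cross - miss v) = sum z cross - sum z (miss v)"
    by (intro sum_diff) (auto simp: cross_def miss_def)
  finally have old: "(\<Sum>b<n. of_bool (E v b) * z b) = sum z (own v) + (sum z cross - sum z (miss v))" .
  have "sum z (cross - Gd) \<le> (\<Sum>u\<in>cross - Gd. K)" using z by (intro sum_mono) (auto simp: cross_def)
  also have "\<dots> = card (cross - Gd) * K" by simp
  also have "\<dots> \<le> (K / \<delta>) * K"
  proof (intro mult_right_mono)
    have "card (cross - Gd) \<le> card ({..<n} - Gd)" by (intro card_mono) (auto simp: cross_def)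
    thus "real (card (cross - Gd)) \<le> K / \<delta>" using not_Gd_count by linarith
  qed (use K1 in auto)
  finally have 1: "sum z (cross - Gd) \<le> K * K / \<delta>" by simp
  have 2: "sum z (own v) \<le> card (own v) + s" 
  proof -
    have "own v \<subseteq> {..<n}" by (auto simp: own_def)
    thus ?thesis using weight[of "own v"] by linarith
  qed
  have 3: "sum z (miss v) \<ge> card (miss v) - s" 
  proof -
    have "miss v \<subseteq> {..<n}" by (auto simp: miss_def)
    thus ?thesis using weight[of "miss v"] by linarith
  qed
  have "real M * p \<ge> 0" by simp
  thus False using le new old 1 2 3 mv o numeric by linarith
qed

lemma good_nbrs_in_class:
  assumes v: "v \<in> Gd" and j: "j < p" "j \<noteq> c v"
  shows "real (card {u \<in> Gd. E v u \<and> c u = j}) > p * w + real (M * p)"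
proof -
  have "cls j - (miss v \<union> ({..<n} - Gd)) \<subseteq> {u \<in> Gd. E v u \<and> c u = j}"
    using j unfolding cls_def miss_def by auto
  hence "card (cls j - (miss v \<union> ({..<n} - Gd))) \<le> card {u \<in> Gd. E v u \<and> c u = j}"
    using fin by (intro card_mono) auto
  moreover have "card (miss v \<union> ({..<n} - Gd)) \<le> card (miss v) + card ({..<n} - Gd)" by (rule card_Un_le)
  moreover have "real (card (cls j - (miss v \<union> ({..<n} - Gd)))) \<ge> real (card (cls j)) - real (card (miss v \<union> ({..<n} - Gd)))"
    using fin by (intro card_Diff_ge) auto
  moreover have "card (miss v) \<le> w" using v by (simp add: Gd_def)
  moreover have "real (card (cls j)) \<ge> 4 * real M * w - s" using cls_size[OF j(1)] numeric(7) by linarith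
  moreover have "real (M * p) = real M * p" by simp
  moreover have "real M * p \<ge> 0" by simp
  ultimately show ?thesis using not_Gd_count numeric by linarith
qed

text \<open>Each of M good neighbours in the class of v starts a petal, which is completed by one
  vertex from each of the other p - 1 classes.\<close>

lemma many_inside_nbrs_is_centre:
  assumes v: "v \<in> Gd" and o: "card (own v \<inter> Gd) \<ge> M"
  shows "has_fan p E M {} v"
proof -
  obtain S where S: "S \<subseteq> own v \<inter> Gd" "card S = M" "finite S" using obtain_subset_with_card_n[OF o] by metis
  obtain h where h: "bij_betw h {0..<M} S" using ex_bij_betw_nat_finite[OF S(3)] S(2) by auto
  have hS: "h a \<in> own v" "h a \<in> Gd" if "a < M" for a using h S(1) that by (auto simp: bij_betw_def)
  show ?thesis
  proof (rule fan_from_transversals[OF g, where D = w and J = "{..<p} - {c v}" and X = "\<lambda>a. {h a}"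
        and A = "\<lambda>j. {u \<in> Gd. E v u \<and> c u = j}" and c = c])
    show "0 \<le> w" using numeric(5) by simp
    fix a assume a: "a < M"
    have E: "E v (h a)" "h a \<noteq> v" using hS(1)[OF a] graph_onD[OF g] unfolding own_def by auto
    have "clique E (insert v {h a})" using E(1) graph_onD(1)[OF g E(1)] by (auto simp: clique_def)
    moreover have "card ({..<p} - {c v}) = p - 1" using c_lt[of v] by simp
    ultimately show "finite {h a} \<and> card {h a} + card ({..<p} - {c v}) = p \<and> v \<notin> {h a} \<and> clique E (insert v {h a})"
      using E(2) p2 by simp
  next
    fix a b assume "a < M" "b < M" "a \<noteq> b"
    thus "{h a} \<inter> {h b} = {}" using h by (auto simp: bij_betw_def inj_on_def)
  next
    fix a x assume "a < M" "x \<in> {h a}"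
    thus "c x \<notin> {..<p} - {c v} \<and> real (card {u. u < n \<and> c u \<noteq> c x \<and> \<not> E x u}) \<le> w"
      using hS[of a] unfolding own_def Gd_def miss_def by auto
  next
    fix j y assume "j \<in> {..<p} - {c v}" "y \<in> {u \<in> Gd. E v u \<and> c u = j}"
    thus "E v y \<and> c y = j \<and> real (card {u. u < n \<and> c u \<noteq> c y \<and> \<not> E y u}) \<le> w"
      unfolding Gd_def miss_def by auto
  next
    fix j assume "j \<in> {..<p} - {c v}"
    thus "real p * w + real (M * p) < real (card {u \<in> Gd. E v u \<and> c u = j})"
      using good_nbrs_in_class[OF v, of j] by auto
  qed simp
qed

text \<open>These vertices can be centres of any star, whatever else has been embedded; they turn
  out to be the vertices of the join.\<close>

definition L :: "nat set" where "L = {v. v < n \<and> has_fan p E M {} v}"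

lemma L_sub: "L \<subseteq> {..<n}" and L_fin: "finite L" unfolding L_def by auto

lemma L_card: "card L < length ks"
  by (rule centres_lt[OF g _ ks(1) free M_ge(5) L_fin]) (use p2 in \<open>auto simp: L_def\<close>)

lemma not_L: 
  assumes "v < n" "v \<notin> L" shows "v \<in> Gd" "card (own v \<inter> Gd) < M" "real (card (own v)) < w / 3"
proof -
  have nf: "\<not> has_fan p E M {} v" using assms by (simp add: L_def)
  thus o: "real (card (own v)) < w / 3" using inside_heavy_is_centre[OF assms(1)] by fastforce
  show v: "v \<in> Gd" by (rule inside_light_is_good[OF assms(1) o])
  show "card (own v \<inter> Gd) < M" using many_inside_nbrs_is_centre[OF v] nf by fastforce
qed

text \<open>The at most 2 * M ends of such a matching have a common good neighbour v outside L in
  another class. The matching edges seed M petals at v, so v would belong to L.\<close>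

lemma no_inside_matching:
  assumes X: "\<And>a. a < M \<Longrightarrow> \<exists>x y. X a = {x, y} \<and> x \<in> Gd \<and> y \<in> Gd \<and> E x y \<and> c x = j \<and> c y = j"
    and d: "\<And>a b. a < M \<Longrightarrow> b < M \<Longrightarrow> a \<noteq> b \<Longrightarrow> X a \<inter> X b = {}"
  shows False
proof -
  have M0: "0 < M" using M_ge(4) by simp
  have jp: "j < p" using X[OF M0] c_lt by auto
  obtain i where i: "i < p" "i \<noteq> j"
  proof (cases "j = 0")
    case True thus ?thesis using that[of 1] p2 by simp
  next
    case False thus ?thesis using that[of 0] p2 by simp
  qed
  define U where "U = (\<Union>a<M. X a)"
  have Xa: "X a \<subseteq> Gd" "finite (X a)" "card (X a) = 2" "\<And>x. x \<in> X a \<Longrightarrow> c x = j" "clique E (X a)" if aM: "a < M" for a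
  proof -
    obtain x y where xy: "X a = {x, y}" "x \<in> Gd" "y \<in> Gd" "E x y" "c x = j" "c y = j" using X[OF aM] by blast
    thus "X a \<subseteq> Gd" "finite (X a)" "card (X a) = 2" "\<And>x. x \<in> X a \<Longrightarrow> c x = j" "clique E (X a)"
      using graph_onD[OF g xy(4)] by (auto simp: clique_def)
  qed
  have "card U \<le> (\<Sum>a<M. card (X a))" unfolding U_def by (rule card_UN_le) simp
  also have "\<dots> = 2 * M" using Xa(3) by simp
  finally have cU: "card U \<le> 2 * M" .
  have U: "U \<subseteq> Gd" "finite U" "\<And>x. x \<in> U \<Longrightarrow> c x = j" using Xa unfolding U_def by auto
  define W where "W = {v \<in> L. c v = i}"
  have fW: "finite W" using L_fin by (simp add: W_def)
  have "\<exists>u. u < n \<and> c u = i \<and> u \<notin> ({..<n} - Gd) \<union> W \<and> (\<forall>x\<in>U. E x u)"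
  proof (rule class_minus_missing[OF i(1) U(1,2)])
    show "c x \<noteq> i" if "x \<in> U" for x using U(3)[OF that] i(2) by simp
    have "card W \<le> card L" unfolding W_def using L_fin by (intro card_mono) auto
    hence "card W \<le> M" using L_card M_ge(3) by simp
    moreover have "card (({..<n} - Gd) \<union> W) \<le> card ({..<n} - Gd) + card W" by (rule card_Un_le)
    ultimately have "real (card (({..<n} - Gd) \<union> W)) \<le> K / \<delta> + M" using not_Gd_count by linarith
    moreover have "real (card U) * w \<le> (2 * M) * w" using cU numeric(5) by (intro mult_right_mono) linarith+
    moreover have "real M * p \<ge> 0" by simp
    ultimately show "real (card U) * w + real (card (({..<n} - Gd) \<union> W)) < 4 * real M * w - s"
      using numeric by linarith
  qed (use fW in auto)
  then obtain v where v: "v < n" "c v = i" "v \<in> Gd" "v \<notin> L" "\<And>x. x \<in> U \<Longrightarrow> E x v" unfolding W_def by blast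
  have "has_fan p E M {} v"
  proof (rule fan_from_transversals[OF g, where D = w and J = "{..<p} - {i, j}" and X = X
        and A = "\<lambda>j. {u \<in> Gd. E v u \<and> c u = j}" and c = c])
    show "0 \<le> w" using numeric(5) by simp
    fix a assume a: "a < M"
    have vX: "E x v" if "x \<in> X a" for x using v(5) that a unfolding U_def by blast
    have "v \<notin> X a" using Xa(4)[OF a, of v] v(2) i(2) by auto
    moreover have "clique E (insert v (X a))"
      using Xa(5)[OF a] vX graph_on_sym[OF g] unfolding clique_def by auto
    moreover have "card (X a) + card ({..<p} - {i, j}) = p"
      using Xa(3)[OF a] i jp p2 by (simp add: card_Diff_subset)
    ultimately show "finite (X a) \<and> card (X a) + card ({..<p} - {i, j}) = p \<and> v \<notin> X a \<and> clique E (insert v (X a))"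
      using Xa(2)[OF a] by blast
  next
    fix a b assume "a < M" "b < M" "a \<noteq> b"
    thus "X a \<inter> X b = {}" by (rule d)
  next
    fix a x assume "a < M" "x \<in> X a"
    thus "c x \<notin> {..<p} - {i, j} \<and> real (card {u. u < n \<and> c u \<noteq> c x \<and> \<not> E x u}) \<le> w"
      using Xa(1,4)[of a] unfolding Gd_def miss_def by auto
  next
    fix k y assume "k \<in> {..<p} - {i, j}" "y \<in> {u \<in> Gd. E v u \<and> c u = k}"
    thus "E v y \<and> c y = k \<and> real (card {u. u < n \<and> c u \<noteq> c y \<and> \<not> E y u}) \<le> w"
      unfolding Gd_def miss_def by auto
  next
    fix k assume "k \<in> {..<p} - {i, j}"
    thus "real p * w + real (M * p) < real (card {u \<in> Gd. E v u \<and> c u = k})"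
      using good_nbrs_in_class[OF v(3), of k] v(2) by auto
  qed simp
  thus False using v(1,4) by (simp add: L_def)
qed

end

text \<open>Only pairs off L are compared with the multipartite pattern, and they are counted as
  ordered pairs. The colours of vertices in L carry no meaning and change class sizes by at most r.
  Sizes up to order sqrt n are all that stability yields.\<close>

definition structured ::
    "nat \<Rightarrow> nat \<Rightarrow> nat \<Rightarrow> nat \<Rightarrow> (nat \<Rightarrow> nat \<Rightarrow> bool) \<Rightarrow> nat set \<Rightarrow> (nat \<Rightarrow> nat) \<Rightarrow> real \<Rightarrow> bool" where
  "structured p r k n E L c C \<longleftrightarrow> graph_on n E \<and> L \<subseteq> {..<n} \<and> card L = r \<and> (\<forall>v. c v < p) \<and>
     (\<forall>u\<in>L. \<forall>v<n. u \<noteq> v \<longrightarrow> E u v) \<and> (\<forall>v. v \<notin> L \<longrightarrow> \<not> has_fan p E k L v) \<and>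
     (\<Sum>a<n. \<Sum>b<n. of_bool (a \<notin> L \<and> b \<notin> L \<and> E a b \<and> c a = c b)) \<le> C \<and>
     (\<Sum>a<n. \<Sum>b<n. of_bool (a \<notin> L \<and> b \<notin> L \<and> c a \<noteq> c b \<and> \<not> E a b)) \<le> C \<and>
     (\<forall>j<p. \<bar>real (card {v. v < n \<and> c v = j}) - n / p\<bar> \<le> C * sqrt n)"

text \<open>A fan off L with centre off L uses no pair that meets L.\<close>

lemma has_fan_cong_off:
  assumes "has_fan p E' k L v" "v \<notin> L" and "\<And>a b. a \<notin> L \<Longrightarrow> b \<notin> L \<Longrightarrow> E' a b \<Longrightarrow> E a b"
  shows "has_fan p E k L v"
proof -
  obtain X where X: "fan p E' k L v X" using assms(1) unfolding has_fan_def by blast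
  have "fan p E k L v X"
    unfolding fan_def
  proof (intro conjI allI impI)
    fix a assume a: "a < k"
    note F = fanD[OF X a]
    show "finite (X a)" "card (X a) = p" "v \<notin> X a" "X a \<inter> L = {}" using F by auto
    show "clique E (insert v (X a))"
      unfolding clique_def using cliqueD[OF F(5)] F(4) assms(2,3) by (metis disjoint_iff insert_iff)
  next
    fix a b assume "a < k" "b < k" "a \<noteq> b"
    thus "X a \<inter> X b = {}" using fanD(6)[OF X] by blast
  qed
  thus ?thesis unfolding has_fan_def by blast
qed

lemma double_sum_ge_term:
  fixes f :: "nat \<Rightarrow> nat \<Rightarrow> real"
  assumes "\<And>a b. a < n \<Longrightarrow> b < n \<Longrightarrow> 0 \<le> f a b" "y < n"
  shows "(\<Sum>b<n. f y b) \<le> (\<Sum>a<n. \<Sum>b<n. f a b)"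
  by (rule member_le_sum[where f = "\<lambda>a. \<Sum>b<n. f a b"]) (use assms in \<open>auto intro: sum_nonneg\<close>)

section \<open>Bounding the extra and missing pairs, and identifying the join\<close>

context weighted_extremal
begin

text \<open>In each class M disjoint inner edges are excluded by \<open>no_inside_matching\<close>,
  so 2 * M vertices meet all inner edges between good vertices of that class.\<close>

lemma inside_cover:
  "\<exists>T. finite T \<and> card T \<le> 2 * p * M \<and>
    (\<forall>a b. a \<in> Gd \<longrightarrow> b \<in> Gd \<longrightarrow> E a b \<longrightarrow> c a = c b \<longrightarrow> a \<in> T \<or> b \<in> T)"
proof -
  define F where "F j = {X. \<exists>x y. X = {x, y} \<and> x \<in> Gd \<and> y \<in> Gd \<and> E x y \<and> c x = j \<and> c y = j}" for j
  have "\<exists>T. finite T \<and> card T \<le> 2 * M \<and> (\<forall>X\<in>F j. X \<inter> T \<noteq> {})" for j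
  proof -
    have F2: "finite X \<and> card X = 2" if "X \<in> F j" for X
      using that graph_onD(4)[OF g] by (auto simp: F_def card_insert_if)
    have "(\<exists>X :: nat \<Rightarrow> nat set. (\<forall>a<M. X a \<in> F j) \<and> (\<forall>a<M. \<forall>b<M. a \<noteq> b \<longrightarrow> X a \<inter> X b = {})) \<or>
      (\<exists>T. finite T \<and> card T \<le> 2 * M \<and> (\<forall>X\<in>F j. X \<inter> T \<noteq> {}))"
      by (rule disjoint_family_or_hitting_set) (rule F2)
    thus ?thesis
    proof (elim disjE)
      assume "\<exists>X :: nat \<Rightarrow> nat set. (\<forall>a<M. X a \<in> F j) \<and> (\<forall>a<M. \<forall>b<M. a \<noteq> b \<longrightarrow> X a \<inter> X b = {})"
      then obtain X :: "nat \<Rightarrow> nat set" where X: "\<forall>a<M. X a \<in> F j"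
        "\<forall>a<M. \<forall>b<M. a \<noteq> b \<longrightarrow> X a \<inter> X b = {}" by (elim exE conjE)
      have False
      proof (rule no_inside_matching)
        show "\<exists>x y. X a = {x, y} \<and> x \<in> Gd \<and> y \<in> Gd \<and> E x y \<and> c x = j \<and> c y = j" if "a < M" for a
          using X(1) that unfolding F_def by simp
      qed (use X(2) in blast)
      thus ?thesis ..
    qed
  qed
  then obtain T where T: "\<And>j. finite (T j)" "\<And>j. card (T j) \<le> 2 * M" "\<And>j X. X \<in> F j \<Longrightarrow> X \<inter> T j \<noteq> {}"
    by metis
  have "card (\<Union>j<p. T j) \<le> (\<Sum>j<p. card (T j))" by (rule card_UN_le) simp
  also have "\<dots> \<le> (\<Sum>j<p. 2 * M)" by (intro sum_mono T(2))
  finally have "card (\<Union>j<p. T j) \<le> 2 * p * M" by simp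
  moreover have "a \<in> (\<Union>j<p. T j) \<or> b \<in> (\<Union>j<p. T j)" if "a \<in> Gd" "b \<in> Gd" "E a b" "c a = c b" for a b
  proof -
    have "{a, b} \<in> F (c a)" unfolding F_def
      by (intro CollectI exI[of _ a] exI[of _ b] conjI) (use that in auto)
    hence "{a, b} \<inter> T (c a) \<noteq> {}" by (rule T(3))
    thus ?thesis using c_lt[of a] by blast
  qed
  ultimately show ?thesis using T(1) by (intro exI[of _ "\<Union>j<p. T j"]) auto
qed

definition inside_pair :: "nat \<Rightarrow> nat \<Rightarrow> bool" where
  "inside_pair a b \<longleftrightarrow> a \<notin> L \<and> b \<notin> L \<and> E a b \<and> c a = c b"

text \<open>Every inner edge off L meets the cover T of at most 2 * p * M vertices, and each vertex
  off L has fewer than M inner neighbours off L; each edge is charged in both orders.\<close>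

lemma inside_count: "(\<Sum>a<n. \<Sum>b<n. of_bool (inside_pair a b)) \<le> 4 * p * (real M)\<^sup>2"
proof -
  obtain T where T: "finite T" "card T \<le> 2 * p * M"
    "\<And>a b. a \<in> Gd \<Longrightarrow> b \<in> Gd \<Longrightarrow> E a b \<Longrightarrow> c a = c b \<Longrightarrow> a \<in> T \<or> b \<in> T"
    using inside_cover by blast
  have sym: "inside_pair a b = inside_pair b a" for a b
    unfolding inside_pair_def using graph_on_sym[OF g, of a b] by auto
  have row: "(\<Sum>b<n. of_bool (inside_pair a b)) \<le> real M" if a: "a < n" for a
  proof (cases "a \<in> L")
    case True thus ?thesis by (simp add: inside_pair_def)
  next
    case False
    have "(\<Sum>b<n. of_bool (inside_pair a b)) = real (card {b. b < n \<and> inside_pair a b})"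
      by (simp only: card_eq_sum_of_bool)
    also have "card {b. b < n \<and> inside_pair a b} \<le> card (own a \<inter> Gd)"
      using not_L(1) fin by (intro card_mono) (auto simp: own_def inside_pair_def)
    also have "\<dots> \<le> M" using not_L(2)[OF a False] by simp
    finally show ?thesis by simp
  qed
  have "(\<Sum>a<n. \<Sum>b<n. of_bool (inside_pair a b)) \<le>
    (\<Sum>a<n. \<Sum>b<n. of_bool (a \<in> T) * of_bool (inside_pair a b) + of_bool (b \<in> T) * of_bool (inside_pair b a) :: real)"
  proof (intro sum_mono)
    fix a b assume ab: "a \<in> {..<n}" "b \<in> {..<n}"
    have "inside_pair a b \<longrightarrow> a \<in> T \<or> b \<in> T"
      using T(3)[of a b] not_L(1)[of a] not_L(1)[of b] ab unfolding inside_pair_def by auto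
    thus "of_bool (inside_pair a b) \<le> of_bool (a \<in> T) * of_bool (inside_pair a b) + of_bool (b \<in> T) * (of_bool (inside_pair b a) :: real)"
      using sym[of a b] by auto
  qed
  also have "\<dots> = (\<Sum>a<n. \<Sum>b<n. of_bool (a \<in> T) * of_bool (inside_pair a b)) +
    (\<Sum>a<n. \<Sum>b<n. of_bool (b \<in> T) * of_bool (inside_pair b a))" by (simp add: sum.distrib)
  also have "(\<Sum>a<n. \<Sum>b<n. of_bool (b \<in> T) * of_bool (inside_pair b a) :: real) =
    (\<Sum>a<n. \<Sum>b<n. of_bool (a \<in> T) * of_bool (inside_pair a b))" by (rule sum.swap)
  also have "(\<Sum>a<n. \<Sum>b<n. of_bool (a \<in> T) * of_bool (inside_pair a b) :: real) =
    (\<Sum>a<n. of_bool (a \<in> T) * (\<Sum>b<n. of_bool (inside_pair a b)))" by (simp add: sum_distrib_left)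
  also have "\<dots> \<le> (\<Sum>a<n. of_bool (a \<in> T) * real M)" using row by (intro sum_mono mult_left_mono) auto
  also have "\<dots> = real (card {a. a < n \<and> a \<in> T}) * M" by (simp only: card_eq_sum_of_bool sum_distrib_right)
  also have "\<dots> \<le> real (2 * p * M) * M"
  proof (intro mult_right_mono)
    have "card {a. a < n \<and> a \<in> T} \<le> card T" using T(1) by (intro card_mono) auto
    thus "real (card {a. a < n \<and> a \<in> T}) \<le> real (2 * p * M)" using T(2) by linarith
  qed simp
  finally show ?thesis by (simp add: power2_eq_square mult_ac)
qed

text \<open>Replacing E by the full join of L' with the multipartite graph loses only inner pairs,
  whose weight is bounded; by maximality of E the weight gained is bounded by the same amount. L'
  may be larger than L, which is how the size of L is determined.\<close>

lemma weight_comparison: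
  assumes L': "L \<subseteq> L'" "L' \<subseteq> {..<n}" "card L' < length ks"
  shows "quad n (\<lambda>a b. (a \<noteq> b \<and> a < n \<and> b < n \<and> (a \<in> L' \<or> b \<in> L' \<or> c a \<noteq> c b)) \<and> \<not> E a b) z
    \<le> 4 * p * (real M)\<^sup>2 * K\<^sup>2"
proof -
  let ?F = "\<lambda>a b. a \<noteq> b \<and> a < n \<and> b < n \<and> (a \<in> L' \<or> b \<in> L' \<or> c a \<noteq> c b)"
  have gF: "graph_on n ?F" unfolding graph_on_def by auto
  have "SF_free p ks n (edge_set ?F)"
    using p2 L' finite_subset[OF L'(2)] c_lt ks(1) by (intro multipartite_join_free) auto
  hence "quad n ?F z \<le> quad n E z" by (rule max[OF gF])
  moreover have "quad n ?F z + quad n (\<lambda>a b. E a b \<and> \<not> ?F a b) z = quad n E z + quad n (\<lambda>a b. ?F a b \<and> \<not> E a b) z"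
    unfolding quad_def sum.distrib[symmetric] by (intro sum.cong) auto
  moreover have "quad n (\<lambda>a b. E a b \<and> \<not> ?F a b) z \<le> K\<^sup>2 * (\<Sum>a<n. \<Sum>b<n. of_bool (E a b \<and> \<not> ?F a b))"
    using z by (intro quad_bound) (auto intro: less_imp_le)
  moreover have "K\<^sup>2 * (\<Sum>a<n. \<Sum>b<n. of_bool (E a b \<and> \<not> ?F a b)) \<le> K\<^sup>2 * (\<Sum>a<n. \<Sum>b<n. of_bool (inside_pair a b))"
  proof (intro mult_left_mono sum_mono)
    fix a b
    have "E a b \<and> \<not> ?F a b \<longrightarrow> inside_pair a b"
      using L'(1) graph_onD[OF g, of a b] unfolding inside_pair_def by blast
    thus "of_bool (E a b \<and> \<not> ?F a b) \<le> (of_bool (inside_pair a b) :: real)" by (simp add: of_bool_def)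
  qed simp
  moreover have "K\<^sup>2 * (\<Sum>a<n. \<Sum>b<n. of_bool (inside_pair a b)) \<le> K\<^sup>2 * (4 * p * (real M)\<^sup>2)"
    by (intro mult_left_mono inside_count) auto
  moreover have "K\<^sup>2 * (4 * p * (real M)\<^sup>2) = 4 * p * (real M)\<^sup>2 * K\<^sup>2" by simp
  ultimately show ?thesis by linarith
qed

lemma numeric2: "n / p \<le> n / 2" "16 * w \<le> n / 2" "real M * p \<ge> 0"
proof -
  have "real n * 2 \<le> real n * p" using p2 by (intro mult_left_mono) auto
  thus 1: "n / p \<le> n / 2" using p2 by (simp add: field_simps)
  show "16 * w \<le> n / 2" using 1 numeric(7,8) by linarith
qed simp

text \<open>A vertex off L is good: it is adjacent to all but its own class and at most w more
  vertices. For p >= 2 these neighbours weigh at least n / 4, and \<open>zdeg\<close> passes this on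
  to \<open>z v\<close>.\<close>

lemma z_lower:
  assumes v: "v < n" "v \<notin> L" shows "z v \<ge> 1 / 4"
proof -
  let ?N = "{u. u < n \<and> E v u}"
  have "{..<n} - (cls (c v) \<union> miss v) \<subseteq> ?N" by (auto simp: cls_def miss_def)
  hence "card ({..<n} - (cls (c v) \<union> miss v)) \<le> card ?N" by (intro card_mono) auto
  moreover have "real (card ({..<n} - (cls (c v) \<union> miss v))) \<ge> real n - real (card (cls (c v) \<union> miss v))"
    using card_Diff_ge[of "cls (c v) \<union> miss v" "{..<n}"] fin by simp
  moreover have "card (cls (c v) \<union> miss v) \<le> card (cls (c v)) + card (miss v)" by (rule card_Un_le)
  moreover have "card (miss v) \<le> w" using not_L(1)[OF v] by (simp add: Gd_def)
  moreover have "card (cls (c v)) \<le> n / p + s" using cls_size[OF c_lt[of v]] by linarith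
  moreover have "sum z ?N \<ge> card ?N - s"
  proof -
    have "?N \<subseteq> {..<n}" by auto
    from weight[OF this] show ?thesis by linarith
  qed
  moreover have "sum z ?N \<le> n * z v" using zdeg[OF v(1)] by (simp add: sum_over_filter)
  ultimately have "n * z v \<ge> real n * (1 / 4)" using numeric numeric2 by linarith
  thus ?thesis using n_pos by (simp add: mult_le_cancel_left_pos)
qed

text \<open>If L were smaller, one more vertex y could be joined to everything and the comparison
  graph would remain free. The pairs missing at y weigh at least w / 4, which is linear in n and
  beyond the constant bound of \<open>weight_comparison\<close>.\<close>

lemma L_card_eq: "card L = length ks - 1"
proof (rule ccontr)
  assume "card L \<noteq> length ks - 1"
  hence lt: "card L + 1 < length ks" using L_card by linarith
  have "real (card L) < n"
  proof -
    have "card L < M" using L_card M_ge(3) by simp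
    hence "real (card L) \<le> M" by simp
    thus ?thesis using numeric numeric2 by linarith
  qed
  hence "\<not> {..<n} \<subseteq> L" using card_mono[OF L_fin, of "{..<n}"] by auto
  then obtain y where y: "y < n" "y \<notin> L" by auto
  define A where "A = cls (c y) - (insert y (own y))"
  have An: "A \<subseteq> {..<n}" unfolding A_def cls_def by auto
  have "real (card A) \<ge> card (cls (c y)) - real (card (insert y (own y)))"
    unfolding A_def using fin by (intro card_Diff_ge) auto
  moreover have "card (insert y (own y)) \<le> card (own y) + 1" using fin by (simp add: card_insert_if)
  moreover have "real (card (cls (c y))) \<ge> 4 * real M * w - s" using cls_size[OF c_lt[of y]] numeric(7) by linarith
  moreover have "real (card (own y)) < w / 3" by (rule not_L(3)[OF y])
  moreover have "sum z A \<ge> card A - s" using weight[OF An] by linarith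
  ultimately have zA: "sum z A \<ge> w" using numeric numeric2 by linarith
  have le: "quad n (\<lambda>a b. (a \<noteq> b \<and> a < n \<and> b < n \<and> (a \<in> insert y L \<or> b \<in> insert y L \<or> c a \<noteq> c b)) \<and> \<not> E a b) z
    \<le> 4 * p * (real M)\<^sup>2 * K\<^sup>2"
    using lt y L_sub L_fin by (intro weight_comparison) auto
  have "z y * sum z A = (\<Sum>b<n. of_bool (b \<in> A) * (z y * z b))"
    using sum_over_filter[where n = n and P = "\<lambda>b. b \<in> A" and f = z] An
    by (simp add: sum_distrib_left Collect_conj_eq Int_absorb1 lessThan_def mult_ac)
  also have "\<dots> \<le> (\<Sum>b<n. of_bool ((y \<noteq> b \<and> y < n \<and> b < n \<and> (y \<in> insert y L \<or> b \<in> insert y L \<or> c y \<noteq> c b)) \<and> \<not> E y b) * z y * z b)"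
    using y z by (intro sum_mono) (auto simp: A_def own_def cls_def intro!: mult_nonneg_nonneg less_imp_le)
  also have "\<dots> \<le> quad n (\<lambda>a b. (a \<noteq> b \<and> a < n \<and> b < n \<and> (a \<in> insert y L \<or> b \<in> insert y L \<or> c a \<noteq> c b)) \<and> \<not> E a b) z"
    unfolding quad_def by (rule double_sum_ge_term) (use y z in \<open>auto intro!: mult_nonneg_nonneg less_imp_le\<close>)
  also note le
  finally have "z y * sum z A \<le> 4 * p * (real M)\<^sup>2 * K\<^sup>2" .
  moreover have "(1 / 4) * w \<le> z y * sum z A" using z_lower[OF y] zA numeric(5) by (intro mult_mono) auto
  ultimately show False using numeric numeric2 by linarith
qed

text \<open>Each missing pair off L has weight at least 1/16 by \<open>z_lower\<close>, so the bound
  on their weight bounds their number.\<close>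

lemma missing_count:
  "(\<Sum>a<n. \<Sum>b<n. of_bool (a \<notin> L \<and> b \<notin> L \<and> c a \<noteq> c b \<and> \<not> E a b)) \<le> 64 * p * (real M)\<^sup>2 * K\<^sup>2"
proof -
  let ?F = "\<lambda>a b. (a \<noteq> b \<and> a < n \<and> b < n \<and> (a \<in> L \<or> b \<in> L \<or> c a \<noteq> c b)) \<and> \<not> E a b"
  have "(\<Sum>a<n. \<Sum>b<n. of_bool (a \<notin> L \<and> b \<notin> L \<and> c a \<noteq> c b \<and> \<not> E a b)) \<le> 16 * quad n ?F z"
    unfolding quad_def sum_distrib_left
  proof (intro sum_mono)
    fix a b assume ab: "a \<in> {..<n}" "b \<in> {..<n}"
    show "of_bool (a \<notin> L \<and> b \<notin> L \<and> c a \<noteq> c b \<and> \<not> E a b) \<le> 16 * (of_bool (?F a b) * z a * z b)"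
    proof (cases "a \<notin> L \<and> b \<notin> L \<and> c a \<noteq> c b \<and> \<not> E a b")
      case True
      have "1 / 4 \<le> z a" "1 / 4 \<le> z b" using z_lower ab True by auto
      hence "(1 / 4) * (1 / 4) \<le> z a * z b" by (intro mult_mono) auto
      moreover have "?F a b" using True ab by auto
      ultimately show ?thesis by simp
    next
      case False
      have "0 \<le> z a" "0 \<le> z b" using z ab by (auto intro: less_imp_le)
      thus ?thesis using False by (simp only: of_bool_eq(1)) simp
    qed
  qed
  also have "\<dots> \<le> 16 * (4 * p * (real M)\<^sup>2 * K\<^sup>2)"
    using L_sub L_card by (intro mult_left_mono weight_comparison) auto
  finally show ?thesis by simp
qed

lemma no_fan_off_L: "v \<notin> L \<Longrightarrow> \<not> has_fan p E (last ks) L v"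
  by (rule no_fan_off_centres[OF g _ ks(1,2) free M_ge(6) L_fin L_card_eq]) (use p2 in \<open>auto simp: L_def\<close>)

text \<open>The criterion for freeness looks only at fans off L, so every pair meeting L may be
  added; positivity of z turns an added pair into a strict gain.\<close>

lemma L_dominating:
  assumes u: "u \<in> L" and v: "v < n" "u \<noteq> v" shows "E u v"
proof (rule ccontr)
  assume ne: "\<not> E u v"
  have un: "u < n" using u L_sub by auto
  define E' where "E' a b \<longleftrightarrow> E a b \<or> (a \<noteq> b \<and> a < n \<and> b < n \<and> (a \<in> L \<or> b \<in> L))" for a b
  have g': "graph_on n E'" using g unfolding graph_on_def E'_def by auto
  have "SF_free p ks n (edge_set E')"
  proof (rule SF_free_by_pigeonhole[OF g' _ ks(3) L_fin L_card])
    show "1 \<le> last ks" using ks by simp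
    fix x assume x: "x \<notin> L"
    show "\<not> has_fan p E' (last ks) L x"
    proof
      assume "has_fan p E' (last ks) L x"
      hence "has_fan p E (last ks) L x" by (rule has_fan_cong_off[OF _ x]) (auto simp: E'_def)
      thus False using no_fan_off_L[OF x] by blast
    qed
  qed
  hence "quad n E' z \<le> quad n E z" by (rule max[OF g'])
  moreover have "quad n E' z = quad n E z + quad n (\<lambda>a b. E' a b \<and> \<not> E a b) z"
    by (rule quad_split_sub) (simp add: E'_def)
  moreover have "z u * z v \<le> quad n (\<lambda>a b. E' a b \<and> \<not> E a b) z"
  proof -
    have "z u * z v = of_bool (E' u v \<and> \<not> E u v) * z u * z v" using ne u v un by (simp add: E'_def)
    also have "\<dots> \<le> (\<Sum>b<n. of_bool (E' u b \<and> \<not> E u b) * z u * z b)"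
      by (rule member_le_sum[where f = "\<lambda>b. of_bool (E' u b \<and> \<not> E u b) * z u * z b"])
        (use v un z in \<open>auto intro!: mult_nonneg_nonneg less_imp_le\<close>)
    also have "\<dots> \<le> quad n (\<lambda>a b. E' a b \<and> \<not> E a b) z"
      unfolding quad_def by (rule double_sum_ge_term) (use un z in \<open>auto intro!: mult_nonneg_nonneg less_imp_le\<close>)
    finally show ?thesis .
  qed
  moreover have "0 < z u * z v" using z un v by simp
  ultimately show False by linarith
qed

lemma is_structured:
  "structured p (length ks - 1) (last ks) n E L c (64 * p * (real M)\<^sup>2 * K\<^sup>2)"
proof -
  let ?C = "64 * p * (real M)\<^sup>2 * K\<^sup>2"
  have KK: "1 \<le> K\<^sup>2" using K1 by simp
  have pM: "1 \<le> p * (real M)\<^sup>2"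
  proof -
    have "1 * 1 \<le> real p * (real M)\<^sup>2" using p2 M_ge(4) by (intro mult_mono) auto
    thus ?thesis by simp
  qed
  have 1: "4 * p * (real M)\<^sup>2 \<le> ?C"
  proof -
    have "(4 * (p * (real M)\<^sup>2)) * 1 \<le> (64 * (p * (real M)\<^sup>2)) * K\<^sup>2" using KK pM by (intro mult_mono) auto
    thus ?thesis by simp
  qed
  have "sqrt K \<le> K"
  proof -
    have "sqrt K * 1 \<le> sqrt K * sqrt K" using K1 by (intro mult_left_mono) auto
    thus ?thesis using K1 by simp
  qed
  also have "K \<le> K\<^sup>2" using K1 by (simp add: power2_eq_square)
  also have "K\<^sup>2 \<le> ?C"
  proof -
    have "1 * K\<^sup>2 \<le> (64 * (p * (real M)\<^sup>2)) * K\<^sup>2" using pM by (intro mult_right_mono) auto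
    thus ?thesis by simp
  qed
  finally have sC: "s \<le> ?C * sqrt n" unfolding s_def real_sqrt_mult by (intro mult_right_mono) auto
  show ?thesis
    unfolding structured_def
  proof (intro conjI allI impI ballI)
    show "(\<Sum>a<n. \<Sum>b<n. of_bool (a \<notin> L \<and> b \<notin> L \<and> E a b \<and> c a = c b)) \<le> ?C"
      using inside_count 1 unfolding inside_pair_def by linarith
    show "\<bar>real (card {v. v < n \<and> c v = j}) - n / p\<bar> \<le> ?C * sqrt n" if "j < p" for j
      using cls_size[OF that] sC unfolding cls_def by linarith
  qed (use g L_sub L_card_eq c_lt L_dominating no_fan_off_L missing_count in auto)
qed

end

lemma stable_partition_mono:
  assumes "stable_partition p n E K c" "K \<le> K'"
  shows "stable_partition p n E K' c"
proof -
  have "K * n \<le> K' * n" using assms(2) by (intro mult_right_mono) auto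
  thus ?thesis using assms(1) unfolding stable_partition_def by (meson order_trans)
qed

lemma weighted_extremal_structured:
  fixes K :: real
  assumes p: "p \<ge> 2" and ks: "\<forall>k\<in>set ks. 1 \<le> k" "ks \<noteq> []" "\<forall>k\<in>set ks. last ks \<le> k" and K: "K \<ge> 1"
  shows "\<exists>C n0. \<forall>n\<ge>n0. \<forall>E z. graph_on n E \<and> SF_free p ks n (edge_set E) \<and>
    quad n E (\<lambda>_. 1) \<ge> (1 - 1 / p) * (real n)\<^sup>2 - K * n \<and>
    (\<forall>i<n. 0 < z i \<and> z i \<le> K) \<and> (\<Sum>i<n. (z i - 1)\<^sup>2) \<le> K \<and>
    (\<forall>v<n. (\<Sum>u<n. of_bool (E v u) * z u) \<le> n * z v) \<and>
    (\<forall>G. graph_on n G \<and> SF_free p ks n (edge_set G) \<longrightarrow> quad n G z \<le> quad n E z)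
    \<longrightarrow> (\<exists>L c. structured p (length ks - 1) (last ks) n E L c C)"
proof -
  obtain K' where K': "\<forall>n E. graph_on n E \<and> SF_free p ks n (edge_set E) \<and>
    quad n E (\<lambda>_. 1) \<ge> (1 - 1 / p) * (real n)\<^sup>2 - K * n \<longrightarrow> (\<exists>c. stable_partition p n E K' c)"
    using exists_stable_partition[of p ks K] p ks(1) by auto
  define B where "B = max K K'"
  have B: "B \<ge> K" "B \<ge> K'" "B \<ge> 1" using K by (auto simp: B_def)
  define M where "M = length ks + (p + 2) * sum_list ks + card (SF_verts p ks) + p + 2"
  define \<delta> where "\<delta> = 1 / (4 * real p * real M)"
  have "M > 0" by (simp add: M_def)
  hence \<delta>: "\<delta> > 0" using p by (simp add: \<delta>_def)
  define T where "T = B * B / \<delta> + 6 * p * B / \<delta> + real (M * p) + real M + 64 * p * (real M)\<^sup>2 * B\<^sup>2 + 1"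
  obtain n0 where n0: "real n0 \<ge> (T + 96 * B / \<delta>) * (24 / \<delta>)" using real_arch_simple by blast
  have main: "\<exists>L c. structured p (length ks - 1) (last ks) n E L c (64 * p * (real M)\<^sup>2 * B\<^sup>2)"
    if n: "n \<ge> n0" and H: "graph_on n E" "SF_free p ks n (edge_set E)"
      "quad n E (\<lambda>_. 1) \<ge> (1 - 1 / p) * (real n)\<^sup>2 - K * n"
      "\<forall>i<n. 0 < z i \<and> z i \<le> K" "(\<Sum>i<n. (z i - 1)\<^sup>2) \<le> K"
      "\<forall>v<n. (\<Sum>u<n. of_bool (E v u) * z u) \<le> n * z v"
      "\<forall>G. graph_on n G \<and> SF_free p ks n (edge_set G) \<longrightarrow> quad n G z \<le> quad n E z" for n E z
  proof -
    obtain c where "stable_partition p n E K' c" using K' H(1-3) by blast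
    hence c: "stable_partition p n E B c" using stable_partition_mono B(2) by blast
    have "(T + 96 * B / \<delta>) * (24 / \<delta>) \<le> n" using n0 n by linarith
    hence "(T + 96 * B / \<delta>) * (24 / \<delta>) * (\<delta> / 24) \<le> n * (\<delta> / 24)" using \<delta> by (intro mult_right_mono) auto
    moreover have "x * (24 / \<delta>) * (\<delta> / 24) = x" for x using \<delta> by simp
    ultimately have 1: "T + 96 * B / \<delta> \<le> \<delta> / 24 * n" by (simp only: mult.commute[of "real n"])
    \<comment> \<open>The inequality of the means trades \<open>4 * sqrt (B * n)\<close> for
      \<open>\<delta> / 24 * n\<close> and the constant \<open>96 * B / \<delta>\<close>; the other
      half of \<open>\<delta> / 12 * n\<close> absorbs that constant together with T.\<close>
    have "sqrt (B * n) = sqrt ((\<delta> / 48 * n) * (48 * B / \<delta>))" using \<delta> by simp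
    also have "\<dots> \<le> (\<delta> / 48 * n + 48 * B / \<delta>) / 2" using \<delta> B by (intro arith_geo_mean_sqrt) auto
    finally have 2: "4 * sqrt (B * n) \<le> \<delta> / 24 * n + 96 * B / \<delta>" by simp
    interpret weighted_extremal p ks n E z c B \<delta> M
    proof
      show "B * B / \<delta> + 6 * p * B / \<delta> + real (M * p) + real M + 64 * p * (real M)\<^sup>2 * B\<^sup>2 + 1 + 4 * sqrt (B * n)
        \<le> \<delta> / 12 * n" using 1 2 unfolding T_def by linarith
      show "\<delta> = 1 / (4 * real p * real M)" by (simp add: \<delta>_def)
      show "M = length ks + (p + 2) * sum_list ks + card (SF_verts p ks) + p + 2" by (simp add: M_def)
      show "0 < z i \<and> z i \<le> B" if "i < n" for i using H(4) that B(1) by force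
      show "(\<Sum>i<n. (z i - 1)\<^sup>2) \<le> B" using H(5) B(1) by linarith
      show "quad n G z \<le> quad n E z" if "graph_on n G" "SF_free p ks n (edge_set G)" for G
        using H(7) that by blast
    qed (rule p ks H(1,2) B(3) c H(6)[rule_format] | assumption)+
    show ?thesis using is_structured by blast
  qed
  show ?thesis
    by (intro exI[of _ "64 * p * (real M)\<^sup>2 * B\<^sup>2"] exI[of _ n0] allI impI, elim conjE) (rule main; assumption)
qed

section \<open>Transplanting the bounded configuration\<close>

definition rest_class :: "nat \<Rightarrow> nat set \<Rightarrow> (nat \<Rightarrow> nat) \<Rightarrow> nat \<Rightarrow> nat set" where
  "rest_class n L c j = {v. v < n \<and> v \<notin> L \<and> c v = j}"

text \<open>The row of an ordinary vertex is determined by its class, so the eigenvalue equation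
  gives all ordinary vertices of a class the same weight.\<close>

definition ordinary :: "nat \<Rightarrow> (nat \<Rightarrow> nat \<Rightarrow> bool) \<Rightarrow> nat set \<Rightarrow> (nat \<Rightarrow> nat) \<Rightarrow> nat \<Rightarrow> bool" where
  "ordinary n E L c v \<longleftrightarrow> v < n \<and> v \<notin> L \<and> (\<forall>b<n. E v b \<longleftrightarrow> b \<in> L \<or> c b \<noteq> c v)"

definition special :: "nat \<Rightarrow> (nat \<Rightarrow> nat \<Rightarrow> bool) \<Rightarrow> nat set \<Rightarrow> (nat \<Rightarrow> nat) \<Rightarrow> nat set" where
  "special n E L c = {v. v < n \<and> v \<notin> L \<and> \<not> ordinary n E L c v}"

definition extra :: "(nat \<Rightarrow> nat \<Rightarrow> bool) \<Rightarrow> nat set \<Rightarrow> (nat \<Rightarrow> nat) \<Rightarrow> nat \<Rightarrow> nat \<Rightarrow> bool" where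
  "extra E L c a b \<longleftrightarrow> a \<notin> L \<and> b \<notin> L \<and> E a b \<and> c a = c b"

definition lacking :: "(nat \<Rightarrow> nat \<Rightarrow> bool) \<Rightarrow> nat set \<Rightarrow> (nat \<Rightarrow> nat) \<Rightarrow> nat \<Rightarrow> nat \<Rightarrow> bool" where
  "lacking E L c a b \<longleftrightarrow> a \<notin> L \<and> b \<notin> L \<and> c a \<noteq> c b \<and> \<not> E a b"

lemma finite_rest_class: "finite (rest_class n L c j)" unfolding rest_class_def by simp

lemma finite_special: "finite (special n E L c)" unfolding special_def by simp

lemma structuredD:
  assumes "structured p r k n E L c C"
  shows "graph_on n E" "L \<subseteq> {..<n}" "finite L" "card L = r" "\<And>v. c v < p"
    "\<And>u v. u \<in> L \<Longrightarrow> v < n \<Longrightarrow> u \<noteq> v \<Longrightarrow> E u v" "\<And>v. v \<notin> L \<Longrightarrow> \<not> has_fan p E k L v"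
    "quad n (extra E L c) (\<lambda>_. 1) \<le> C" "quad n (lacking E L c) (\<lambda>_. 1) \<le> C"
    "\<And>j. j < p \<Longrightarrow> \<bar>real (card {v. v < n \<and> c v = j}) - n / p\<bar> \<le> C * sqrt n" "C \<ge> 0"
proof -
  note S = assms[unfolded structured_def]
  show "graph_on n E" "L \<subseteq> {..<n}" "card L = r" "\<And>v. c v < p"
    "\<And>u v. u \<in> L \<Longrightarrow> v < n \<Longrightarrow> u \<noteq> v \<Longrightarrow> E u v" "\<And>v. v \<notin> L \<Longrightarrow> \<not> has_fan p E k L v"
    "\<And>j. j < p \<Longrightarrow> \<bar>real (card {v. v < n \<and> c v = j}) - n / p\<bar> \<le> C * sqrt n"
    using S by blast+
  thus "finite L" using finite_subset by blast
  show a: "quad n (extra E L c) (\<lambda>_. 1) \<le> C" and "quad n (lacking E L c) (\<lambda>_. 1) \<le> C"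
    using S by (simp_all add: quad_def extra_def lacking_def)
  have "0 \<le> quad n (extra E L c) (\<lambda>_. 1)" by (rule quad_nonneg) simp
  thus "C \<ge> 0" using a by linarith
qed

lemma structuredI:
  assumes "graph_on n E" "L \<subseteq> {..<n}" "card L = r" "\<And>v. c v < p"
    "\<And>u v. u \<in> L \<Longrightarrow> v < n \<Longrightarrow> u \<noteq> v \<Longrightarrow> E u v" "\<And>v. v \<notin> L \<Longrightarrow> \<not> has_fan p E k L v"
    "quad n (extra E L c) (\<lambda>_. 1) \<le> C" "quad n (lacking E L c) (\<lambda>_. 1) \<le> C"
    "\<And>j. j < p \<Longrightarrow> \<bar>real (card {v. v < n \<and> c v = j}) - n / p\<bar> \<le> C * sqrt n"
  shows "structured p r k n E L c C"
  using assms unfolding structured_def quad_def extra_def lacking_def by simp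

lemma special_pair:
  assumes S: "structured p r k n E L c C" and v: "v \<in> special n E L c"
  shows "\<exists>b<n. extra E L c v b \<or> lacking E L c v b"
proof -
  obtain b where b: "b < n" "E v b \<noteq> (b \<in> L \<or> c b \<noteq> c v)" and v': "v < n" "v \<notin> L"
    using v unfolding special_def ordinary_def by blast
  have "b \<notin> L" using b structuredD(6)[OF S, of b v] v' graph_on_sym[OF structuredD(1)[OF S], of b v] by auto
  thus ?thesis using b v' unfolding extra_def lacking_def by (intro exI[of _ b]) auto
qed

text \<open>Every special vertex is the first entry of an extra or a lacking ordered pair.\<close>

lemma special_card:
  assumes S: "structured p r k n E L c C"
  shows "real (card (special n E L c)) \<le> 2 * C"
proof -
  have "real (card (special n E L c)) = (\<Sum>v<n. of_bool (v \<in> special n E L c))"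
    using card_eq_sum_of_bool[of n "\<lambda>v. v \<in> special n E L c"]
    by (simp add: special_def conj_commute cong: conj_cong)
  also have "\<dots> \<le> (\<Sum>v<n. \<Sum>b<n. of_bool (extra E L c v b) + of_bool (lacking E L c v b))"
  proof (intro sum_mono)
    fix v
    show "of_bool (v \<in> special n E L c) \<le> (\<Sum>b<n. of_bool (extra E L c v b) + of_bool (lacking E L c v b) :: real)"
    proof (cases "v \<in> special n E L c")
      case True
      then obtain b where b: "b < n" "extra E L c v b \<or> lacking E L c v b" using special_pair[OF S] by blast
      have "1 \<le> of_bool (extra E L c v b) + (of_bool (lacking E L c v b) :: real)" using b(2) by auto
      also have "\<dots> \<le> (\<Sum>b<n. of_bool (extra E L c v b) + of_bool (lacking E L c v b) :: real)"
        using b(1) by (intro member_le_sum) auto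
      finally show ?thesis using True by simp
    qed (simp add: sum_nonneg)
  qed
  also have "\<dots> = quad n (extra E L c) (\<lambda>_. 1) + quad n (lacking E L c) (\<lambda>_. 1)"
    by (simp add: quad_def sum.distrib)
  finally show ?thesis using structuredD(8,9)[OF S] by linarith
qed

lemma rest_class_size:
  assumes S: "structured p r k n E L c C" and j: "j < p"
  shows "real (card (rest_class n L c j)) \<le> n / p + C * sqrt n"
    "real (card (rest_class n L c j)) \<ge> n / p - C * sqrt n - r"
proof -
  let ?V = "{v. v < n \<and> c v = j}"
  have sub: "rest_class n L c j = ?V - L" unfolding rest_class_def by auto
  have "card (?V - L) \<le> card ?V" by (intro card_mono) auto
  moreover have "real (card (?V - L)) \<ge> real (card ?V) - real (card L)"
    using diff_card_le_card_Diff[OF structuredD(3)[OF S], of ?V] by linarith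
  ultimately show "real (card (rest_class n L c j)) \<le> n / p + C * sqrt n"
    "real (card (rest_class n L c j)) \<ge> n / p - C * sqrt n - r"
    using structuredD(10)[OF S j] structuredD(4)[OF S] unfolding sub by linarith+
qed

text \<open>Of the n / p vertices of an average class, order sqrt n may be lost to imbalance, r to
  L, and 2 * C to special vertices.\<close>

lemma many_ordinary:
  assumes p: "p \<ge> 1" and S: "structured p r k n E L c C" and j: "j < p"
    and n: "sqrt n \<ge> p * (3 * C + r + N + 1)"
  shows "real (card (rest_class n L c j - special n E L c)) \<ge> N"
proof -
  have C: "C \<ge> 0" by (rule structuredD(11)[OF S])
  have p1: "real p \<ge> 1" using p by simp
  show ?thesis
  proof (cases "N \<ge> 0")
    case True
    have "1 * 1 \<le> p * (3 * C + r + N + 1)" using p1 C True by (intro mult_mono) auto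
    hence s1: "sqrt n \<ge> 1" using n by linarith
    have "sqrt n * (p * (3 * C + r + N + 1)) \<le> sqrt n * sqrt n" using n by (intro mult_left_mono) auto
    hence "(sqrt n * (3 * C + r + N + 1)) * p \<le> n" by (simp add: mult_ac)
    hence "sqrt n * (3 * C + r + N + 1) \<le> n / p" using p1 by (simp add: field_simps)
    moreover have "1 * (2 * C + r + N) \<le> sqrt n * (2 * C + r + N)"
      using s1 C True by (intro mult_right_mono) auto
    ultimately have "sqrt n + N * sqrt n + r * sqrt n + 3 * (C * sqrt n) \<le> n / p"
      "2 * C + r + N \<le> 2 * (C * sqrt n) + r * sqrt n + N * sqrt n" by (simp_all add: algebra_simps)
    hence "n / p - C * sqrt n - r - 2 * C \<ge> N" using s1 by linarith
    moreover have "real (card (rest_class n L c j - special n E L c)) \<ge>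
      real (card (rest_class n L c j)) - real (card (special n E L c))"
      using diff_card_le_card_Diff[OF finite_special[of n E L c], of "rest_class n L c j"] by linarith
    ultimately show ?thesis using rest_class_size(2)[OF S j] special_card[OF S] by linarith
  qed (metis linorder_linear of_nat_0_le_iff order_trans)
qed

text \<open>The row of v is everything except its class, up to pairs of total weight
  \<open>C * K\<close>. Sums of z over sets differ from cardinalities by at most
  \<open>sqrt (K * n)\<close>, so the eigenvalue equation determines \<open>lam n E * z v\<close> up
  to order sqrt n, and dividing by a spectral radius of at least n / 4 leaves a small error.\<close>

lemma perron_nearly_constant:
  fixes K C \<epsilon> :: real
  assumes p: "p \<ge> 2" and S: "structured p r k n E L c C" and P: "near_perron p n E K z"
    and \<epsilon>: "\<epsilon> > 0" and n: "sqrt n * \<epsilon> \<ge> 4 * (2 * sqrt K + C + r + 2 * (C * K) + K)" "n \<ge> 1"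
    and v: "v < n" "v \<notin> L"
  shows "\<bar>z v - 1\<bar> \<le> \<epsilon>"
proof -
  note P' = P[unfolded near_perron_def]
  have z: "\<And>i. i < n \<Longrightarrow> 0 \<le> z i \<and> z i \<le> K" and ev: "(\<Sum>j<n. of_bool (E v j) * z j) = lam n E * z v"
    and dev: "(\<Sum>i<n. (z i - 1)\<^sup>2) \<le> K" and lam: "\<bar>lam n E - (1 - 1 / p) * n\<bar> \<le> K" "n \<le> 4 * lam n E"
    using P' v by blast+
  have K: "K \<ge> 0" using z[OF v(1)] by linarith
  have C: "C \<ge> 0" by (rule structuredD(11)[OF S])
  note g = structuredD(1)[OF S]
  let ?R = "rest_class n L c (c v)"
  have R: "?R \<subseteq> {..<n}" unfolding rest_class_def by auto
  have row: "(\<Sum>b<n. of_bool (D v b) * z b) \<le> C * K" if D: "quad n D (\<lambda>_. 1) \<le> C" for D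
  proof -
    have "(\<Sum>b<n. of_bool (D v b) * z b) \<le> (\<Sum>b<n. of_bool (D v b) * K)"
      using z by (intro sum_mono mult_left_mono) auto
    also have "\<dots> = (\<Sum>b<n. of_bool (D v b)) * K" by (simp add: sum_distrib_right)
    also have "\<dots> \<le> C * K"
    proof (rule mult_right_mono[OF _ K])
      have "(\<Sum>b<n. of_bool (D v b)) \<le> (\<Sum>a<n. \<Sum>b<n. of_bool (D a b) :: real)"
        using v(1) by (intro double_sum_ge_term) auto
      thus "(\<Sum>b<n. of_bool (D v b)) \<le> C" using D by (simp add: quad_def)
    qed
    finally show ?thesis .
  qed
  have row0: "0 \<le> (\<Sum>b<n. of_bool (D v b) * z b)" for D :: "nat \<Rightarrow> nat \<Rightarrow> bool"
    using z by (intro sum_nonneg) auto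
  have "lam n E * z v = (\<Sum>b<n. of_bool (E v b) * z b)" by (simp add: ev)
  also have "\<dots> = (\<Sum>b<n. z b - of_bool (b \<notin> L \<and> c b = c v) * z b
      + of_bool (extra E L c v b) * z b - of_bool (lacking E L c v b) * z b)"
  proof (intro sum.cong refl)
    fix b assume b: "b \<in> {..<n}"
    have "b \<in> L \<Longrightarrow> E v b" using structuredD(6)[OF S, of b v] v graph_on_sym[OF g, of b v] by auto
    thus "of_bool (E v b) * z b = z b - of_bool (b \<notin> L \<and> c b = c v) * z b
      + of_bool (extra E L c v b) * z b - of_bool (lacking E L c v b) * z b"
      using v(2) by (auto simp: extra_def lacking_def)
  qed
  also have "\<dots> = sum z {..<n} - sum z ?R + (\<Sum>b<n. of_bool (extra E L c v b) * z b)
      - (\<Sum>b<n. of_bool (lacking E L c v b) * z b)"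
    unfolding rest_class_def by (simp add: sum.distrib sum_subtractf sum_over_filter)
  finally have "\<bar>lam n E * z v - (sum z {..<n} - sum z ?R)\<bar> \<le> C * K"
    using row[OF structuredD(8)[OF S]] row[OF structuredD(9)[OF S]] row0[of "extra E L c"] row0[of "lacking E L c"]
    by linarith
  moreover have "\<bar>sum z {..<n} - n\<bar> \<le> sqrt (K * n)" using deviation_bound[OF dev, of "{..<n}"] by simp
  moreover have "\<bar>sum z ?R - card ?R\<bar> \<le> sqrt (K * n)" by (rule deviation_bound[OF dev R])
  moreover have "\<bar>real (card ?R) - n / p\<bar> \<le> C * sqrt n + r"
    using rest_class_size[OF S structuredD(5)[OF S, of v]] by (simp add: abs_le_iff)
  moreover have "(1 - 1 / p) * real n = n - n / p" by (simp add: algebra_simps)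
  ultimately have 1: "\<bar>lam n E * z v - (1 - 1 / p) * n\<bar> \<le> C * K + 2 * sqrt (K * n) + C * sqrt n + r" by linarith
  have s1: "sqrt n \<ge> 1" using n(2) by simp
  have "lam n E * (z v - 1) = (lam n E * z v - (1 - 1 / p) * n) - (lam n E - (1 - 1 / p) * n)"
    by (simp add: algebra_simps)
  hence "\<bar>lam n E * (z v - 1)\<bar> \<le> C * K + 2 * sqrt (K * n) + C * sqrt n + r + K" using 1 lam(1) by linarith
  also have "\<dots> \<le> (2 * sqrt K + C + r + 2 * (C * K) + K) * sqrt n"
  proof -
    have "1 * (C * K + r + K) \<le> sqrt n * (C * K + r + K)" using s1 C K by (intro mult_right_mono) auto
    moreover have "0 \<le> C * K * sqrt n" using C K by simp
    ultimately show ?thesis by (simp add: algebra_simps real_sqrt_mult)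
  qed
  also have "\<dots> \<le> (sqrt n * \<epsilon> / 4) * sqrt n" using n(1) by (intro mult_right_mono) auto
  also have "\<dots> = n / 4 * \<epsilon>" by simp
  also have "\<dots> \<le> lam n E * \<epsilon>" using lam(2) \<epsilon> by (intro mult_right_mono) auto
  finally have "lam n E * \<bar>z v - 1\<bar> \<le> lam n E * \<epsilon>" using lam(2) n(2) by (simp add: abs_mult)
  moreover have "lam n E > 0" using lam(2) n(2) by simp
  ultimately show ?thesis by simp
qed

lemma ordinary_row:
  fixes z :: "nat \<Rightarrow> real"
  assumes v: "ordinary n E L c v"
  shows "(\<Sum>b<n. of_bool (E v b) * z b) = sum z {..<n} - sum z (rest_class n L c (c v))"
proof -
  have "(\<Sum>b<n. of_bool (E v b) * z b) = sum z {b. b < n \<and> E v b}" by (simp add: sum_over_filter)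
  also have "{b. b < n \<and> E v b} = {..<n} - rest_class n L c (c v)"
    using v unfolding ordinary_def rest_class_def by auto
  also have "sum z \<dots> = sum z {..<n} - sum z (rest_class n L c (c v))"
    by (intro sum_diff) (auto simp: rest_class_def)
  finally show ?thesis .
qed

text \<open>All ordinary vertices of a class have equal weight, so a class weighs its size times
  that weight, up to an error of \<open>4 * (C * \<epsilon>)\<close> from the special vertices. The
  eigenvalue equations give \<open>D = l * (z w - z u)\<close>. A difference d in size is thus
  shared between D and \<open>mj * (z w - z u)\<close>, and the latter is at most
  \<open>(1 + \<epsilon>) * D\<close> if it is nonnegative. The first alternative covers
  \<open>z w < z u\<close>.\<close>

lemma class_weight_gap:
  fixes \<epsilon> C :: real
  assumes S: "structured p r k n E L c C" and l0: "lam n E > 0"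
    and ev: "\<And>i. i < n \<Longrightarrow> (\<Sum>j<n. of_bool (E i j) * z j) = lam n E * z i"
    and near: "\<And>v. v < n \<Longrightarrow> v \<notin> L \<Longrightarrow> \<bar>z v - 1\<bar> \<le> \<epsilon>"
    and u: "ordinary n E L c u" and w: "ordinary n E L c w"
    and d: "card (rest_class n L c (c u)) \<ge> card (rest_class n L c (c w)) + d"
    and ratio: "real (card (rest_class n L c (c w))) \<le> (1 + \<epsilon>) * lam n E"
    and \<epsilon>: "0 \<le> \<epsilon>" "\<epsilon> \<le> 1"
  defines "D \<equiv> sum z (rest_class n L c (c u)) - sum z (rest_class n L c (c w))"
  shows "D \<ge> d * (1 - \<epsilon>) - 8 * (C * \<epsilon>) \<or> (2 + \<epsilon>) * D \<ge> d * (1 - \<epsilon>) - 8 * (C * \<epsilon>)"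
proof -
  let ?R = "rest_class n L c"
  let ?Sp = "special n E L c"
  define l where "l = lam n E"
  have uw: "u < n" "u \<notin> L" "w < n" "w \<notin> L" using u w by (auto simp: ordinary_def)
  have zu: "l * z u = sum z {..<n} - sum z (?R (c u))" if "ordinary n E L c u" for u
    using ev[of u] ordinary_row[OF that, of z] that unfolding l_def ordinary_def by simp
  have DD: "D = l * (z w - z u)" using zu[OF u] zu[OF w] unfolding D_def by (simp add: algebra_simps)
  have cls: "\<bar>sum z (?R (c x)) - card (?R (c x)) * z x\<bar> \<le> 2 * \<epsilon> * (2 * C)" if x: "ordinary n E L c x" for x
  proof -
    have x': "x < n" "x \<notin> L" using x by (auto simp: ordinary_def)
    have "sum z (?R (c x)) - card (?R (c x)) * z x = (\<Sum>v\<in>?R (c x). z v - z x)" by (simp add: sum_subtractf)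
    also have "\<bar>\<dots>\<bar> \<le> (\<Sum>v\<in>?R (c x). \<bar>z v - z x\<bar>)" by (rule sum_abs)
    also have "\<dots> \<le> (\<Sum>v\<in>?R (c x). if v \<in> ?Sp then 2 * \<epsilon> else 0)"
    proof (intro sum_mono)
      fix v assume v: "v \<in> ?R (c x)"
      show "\<bar>z v - z x\<bar> \<le> (if v \<in> ?Sp then 2 * \<epsilon> else 0)"
      proof (cases "v \<in> ?Sp")
        case True
        have "\<bar>z v - 1\<bar> \<le> \<epsilon>" "\<bar>z x - 1\<bar> \<le> \<epsilon>" using near x' v by (auto simp: rest_class_def)
        thus ?thesis using True by auto
      next
        case False
        hence o: "ordinary n E L c v" using v unfolding special_def rest_class_def by auto
        have "c v = c x" using v by (simp add: rest_class_def)
        hence "l * z v = l * z x" using zu[OF o] zu[OF x] by simp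
        thus ?thesis using False l0 by (simp add: l_def)
      qed
    qed
    also have "\<dots> = 2 * \<epsilon> * real (card (?R (c x) \<inter> ?Sp))"
      by (subst sum.inter_restrict[OF finite_rest_class, symmetric]) simp
    also have "\<dots> \<le> 2 * \<epsilon> * (2 * C)"
    proof (intro mult_left_mono)
      have "card (?R (c x) \<inter> ?Sp) \<le> card ?Sp" by (intro card_mono finite_special) auto
      thus "real (card (?R (c x) \<inter> ?Sp)) \<le> 2 * C" using special_card[OF S] by linarith
    qed (use \<epsilon> in auto)
    finally show ?thesis .
  qed
  define mi where "mi = real (card (?R (c u)))"
  define mj where "mj = real (card (?R (c w)))"
  have m: "mi \<ge> mj + d" using d unfolding mi_def mj_def by (simp flip: of_nat_add)
  have zz: "z u \<ge> 1 - \<epsilon>" using near[OF uw(1,2)] by linarith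
  have "D \<ge> mi * z u - mj * z w - 8 * (C * \<epsilon>)"
    using cls[OF u] cls[OF w] unfolding D_def mi_def mj_def by (simp add: abs_le_iff algebra_simps)
  moreover have "mi * z u - mj * z w = (mi - mj) * z u - mj * (z w - z u)" by (simp add: algebra_simps)
  moreover have "(mi - mj) * z u \<ge> d * (1 - \<epsilon>)" using m zz \<epsilon> by (intro mult_mono) auto
  ultimately have main: "D + mj * (z w - z u) \<ge> d * (1 - \<epsilon>) - 8 * (C * \<epsilon>)" by linarith
  show ?thesis
  proof (cases "z w - z u \<ge> 0")
    case True
    have "mj * (z w - z u) \<le> ((1 + \<epsilon>) * l) * (z w - z u)"
      using ratio True unfolding mj_def l_def by (intro mult_right_mono) auto
    also have "\<dots> = (1 + \<epsilon>) * D" by (simp add: DD)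
    finally show ?thesis using main by (simp add: algebra_simps)
  next
    case False
    hence "mj * (z w - z u) \<le> 0" unfolding mj_def by (intro mult_nonneg_nonpos) auto
    thus ?thesis using main by linarith
  qed
qed

section \<open>Carrying a bounded configuration from one graph to another\<close>

lemma colour_injection:
  fixes d :: "'b \<Rightarrow> nat" and col :: "'a \<Rightarrow> nat"
  assumes "finite A" "\<And>x. x \<in> A \<Longrightarrow> col x < p" and B: "\<And>j. j < p \<Longrightarrow> card {b \<in> B. d b = j} \<ge> N"
    and "card A \<le> N"
  shows "\<exists>\<phi>. inj_on \<phi> A \<and> \<phi> ` A \<subseteq> B \<and> (\<forall>x\<in>A. d (\<phi> x) = col x)"
  using assms(1,2,4)
proof (induction A)
  case empty thus ?case by auto
next
  case (insert x A)
  then obtain \<phi> where \<phi>: "inj_on \<phi> A" "\<phi> ` A \<subseteq> B" "\<forall>x\<in>A. d (\<phi> x) = col x" by auto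
  have "card (\<phi> ` A) \<le> card A" using insert.hyps by (intro card_image_le)
  also have "card A < N" using insert.prems(2) insert.hyps by simp
  also have "N \<le> card {b \<in> B. d b = col x}" using insert.prems(1) by (intro B) auto
  finally have "\<not> {b \<in> B. d b = col x} \<subseteq> \<phi> ` A"
    using card_mono[of "\<phi> ` A" "{b \<in> B. d b = col x}"] insert.hyps by auto
  then obtain b where b: "b \<in> B" "d b = col x" "b \<notin> \<phi> ` A" by blast
  have "inj_on (\<phi>(x := b)) (insert x A)" using \<phi>(1) b(3) insert.hyps by (auto simp: inj_on_def)
  moreover have "(\<phi>(x := b)) ` insert x A \<subseteq> B" using \<phi>(2) b insert.hyps by auto
  moreover have "\<forall>y\<in>insert x A. d ((\<phi>(x := b)) y) = col y" using \<phi>(3) b by auto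
  ultimately show ?case by blast
qed

lemma has_fan_transport:
  assumes X: "fan p E k L v X" and inj: "inj_on \<psi> (star_support k v X)"
    and out: "\<psi> ` star_support k v X \<inter> L2 = {}"
    and e: "\<And>x y. x \<in> star_support k v X \<Longrightarrow> y \<in> star_support k v X \<Longrightarrow> E x y \<Longrightarrow> E2 (\<psi> x) (\<psi> y)"
  shows "has_fan p E2 k L2 (\<psi> v)"
proof -
  have sub: "insert v (X a) \<subseteq> star_support k v X" if "a < k" for a
    using that unfolding star_support_def by auto
  have "fan p E2 k L2 (\<psi> v) (\<lambda>a. \<psi> ` X a)"
    unfolding fan_def
  proof (intro conjI allI impI)
    fix a assume a: "a < k"
    note F = fanD[OF X a]
    have i: "inj_on \<psi> (insert v (X a))" using inj sub[OF a] by (rule inj_on_subset)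
    show "finite (\<psi> ` X a)" using F(1) by simp
    show "card (\<psi> ` X a) = p" using F(2) card_image[of \<psi> "X a"] i by (auto intro: inj_on_subset)
    show "\<psi> v \<notin> \<psi> ` X a" using i F(3) by (auto simp: inj_on_def)
    show "\<psi> ` X a \<inter> L2 = {}" using out sub[OF a] by blast
    show "clique E2 (insert (\<psi> v) (\<psi> ` X a))"
      unfolding clique_def
    proof (intro ballI impI)
      fix x y assume "x \<in> insert (\<psi> v) (\<psi> ` X a)" "y \<in> insert (\<psi> v) (\<psi> ` X a)" and ne: "x \<noteq> y"
      then obtain s t where st: "s \<in> insert v (X a)" "t \<in> insert v (X a)" "x = \<psi> s" "y = \<psi> t" by blast
      hence "E s t" using cliqueD[OF F(5)] ne by auto
      moreover have "s \<in> star_support k v X" "t \<in> star_support k v X" using st sub[OF a] by auto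
      ultimately show "E2 x y" using e st by auto
    qed
  next
    fix a b assume ab: "a < k" "b < k" "a \<noteq> b"
    have "X a \<subseteq> star_support k v X" "X b \<subseteq> star_support k v X" using sub ab by auto
    hence "\<psi> ` X a \<inter> \<psi> ` X b = \<psi> ` (X a \<inter> X b)" using inj_on_image_Int[OF inj] by simp
    thus "\<psi> ` X a \<inter> \<psi> ` X b = {}" using fanD(6)[OF X ab(1,2,3)] by simp
  qed
  thus ?thesis unfolding has_fan_def by blast
qed

lemma star_support_card:
  assumes X: "fan p E k L v X"
  shows "finite (star_support k v X)" "card (star_support k v X) \<le> 1 + p * k"
proof -
  have f: "finite (\<Union>a<k. X a)" using fanD(1)[OF X] by auto
  thus "finite (star_support k v X)" unfolding star_support_def by simp
  have "card (\<Union>a<k. X a) \<le> (\<Sum>a<k. card (X a))" by (rule card_UN_le) simp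
  also have "\<dots> = p * k" using fanD(2)[OF X] by simp
  finally show "card (star_support k v X) \<le> 1 + p * k"
    using f unfolding star_support_def by (simp add: card_insert_if)
qed

lemma star_support_in:
  assumes X: "fan p E k L v X" and "k \<ge> 1" "p \<ge> 1" and g: "graph_on n E" and v: "v \<notin> L"
  shows "star_support k v X \<subseteq> {..<n} - L"
proof -
  have adj: "E v x" if "a < k" "x \<in> X a" for a x
    using cliqueD[OF fanD(5)[OF X that(1)], of v x] fanD(3)[OF X that(1)] that(2) by auto
  have "X 0 \<noteq> {}" using fanD(2)[OF X, of 0] assms(2,3) by auto
  then obtain y where "y \<in> X 0" by blast
  hence "E v y" using adj[of 0 y] assms(2) by simp
  hence "v < n" by (rule graph_onD(2)[OF g])
  moreover have "x < n \<and> x \<notin> L" if "a < k" "x \<in> X a" for a x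
    using graph_onD(3)[OF g adj[OF that]] fanD(4)[OF X that(1)] that(2) by blast
  ultimately show ?thesis using v unfolding star_support_def by auto
qed

text \<open>S is meant to carry all deviations of E from the multipartite pattern; they are read
  through the inverse of \<phi>, while L is joined to everything and the remaining pairs follow c.
  With \<phi> the identity this also describes recolouring an ordinary vertex.\<close>

definition transplant :: "nat \<Rightarrow> (nat \<Rightarrow> nat \<Rightarrow> bool) \<Rightarrow> nat set \<Rightarrow> (nat \<Rightarrow> nat) \<Rightarrow> nat set \<Rightarrow> (nat \<Rightarrow> nat) \<Rightarrow> nat \<Rightarrow> nat \<Rightarrow> bool" where
  "transplant n E S \<phi> L c a b \<longleftrightarrow> a \<noteq> b \<and> a < n \<and> b < n \<and> (a \<in> L \<or> b \<in> L \<or>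
    (if a \<in> \<phi> ` S \<and> b \<in> \<phi> ` S then E (inv_into S \<phi> a) (inv_into S \<phi> b) else c a \<noteq> c b))"

lemma quad_supported:
  assumes "S \<subseteq> {..<n}" "\<And>a b. a < n \<Longrightarrow> b < n \<Longrightarrow> D a b \<Longrightarrow> a \<in> S \<and> b \<in> S"
  shows "quad n D (\<lambda>_. 1) = (\<Sum>a\<in>S. \<Sum>b\<in>S. of_bool (D a b))"
proof -
  have "quad n D (\<lambda>_. 1) = (\<Sum>a<n. \<Sum>b<n. of_bool (D a b))" by (simp add: quad_def)
  also have "\<dots> = (\<Sum>a\<in>S. \<Sum>b<n. of_bool (D a b))"
    using assms by (intro sum.mono_neutral_right) (auto intro!: sum.neutral)
  also have "\<dots> = (\<Sum>a\<in>S. \<Sum>b\<in>S. of_bool (D a b))"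
    using assms by (intro sum.cong refl sum.mono_neutral_right) auto
  finally show ?thesis .
qed

text \<open>The pairs on which a structured graph differs from a join of \<open>L\<close> with a complete
  multipartite graph form a bounded configuration, which can be copied onto any other large classes.\<close>

lemma transplant_structured:
  fixes C C' :: real
  assumes S: "structured p r k n E2 L2 c2 C" and kp: "k \<ge> 1" "p \<ge> 1"
    and L: "L \<subseteq> {..<n}" "card L = r" and c: "\<And>v. c v < p"
    and \<phi>: "inj_on \<phi> (special n E2 L2 c2)" "\<phi> ` special n E2 L2 c2 \<subseteq> {..<n} - L"
      "\<And>v. v \<in> special n E2 L2 c2 \<Longrightarrow> c (\<phi> v) = c2 v"
    and room: "\<And>j. j < p \<Longrightarrow> card (rest_class n L2 c2 j - special n E2 L2 c2) \<ge> 1 + p * k"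
    and sz: "\<And>j. j < p \<Longrightarrow> \<bar>real (card {v. v < n \<and> c v = j}) - n / p\<bar> \<le> C' * sqrt n" and CC: "C \<le> C'"
  defines "E' \<equiv> transplant n E2 (special n E2 L2 c2) \<phi> L c"
  shows "structured p r k n E' L c C'"
    and "quad n (extra E' L c) (\<lambda>_. 1) = quad n (extra E2 L2 c2) (\<lambda>_. 1)"
    and "quad n (lacking E' L c) (\<lambda>_. 1) = quad n (lacking E2 L2 c2) (\<lambda>_. 1)"
proof -
  define Sp where "Sp = special n E2 L2 c2"
  note \<phi>' = \<phi>[folded Sp_def]
  have E': "E' a b \<longleftrightarrow> a \<noteq> b \<and> a < n \<and> b < n \<and> (a \<in> L \<or> b \<in> L \<or>
    (if a \<in> \<phi> ` Sp \<and> b \<in> \<phi> ` Sp then E2 (inv_into Sp \<phi> a) (inv_into Sp \<phi> b) else c a \<noteq> c b))" for a b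
    unfolding E'_def transplant_def Sp_def ..
  have g2: "graph_on n E2" by (rule structuredD(1)[OF S])
  have inv: "inv_into Sp \<phi> (\<phi> x) = x" if "x \<in> Sp" for x using that \<phi>'(1) by (rule inv_into_f_f[rotated])
  have SpV: "Sp \<subseteq> {..<n} - L2" by (auto simp: Sp_def special_def)
  have g: "graph_on n E'"
    unfolding graph_on_def E' using graph_on_sym[OF g2] by auto
  have nf: "\<not> has_fan p E' k L v" if v: "v \<notin> L" for v
  proof
    assume "has_fan p E' k L v"
    then obtain X where X: "fan p E' k L v X" unfolding has_fan_def by blast
    define U where "U = star_support k v X"
    have U: "finite U" "card U \<le> 1 + p * k" "U \<subseteq> {..<n} - L"
      using star_support_card[OF X] star_support_in[OF X kp g v] unfolding U_def by auto
    \<comment> \<open>A fan of the new graph is pulled back: copied vertices return to their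
      originals, and all others go to distinct ordinary vertices of the same colour, which are
      adjacent to everything outside their class. The result is a fan of E2 off L2.\<close>
    have "\<exists>\<psi>. inj_on \<psi> (U - \<phi> ` Sp) \<and> \<psi> ` (U - \<phi> ` Sp) \<subseteq> {v. v < n \<and> v \<notin> L2 \<and> v \<notin> Sp} \<and>
      (\<forall>x\<in>U - \<phi> ` Sp. c2 (\<psi> x) = c x)"
    proof (rule colour_injection[where p = p and N = "1 + p * k"])
      fix j assume j: "j < p"
      have "{b \<in> {v. v < n \<and> v \<notin> L2 \<and> v \<notin> Sp}. c2 b = j} = rest_class n L2 c2 j - special n E2 L2 c2"
        by (auto simp: rest_class_def Sp_def)
      thus "1 + p * k \<le> card {b \<in> {v. v < n \<and> v \<notin> L2 \<and> v \<notin> Sp}. c2 b = j}" using room[OF j] by simp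
    next
      have "card (U - \<phi> ` Sp) \<le> card U" using U(1) by (intro card_mono) auto
      thus "card (U - \<phi> ` Sp) \<le> 1 + p * k" using U(2) by linarith
    qed (use U c in auto)
    then obtain \<psi>0 where \<psi>0: "inj_on \<psi>0 (U - \<phi> ` Sp)" "\<psi>0 ` (U - \<phi> ` Sp) \<subseteq> {v. v < n \<and> v \<notin> L2 \<and> v \<notin> Sp}"
      "\<forall>x\<in>U - \<phi> ` Sp. c2 (\<psi>0 x) = c x" by (elim exE conjE)
    define \<psi> where "\<psi> x = (if x \<in> \<phi> ` Sp then inv_into Sp \<phi> x else \<psi>0 x)" for x
    have \<psi>1: "\<psi> x \<in> Sp" "c2 (\<psi> x) = c x" if "x \<in> \<phi> ` Sp" for x
      using that \<phi>'(3) inv unfolding \<psi>_def by auto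
    have \<psi>2: "\<psi> x < n" "\<psi> x \<notin> L2" "\<psi> x \<notin> Sp" "c2 (\<psi> x) = c x" if "x \<in> U" "x \<notin> \<phi> ` Sp" for x
      using that \<psi>0(2,3) unfolding \<psi>_def by auto
    have ord2: "E2 (\<psi> x) b \<longleftrightarrow> b \<in> L2 \<or> c2 b \<noteq> c2 (\<psi> x)" if "x \<in> U" "x \<notin> \<phi> ` Sp" "b < n" for x b
      using \<psi>2[OF that(1,2)] that(3) unfolding Sp_def special_def ordinary_def by auto
    have inj: "inj_on \<psi> U"
    proof (rule inj_onI)
      fix x y assume xy: "x \<in> U" "y \<in> U" "\<psi> x = \<psi> y"
      consider "x \<in> \<phi> ` Sp" "y \<in> \<phi> ` Sp" | "x \<notin> \<phi> ` Sp" "y \<notin> \<phi> ` Sp"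
        using \<psi>1 \<psi>2 xy by metis
      thus "x = y"
      proof cases
        case 1 thus ?thesis using xy(3) inv unfolding \<psi>_def by auto
      next
        case 2 thus ?thesis using xy \<psi>0(1) unfolding \<psi>_def inj_on_def by auto
      qed
    qed
    have "has_fan p E2 k L2 (\<psi> v)"
    proof (rule has_fan_transport[OF X])
      show "inj_on \<psi> (star_support k v X)" using inj by (simp add: U_def)
      show "\<psi> ` star_support k v X \<inter> L2 = {}"
        unfolding U_def[symmetric] using \<psi>1(1) \<psi>2(2) SpV by blast
    next
      fix x y assume xy: "x \<in> star_support k v X" "y \<in> star_support k v X" "E' x y"
      hence xyU: "x \<in> U" "y \<in> U" by (auto simp: U_def)
      hence nL: "x \<notin> L" "y \<notin> L" using U(3) by auto
      show "E2 (\<psi> x) (\<psi> y)"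
      proof (cases "x \<in> \<phi> ` Sp \<and> y \<in> \<phi> ` Sp")
        case True thus ?thesis using xy(3) nL unfolding E' \<psi>_def by auto
      next
        case False
        hence cc: "c x \<noteq> c y" using xy(3) nL unfolding E' by auto
        have cs: "c2 (\<psi> x) = c x" "c2 (\<psi> y) = c y" using \<psi>1(2) \<psi>2(4) xyU by blast+
        have ns: "\<psi> x < n" "\<psi> y < n" using \<psi>1(1) \<psi>2(1) xyU SpV by blast+
        show ?thesis
        proof (cases "x \<in> \<phi> ` Sp")
          case True
          hence "y \<notin> \<phi> ` Sp" using False by blast
          hence "E2 (\<psi> y) (\<psi> x)" using ord2[OF xyU(2) _ ns(1)] cs cc by auto
          thus ?thesis using graph_onD(1)[OF g2] by blast
        next
          case False
          thus ?thesis using ord2[OF xyU(1) _ ns(2)] cs cc by auto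
        qed
      qed
    qed
    moreover have "\<psi> v \<notin> L2"
    proof -
      have "v \<in> U" by (simp add: U_def star_support_def)
      thus ?thesis using \<psi>1(1)[of v] \<psi>2(2)[of v] SpV by blast
    qed
    ultimately show False using structuredD(7)[OF S] by blast
  qed
  have D2: "a \<in> Sp \<and> b \<in> Sp" if "extra E2 L2 c2 a b \<or> lacking E2 L2 c2 a b" "a < n" "b < n" for a b
  proof -
    have "a \<notin> L2" "b \<notin> L2" using that(1) by (auto simp: extra_def lacking_def)
    moreover have "\<not> (E2 a b \<longleftrightarrow> b \<in> L2 \<or> c2 b \<noteq> c2 a)" "\<not> (E2 b a \<longleftrightarrow> a \<in> L2 \<or> c2 a \<noteq> c2 b)"
      using that(1) graph_on_sym[OF g2, of a b] unfolding extra_def lacking_def by auto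
    ultimately show ?thesis using that(2,3) unfolding Sp_def special_def ordinary_def by blast
  qed
  have D': "a \<in> \<phi> ` Sp \<and> b \<in> \<phi> ` Sp" if "extra E' L c a b \<or> lacking E' L c a b" "a < n" "b < n" for a b
    using that unfolding extra_def lacking_def E' by (auto split: if_splits)
  have ex: "extra E' L c (\<phi> a) (\<phi> b) = extra E2 L2 c2 a b" "lacking E' L c (\<phi> a) (\<phi> b) = lacking E2 L2 c2 a b"
    if ab: "a \<in> Sp" "b \<in> Sp" for a b
  proof -
    have nL: "\<phi> a \<notin> L" "\<phi> b \<notin> L" "\<phi> a < n" "\<phi> b < n" using ab \<phi>'(2) by auto
    have nL2: "a \<notin> L2" "b \<notin> L2" using ab SpV by auto
    have cc: "c (\<phi> a) = c2 a" "c (\<phi> b) = c2 b" using \<phi>'(3) ab by auto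
    have "E' (\<phi> a) (\<phi> b) = (a \<noteq> b \<and> E2 a b)"
    proof -
      have "\<phi> a = \<phi> b \<longleftrightarrow> a = b" using \<phi>'(1) ab by (auto simp: inj_on_def)
      thus ?thesis unfolding E' using nL ab inv by auto
    qed
    also have "\<dots> = E2 a b" using graph_onD(4)[OF g2] by blast
    finally have ee: "E' (\<phi> a) (\<phi> b) = E2 a b" .
    show "extra E' L c (\<phi> a) (\<phi> b) = extra E2 L2 c2 a b" "lacking E' L c (\<phi> a) (\<phi> b) = lacking E2 L2 c2 a b"
      unfolding extra_def lacking_def ee cc using nL nL2 by auto
  qed
  have re: "quad n D' (\<lambda>_. 1) = quad n D (\<lambda>_. 1)"
    if 1: "\<And>a b. a < n \<Longrightarrow> b < n \<Longrightarrow> D' a b \<Longrightarrow> a \<in> \<phi> ` Sp \<and> b \<in> \<phi> ` Sp"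
      and 2: "\<And>a b. a < n \<Longrightarrow> b < n \<Longrightarrow> D a b \<Longrightarrow> a \<in> Sp \<and> b \<in> Sp"
      and 3: "\<And>a b. a \<in> Sp \<Longrightarrow> b \<in> Sp \<Longrightarrow> D' (\<phi> a) (\<phi> b) = D a b" for D D'
  proof -
    have "quad n D' (\<lambda>_. 1) = (\<Sum>a\<in>\<phi> ` Sp. \<Sum>b\<in>\<phi> ` Sp. of_bool (D' a b))"
      by (rule quad_supported) (use \<phi>'(2) 1 in auto)
    also have "\<dots> = (\<Sum>a\<in>Sp. \<Sum>b\<in>Sp. of_bool (D' (\<phi> a) (\<phi> b)))"
      by (simp add: sum.reindex[OF \<phi>'(1)])
    also have "\<dots> = (\<Sum>a\<in>Sp. \<Sum>b\<in>Sp. of_bool (D a b))" using 3 by (intro sum.cong refl) simp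
    also have "\<dots> = quad n D (\<lambda>_. 1)" by (rule quad_supported[symmetric]) (use SpV 2 in auto)
    finally show ?thesis .
  qed
  show e1: "quad n (extra E' L c) (\<lambda>_. 1) = quad n (extra E2 L2 c2) (\<lambda>_. 1)"
    by (rule re) (use D2 D' ex in blast)+
  show e2: "quad n (lacking E' L c) (\<lambda>_. 1) = quad n (lacking E2 L2 c2) (\<lambda>_. 1)"
    by (rule re) (use D2 D' ex in blast)+
  show "structured p r k n E' L c C'"
  proof (rule structuredI[OF g L c _ nf])
    show "E' u v" if "u \<in> L" "v < n" "u \<noteq> v" for u v using that L(1) unfolding E' by auto
    show "quad n (extra E' L c) (\<lambda>_. 1) \<le> C'" using e1 structuredD(8)[OF S] CC by linarith
    show "quad n (lacking E' L c) (\<lambda>_. 1) \<le> C'" using e2 structuredD(9)[OF S] CC by linarith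
  qed (use sz in auto)
qed

lemma structured_free:
  assumes S: "structured p r k n E L c C" and "length ks = r + 1" "1 \<le> k" "\<forall>k'\<in>set ks. k \<le> k'"
  shows "SF_free p ks n (edge_set E)"
  by (rule SF_free_by_pigeonhole[OF structuredD(1)[OF S] assms(3,4) structuredD(3)[OF S] _ structuredD(7)[OF S]])
    (use assms(2) structuredD(4)[OF S] in auto)

text \<open>Both graphs share L and c, so they agree on pairs meeting L and deviate from one common
  pattern elsewhere.\<close>

lemma quad_difference:
  assumes S: "structured p r k n E L c C" and S': "structured p r k n E' L c C'"
  shows "quad n E' w - quad n E w = quad n (extra E' L c) w - quad n (lacking E' L c) w
    - quad n (extra E L c) w + quad n (lacking E L c) w"
proof -
  have "of_bool (E' a b) * w a * w b + of_bool (lacking E' L c a b) * w a * w b + of_bool (extra E L c a b) * w a * w b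
    = of_bool (E a b) * w a * w b + of_bool (extra E' L c a b) * w a * w b + of_bool (lacking E L c a b) * w a * w b"
    if ab: "a < n" "b < n" for a b
  proof (cases "a \<in> L \<or> b \<in> L")
    case True
    have "E x y \<longleftrightarrow> x \<noteq> y" if S: "structured p r k n E L c C" and "x < n" "y < n" "x \<in> L \<or> y \<in> L" for E C x y
      using that structuredD(6)[OF S, of x y] structuredD(6)[OF S, of y x] graph_onD[OF structuredD(1)[OF S]] by blast
    from this[OF S ab True] this[OF S' ab True] True show ?thesis by (auto simp: extra_def lacking_def)
  next
    case False thus ?thesis by (auto simp: extra_def lacking_def)
  qed
  hence "quad n E' w + quad n (lacking E' L c) w + quad n (extra E L c) w
    = quad n E w + quad n (extra E' L c) w + quad n (lacking E L c) w"
    unfolding quad_def sum.distrib[symmetric] by (intro sum.cong refl) auto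
  thus ?thesis by linarith
qed

lemma quad_near_one:
  fixes \<epsilon> :: real
  assumes near: "\<And>v. v < n \<Longrightarrow> v \<notin> L \<Longrightarrow> \<bar>z v - 1\<bar> \<le> \<epsilon>" and \<epsilon>: "0 \<le> \<epsilon>" "\<epsilon> \<le> 1"
    and D: "\<And>a b. D a b \<Longrightarrow> a \<notin> L \<and> b \<notin> L"
  shows "\<bar>quad n D z - quad n D (\<lambda>_. 1)\<bar> \<le> 3 * \<epsilon> * quad n D (\<lambda>_. 1)"
proof -
  have pt: "\<bar>of_bool (D a b) * z a * z b - of_bool (D a b) * 1 * 1\<bar> \<le> 3 * \<epsilon> * (of_bool (D a b) * 1 * 1)"
    if ab: "a < n" "b < n" for a b
  proof (cases "D a b")
    case True
    have 1: "\<bar>z a - 1\<bar> \<le> \<epsilon>" "\<bar>z b - 1\<bar> \<le> \<epsilon>" using near D[OF True] ab by auto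
    have "z a * z b - 1 = (z a - 1) * (z b - 1) + (z a - 1) + (z b - 1)" by (simp add: algebra_simps)
    moreover have "\<bar>(z a - 1) * (z b - 1)\<bar> \<le> \<epsilon> * 1" unfolding abs_mult using 1 \<epsilon> by (intro mult_mono) auto
    ultimately have "\<bar>z a * z b - 1\<bar> \<le> 3 * \<epsilon>" using 1 by linarith
    thus ?thesis using True by simp
  qed simp
  have "quad n D z - quad n D (\<lambda>_. 1) = (\<Sum>a<n. \<Sum>b<n. of_bool (D a b) * z a * z b - of_bool (D a b) * 1 * 1)"
    unfolding quad_def by (simp add: sum_subtractf)
  also have "\<bar>\<dots>\<bar> \<le> (\<Sum>a<n. \<Sum>b<n. \<bar>of_bool (D a b) * z a * z b - of_bool (D a b) * 1 * 1\<bar>)"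
    by (intro order_trans[OF sum_abs] sum_mono) auto
  also have "\<dots> \<le> (\<Sum>a<n. \<Sum>b<n. 3 * \<epsilon> * (of_bool (D a b) * 1 * 1))" using pt by (intro sum_mono) auto
  also have "\<dots> = 3 * \<epsilon> * quad n D (\<lambda>_. 1)" unfolding quad_def sum_distrib_left ..
  finally show ?thesis .
qed

section \<open>Comparison of spectral and edge extremal graphs\<close>

lemma residue_class_card: "p \<ge> 1 \<Longrightarrow> card {v. v < n \<and> v mod p = j} \<le> n div p + (1::nat)"
proof -
  assume p: "p \<ge> 1"
  have "inj_on (\<lambda>v. v div p) {v. v < n \<and> v mod p = j}"
    by (rule inj_onI) (metis (mono_tags, lifting) div_mult_mod_eq mem_Collect_eq)
  moreover have "(\<lambda>v. v div p) ` {v. v < n \<and> v mod p = j} \<subseteq> {..n div p}"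
    by (auto intro: div_le_mono less_imp_le)
  ultimately have "card {v. v < n \<and> v mod p = j} \<le> card {..n div p}" by (intro card_inj_on_le) auto
  thus ?thesis by simp
qed

lemma exists_dense_free_graph:
  assumes p: "p \<ge> 1" and ks: "\<forall>k\<in>set ks. 1 \<le> k" "ks \<noteq> []"
  shows "\<exists>E. graph_on n E \<and> SF_free p ks n (edge_set E) \<and> quad n E (\<lambda>_. 1) \<ge> (1 - 1 / p) * (real n)\<^sup>2 - n"
proof -
  \<comment> \<open>The colours are residues modulo p; the empty sets make the relation an instance
    of \<open>multipartite_join_free\<close> with L empty.\<close>
  define E where "E a b \<longleftrightarrow> a \<noteq> b \<and> a < n \<and> b < n \<and> (a \<in> {} \<or> b \<in> {} \<or> a mod p \<noteq> b mod p)" for a b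
  have g: "graph_on n E" unfolding graph_on_def E_def by auto
  have f: "SF_free p ks n (edge_set E)"
    unfolding E_def by (rule multipartite_join_free[OF p ks(1)]) (use p ks in auto)
  have "(1 - 1 / p) * (real n)\<^sup>2 - n = (\<Sum>a<n. n - (n / p + 1))"
    by (simp add: power2_eq_square algebra_simps)
  also have "\<dots> \<le> (\<Sum>a<n. \<Sum>b<n. of_bool (E a b) * 1 * 1)"
  proof (intro sum_mono)
    fix a assume a: "a \<in> {..<n}"
    have "(\<Sum>b<n. of_bool (E a b) * 1 * 1) = (\<Sum>b<n. 1 - of_bool (b mod p = a mod p) :: real)"
      using a by (intro sum.cong) (auto simp: E_def)
    also have "\<dots> = n - real (card {b. b < n \<and> b mod p = a mod p})"
      by (simp add: sum_subtractf card_eq_sum_of_bool)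
    finally have e: "(\<Sum>b<n. of_bool (E a b) * 1 * 1) = n - real (card {b. b < n \<and> b mod p = a mod p})" .
    have "real (card {b. b < n \<and> b mod p = a mod p}) \<le> real (n div p + 1)"
      using residue_class_card[OF p, of n "a mod p"] by (simp only: of_nat_le_iff)
    also have "\<dots> \<le> n / p + 1" using of_nat_div_le_of_nat[of n p, where 'a = real] by simp
    finally show "real n - (n / p + 1) \<le> (\<Sum>b<n. of_bool (E a b) * 1 * 1)" unfolding e by linarith
  qed
  finally have "quad n E (\<lambda>_. 1) \<ge> (1 - 1 / p) * (real n)\<^sup>2 - n" unfolding quad_def .
  thus ?thesis using g f by blast
qed

text \<open>A vertex of weight zero has only neighbours of weight zero, so joining it to a vertex of
  positive weight adds a bridge. Every edge of the forbidden graph lies in a triangle, hence the new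
  graph is still free, but the vector is no longer an eigenvector.\<close>

lemma perron_vector_positive:
  assumes p: "p \<ge> 2" and ks: "\<forall>k\<in>set ks. 1 \<le> k" and n: "n \<ge> 1"
    and g: "graph_on n E" and free: "SF_free p ks n (edge_set E)"
    and max: "\<And>G. graph_on n G \<Longrightarrow> SF_free p ks n (edge_set G) \<Longrightarrow> lam n G \<le> lam n E"
    and z: "\<And>i. i < n \<Longrightarrow> 0 \<le> z i" "(\<Sum>i<n. (z i)\<^sup>2) = n" "quad n E z = lam n E * n"
    and ev: "\<And>i. i < n \<Longrightarrow> (\<Sum>j<n. of_bool (E i j) * z j) = lam n E * z i"
    and a: "a < n"
  shows "0 < z a"
proof (rule ccontr)
  assume "\<not> 0 < z a"
  hence za: "z a = 0" using z(1)[OF a] by simp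
  have "\<exists>b<n. z b \<noteq> 0"
  proof (rule ccontr)
    assume "\<not> ?thesis"
    hence "(\<Sum>i<n. (z i)\<^sup>2) = 0" by simp
    thus False using z(2) n by simp
  qed
  then obtain b where b: "b < n" "z b > 0" using z(1) by (metis less_eq_real_def)
  have nb: "z y = 0" if "E x y" "z x = 0" for x y
  proof -
    have xy: "x < n" "y < n" using graph_onD[OF g that(1)] by auto
    have "(\<Sum>j<n. of_bool (E x j) * z j) = 0" using ev[OF xy(1)] that(2) by simp
    hence "of_bool (E x y) * z y = 0" using z(1) xy by (subst (asm) sum_nonneg_eq_0_iff) auto
    thus ?thesis using that(1) by simp
  qed
  define E' where "E' x y \<longleftrightarrow> E x y \<or> (x = a \<and> y = b) \<or> (x = b \<and> y = a)" for x y
  have ab: "a \<noteq> b" using za b by auto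
  have g': "graph_on n E'" using g a b ab unfolding graph_on_def E'_def by blast
  have cl: "clique E Y" if Y: "clique E' Y" "card Y \<ge> 3" for Y
    unfolding clique_def
  proof (intro ballI impI)
    fix x y assume xy: "x \<in> Y" "y \<in> Y" "x \<noteq> y"
    have fY: "finite Y" using Y(2) by (metis card.infinite not_numeral_le_zero)
    have "\<not> Y \<subseteq> {x, y}" using card_mono[of "{x, y}" Y] Y(2) xy(3) by auto
    then obtain w where w: "w \<in> Y" "w \<noteq> x" "w \<noteq> y" by blast
    have e: "E' x y" "E' x w" "E' y w" "E' w x" "E' w y" using cliqueD[OF Y(1)] xy w by metis+
    show "E x y"
    proof (rule ccontr)
      assume "\<not> E x y"
      hence "(x = a \<and> y = b) \<or> (x = b \<and> y = a)" using e(1) unfolding E'_def by auto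
      hence "E a w" "E w b" using e w unfolding E'_def by auto
      hence "z b = 0" using nb za by blast
      thus False using b(2) by simp
    qed
  qed
  have "SF_free p ks n (edge_set E')"
    unfolding SF_free_def
  proof
    assume con: "contains_SF p ks n (edge_set E')"
    have ks1: "ks ! i \<ge> 1" if "i < length ks" for i using ks nth_mem[OF that] by auto
    have "\<exists>c X. (\<forall>i<length ks. fan p E' (ks ! i) {} (c i) (X i)) \<and>
      (\<forall>i<length ks. \<forall>j<length ks. i \<noteq> j \<longrightarrow>
        star_support (ks ! i) (c i) (X i) \<inter> star_support (ks ! j) (c j) (X j) = {})"
      by (rule contains_SF_D[OF g' _ con]) (rule ks1)
    then obtain c X where f: "\<forall>i<length ks. fan p E' (ks ! i) {} (c i) (X i)"
      and d: "\<forall>i<length ks. \<forall>j<length ks. i \<noteq> j \<longrightarrow>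
        star_support (ks ! i) (c i) (X i) \<inter> star_support (ks ! j) (c j) (X j) = {}"
      by (elim exE conjE)
    have "fan p E (ks ! i) {} (c i) (X i)" if i: "i < length ks" for i
      unfolding fan_def
    proof (intro conjI allI impI)
      fix k assume k: "k < ks ! i"
      note F = fanD[OF f[rule_format, OF i] k]
      show "finite (X i k)" "card (X i k) = p" "c i \<notin> X i k" "X i k \<inter> {} = {}" using F by auto
      have "card (insert (c i) (X i k)) = p + 1" using F by simp
      thus "clique E (insert (c i) (X i k))" using cl[OF F(5)] p by simp
    next
      fix k l assume "k < ks ! i" "l < ks ! i" "k \<noteq> l"
      thus "X i k \<inter> X i l = {}" using fanD(6)[OF f[rule_format, OF i]] by blast
    qed
    note fE = this
    have "contains_SF p ks n (edge_set E)"
    proof (rule contains_SF_I[OF g, where c = c and X = X])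
      show "1 \<le> p" using p by simp
      show "1 \<le> ks ! i" if "i < length ks" for i using ks1[OF that] .
      show "fan p E (ks ! i) {} (c i) (X i)" if "i < length ks" for i using fE[OF that] .
      show "star_support (ks ! i) (c i) (X i) \<inter> star_support (ks ! j) (c j) (X j) = {}"
        if "i < length ks" "j < length ks" "i \<noteq> j" for i j using d that by blast
    qed
    thus False using free unfolding SF_free_def by simp
  qed
  hence l: "lam n E' \<le> lam n E" by (rule max[OF g'])
  have sub: "quad n E z \<le> quad n E' z"
    unfolding quad_def
  proof (intro sum_mono mult_right_mono)
    show "of_bool (E x y) \<le> (of_bool (E' x y) :: real)" for x y by (simp add: E'_def of_bool_def)
  qed (use z(1) in auto)
  have up: "quad n E' z \<le> lam n E' * n" using quad_le_lam[OF n g', of z] z(2) by simp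
  have "lam n E * n \<le> lam n E' * n" using sub up z(3) by linarith
  hence ll: "lam n E' = lam n E" using l n by simp
  \<comment> \<open>The form does not drop and the spectral radius does not grow, so z attains the
    maximum for E' too and is an eigenvector of it; the equation at a is then violated by the new
    neighbour b.\<close>
  have "quad n E' z = lam n E' * (\<Sum>i<n. (z i)\<^sup>2)" using sub up z(2,3) ll by simp
  from quad_maximizer_eigen[OF n g' this a]
  have "(\<Sum>j<n. of_bool (E' a j) * z j) = 0" using za by simp
  hence "of_bool (E' a b) * z b = 0" using z(1) b(1) by (subst (asm) sum_nonneg_eq_0_iff) auto
  thus False using b(2) by (simp add: E'_def)
qed

lemma quad_one_eq_card:
  assumes g: "graph_on n E"
  shows "quad n E (\<lambda>_. 1) = 2 * real (card (edge_set E))"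
proof -
  have fin: "finite {x. fst x < n \<and> snd x < n \<and> E (fst x) (snd x)}"
    by (rule finite_subset[of _ "{..<n} \<times> {..<n}"]) auto
  have "quad n E (\<lambda>_. 1) = (\<Sum>x\<in>{..<n} \<times> {..<n}. of_bool (E (fst x) (snd x)))"
    unfolding quad_def by (simp add: sum.cartesian_product case_prod_beta)
  also have "\<dots> = real (card {x. E (fst x) (snd x)})"
  proof -
    have "{..<n} \<times> {..<n} \<inter> {x. E (fst x) (snd x)} = {x. E (fst x) (snd x)}"
      using graph_onD[OF g] by auto
    thus ?thesis by (simp add: sum_of_bool_eq)
  qed
  also have "{x. E (fst x) (snd x)} = (\<Union>e\<in>edge_set E. {x. {fst x, snd x} = e})"
    using mem_edge_set[OF g] by auto
  also have "card \<dots> = (\<Sum>e\<in>edge_set E. card {x :: nat \<times> nat. {fst x, snd x} = e})"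
  proof (rule card_UN_disjoint)
    have "edge_set E \<subseteq> (\<lambda>x. {fst x, snd x}) ` ({..<n} \<times> {..<n})"
    proof
      fix e assume "e \<in> edge_set E"
      then obtain u v where "e = {u, v}" "E u v" unfolding edge_set_def by blast
      thus "e \<in> (\<lambda>x. {fst x, snd x}) ` ({..<n} \<times> {..<n})"
        using graph_onD[OF g] by (intro image_eqI[of _ _ "(u, v)"]) auto
    qed
    thus "finite (edge_set E)" by (rule finite_subset) auto
    show "\<forall>e\<in>edge_set E. finite {x :: nat \<times> nat. {fst x, snd x} = e}"
    proof
      fix e assume "e \<in> edge_set E"
      then obtain u v where "e = {u, v}" unfolding edge_set_def by blast
      have "{x :: nat \<times> nat. {fst x, snd x} = e} \<subseteq> {u, v} \<times> {u, v}"
      proof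
        fix x :: "nat \<times> nat" assume "x \<in> {x. {fst x, snd x} = e}"
        hence "{fst x, snd x} = {u, v}" using \<open>e = {u, v}\<close> by simp
        hence "fst x \<in> {u, v}" "snd x \<in> {u, v}" by blast+
        thus "x \<in> {u, v} \<times> {u, v}" by (cases x) auto
      qed
      thus "finite {x :: nat \<times> nat. {fst x, snd x} = e}" by (rule finite_subset) auto
    qed
  qed auto
  also have "\<dots> = (\<Sum>e\<in>edge_set E. 2)"
  proof (rule sum.cong[OF refl])
    fix e assume "e \<in> edge_set E"
    then obtain u v where uv: "e = {u, v}" "E u v" unfolding edge_set_def by blast
    have "{x. {fst x, snd x} = e} = {(u, v), (v, u)}" unfolding uv(1) by (auto simp: doubleton_eq_iff)
    thus "card {x. {fst x, snd x} = e} = 2" using graph_onD(4)[OF g uv(2)] by simp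
  qed
  finally show ?thesis by simp
qed

text \<open>With A and A' the adjacency matrices, the left side pairs x with (A' - A) y, and A' - A
  lives in the row and column of u. The identity is obtained by polarisation from
  \<open>quad_change_vertex\<close>, which speaks of quadratic forms only.\<close>

lemma two_eigenvectors:
  fixes x y :: "nat \<Rightarrow> real"
  assumes g: "graph_on n E" and g': "graph_on n E'" and u: "u < n"
    and eq: "\<And>a b. a \<noteq> u \<Longrightarrow> b \<noteq> u \<Longrightarrow> E' a b = E a b"
    and x: "\<And>i. i < n \<Longrightarrow> (\<Sum>j<n. of_bool (E i j) * x j) = l * x i"
    and y: "\<And>i. i < n \<Longrightarrow> (\<Sum>j<n. of_bool (E' i j) * y j) = l' * y i"
  shows "(l' - l) * (\<Sum>i<n. x i * y i) =
    x u * ((\<Sum>b<n. of_bool (E' u b) * y b) - (\<Sum>b<n. of_bool (E u b) * y b)) +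
    y u * ((\<Sum>b<n. of_bool (E' u b) * x b) - (\<Sum>b<n. of_bool (E u b) * x b))"
proof -
  have pol: "quad n D (\<lambda>i. f i + h i) - quad n D (\<lambda>i. f i - h i) = 4 * (\<Sum>a<n. h a * (\<Sum>b<n. of_bool (D a b) * f b))"
    if D: "graph_on n D" for D and f h :: "nat \<Rightarrow> real"
  proof -
    have "(\<Sum>a<n. \<Sum>b<n. of_bool (D a b) * f a * h b) = (\<Sum>b<n. \<Sum>a<n. of_bool (D a b) * f a * h b)" by (rule sum.swap)
    also have "\<dots> = (\<Sum>a<n. \<Sum>b<n. of_bool (D a b) * h a * f b)"
    proof (intro sum.cong refl)
      fix a b have "D b a = D a b" using graph_on_sym[OF D] by blast
      thus "of_bool (D b a) * f b * h a = of_bool (D a b) * h a * f b" by simp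
    qed
    finally have sw: "(\<Sum>a<n. \<Sum>b<n. of_bool (D a b) * f a * h b) = (\<Sum>a<n. \<Sum>b<n. of_bool (D a b) * h a * f b)" .
    have "quad n D (\<lambda>i. f i + h i) - quad n D (\<lambda>i. f i - h i) =
      (\<Sum>a<n. \<Sum>b<n. 2 * (of_bool (D a b) * f a * h b) + 2 * (of_bool (D a b) * h a * f b))"
      unfolding quad_def sum_subtractf[symmetric] by (intro sum.cong refl) (simp add: algebra_simps)
    also have "\<dots> = 2 * (\<Sum>a<n. \<Sum>b<n. of_bool (D a b) * f a * h b) + 2 * (\<Sum>a<n. \<Sum>b<n. of_bool (D a b) * h a * f b)"
      by (simp add: sum.distrib sum_distrib_left)
    also have "\<dots> = 4 * (\<Sum>a<n. \<Sum>b<n. of_bool (D a b) * h a * f b)" unfolding sw by simp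
    also have "(\<Sum>a<n. \<Sum>b<n. of_bool (D a b) * h a * f b) = (\<Sum>a<n. h a * (\<Sum>b<n. of_bool (D a b) * f b))"
      by (simp add: sum_distrib_left mult_ac)
    finally show ?thesis .
  qed
  have chg: "quad n E' w - quad n E w = 2 * w u * ((\<Sum>b<n. of_bool (E' u b) * w b) - (\<Sum>b<n. of_bool (E u b) * w b))" for w
  proof (rule quad_change_vertex)
    show "E a b \<Longrightarrow> E b a" "E' a b \<Longrightarrow> E' b a" for a b using graph_onD(1)[OF g] graph_onD(1)[OF g'] by blast+
    show "\<not> E u u" "\<not> E' u u" using graph_onD(4)[OF g] graph_onD(4)[OF g'] by blast+
  qed (use u eq in auto)
  define d where "d f = (\<Sum>b<n. of_bool (E' u b) * f b) - (\<Sum>b<n. of_bool (E u b) * f b)" for f :: "nat \<Rightarrow> real"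
  have da: "d (\<lambda>i. x i + y i) = d x + d y" "d (\<lambda>i. x i - y i) = d x - d y"
    unfolding d_def by (simp_all add: algebra_simps sum.distrib sum_subtractf)
  have c1: "quad n E (\<lambda>i. y i + x i) - quad n E (\<lambda>i. x i - y i) = 4 * (l * (\<Sum>i<n. x i * y i))"
  proof -
    have "(\<Sum>a<n. y a * (\<Sum>b<n. of_bool (E a b) * x b)) = (\<Sum>a<n. l * (x a * y a))"
      by (intro sum.cong refl) (simp add: x)
    thus ?thesis using pol[OF g, of x y] by (simp add: add.commute sum_distrib_left)
  qed
  have c2: "quad n E' (\<lambda>i. y i + x i) - quad n E' (\<lambda>i. y i - x i) = 4 * (l' * (\<Sum>i<n. x i * y i))"
  proof -
    have "(\<Sum>a<n. x a * (\<Sum>b<n. of_bool (E' a b) * y b)) = (\<Sum>a<n. l' * (x a * y a))"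
      by (intro sum.cong refl) (simp add: y)
    thus ?thesis using pol[OF g', of y x] by (simp add: sum_distrib_left)
  qed
  have neg: "quad n D (\<lambda>i. y i - x i) = quad n D (\<lambda>i. x i - y i)" for D
    unfolding quad_def by (intro sum.cong refl) (simp add: algebra_simps)
  have "4 * ((l' - l) * (\<Sum>i<n. x i * y i)) = (quad n E' (\<lambda>i. x i + y i) - quad n E (\<lambda>i. x i + y i))
    - (quad n E' (\<lambda>i. x i - y i) - quad n E (\<lambda>i. x i - y i))"
    using c1 c2 neg[of E'] by (simp add: algebra_simps)
  also have "\<dots> = 2 * (x u + y u) * (d x + d y) - 2 * (x u - y u) * (d x - d y)"
    unfolding chg d_def[symmetric] da ..
  also have "\<dots> = 4 * (x u * d y + y u * d x)" by (simp add: algebra_simps)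
  finally show ?thesis unfolding d_def by simp
qed

section \<open>Balancing the classes by moving a vertex\<close>

lemma structured_adj:
  assumes S: "structured p r k n E L c C" and ab: "a < n" "b < n"
  shows "a \<in> L \<or> b \<in> L \<Longrightarrow> E a b \<longleftrightarrow> a \<noteq> b"
    and "a \<notin> L \<Longrightarrow> b \<notin> L \<Longrightarrow> \<not> (a \<in> special n E L c \<and> b \<in> special n E L c) \<Longrightarrow> E a b \<longleftrightarrow> c a \<noteq> c b"
proof -
  note g = structuredD(1)[OF S]
  show "a \<in> L \<or> b \<in> L \<Longrightarrow> E a b \<longleftrightarrow> a \<noteq> b"
    using structuredD(6)[OF S, of a b] structuredD(6)[OF S, of b a] graph_onD[OF g] ab by blast
  show "E a b \<longleftrightarrow> c a \<noteq> c b" if "a \<notin> L" "b \<notin> L" "\<not> (a \<in> special n E L c \<and> b \<in> special n E L c)"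
    using that ab graph_on_sym[OF g, of a b] unfolding special_def ordinary_def by auto
qed

text \<open>As p >= 2, a class has at most about n / 2 vertices and l is at least about n / 2; the
  errors of order sqrt n fit into the factor 1 + \<epsilon>.\<close>

lemma size_ratio:
  fixes C K \<epsilon> l m :: real and n p :: nat
  assumes p: "p \<ge> 2" and l: "l \<ge> (1 - 1 / p) * n - K" and m: "m \<le> n / p + C * sqrt n"
    and \<epsilon>: "0 < \<epsilon>" "\<epsilon> \<le> 1" and CK: "C \<ge> 0" "K \<ge> 0" and n: "sqrt n * \<epsilon> \<ge> 4 * (C + K)" "n \<ge> 1"
  shows "m \<le> (1 + \<epsilon>) * l"
proof -
  have s1: "sqrt n \<ge> 1" using n(2) by simp
  have "real n * 2 \<le> real n * p" using p by (intro mult_left_mono) auto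
  hence np: "n / p \<le> n / 2" using p by (simp add: field_simps)
  have "(1 - 1 / p) * real n = n - n / p" by (simp add: algebra_simps)
  hence l2: "l \<ge> n / 2 - K" using l np by linarith
  have "(sqrt n * \<epsilon>) * sqrt n \<ge> 4 * (C + K) * sqrt n" using n(1) by (intro mult_right_mono) auto
  moreover have "sqrt n * sqrt n = n" by simp
  ultimately have "\<epsilon> * n \<ge> 4 * (C * sqrt n) + 4 * (K * sqrt n)" by (simp add: algebra_simps)
  moreover have "K * 1 \<le> K * sqrt n" using s1 CK by (intro mult_left_mono) auto
  moreover have "\<epsilon> * K \<le> 1 * K" using \<epsilon> CK by (intro mult_right_mono) auto
  moreover have "C * sqrt n \<ge> 0" using CK by simp
  ultimately have "n / 2 + C * sqrt n \<le> n / 2 + \<epsilon> * n / 2 - K - \<epsilon> * K" by linarith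
  also have "\<dots> = (1 + \<epsilon>) * (n / 2 - K)" by (simp add: algebra_simps)
  also have "\<dots> \<le> (1 + \<epsilon>) * l" using l2 \<epsilon> by (intro mult_left_mono) auto
  finally show ?thesis using m np by linarith
qed

text \<open>Moving an ordinary vertex from a class to one that is smaller by at least two raises the
  spectral radius: the Perron vectors of both graphs express the change exactly, and it suffices to
  know the two vectors up to a small relative error.\<close>

lemma move_vertex_raises_lam:
  fixes C K K2 \<epsilon> :: real
  assumes p: "p \<ge> 2" and k: "k \<ge> 1" and len: "length ks = r + 1" and ks: "\<forall>k'\<in>set ks. k \<le> k'"
    and S: "structured p r k n E L c C" and P: "near_perron p n E K z" and K: "K \<ge> 0" "K2 \<ge> 0"
    and ij: "i < p" "j < p" and gap: "card (rest_class n L c i) \<ge> card (rest_class n L c j) + 2"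
    and \<epsilon>: "\<epsilon> = 1 / (100 * (C + 2))"
    and n: "n \<ge> 1" "sqrt n * \<epsilon> \<ge> 4 * (2 * sqrt K + C + r + 2 * (C * K) + K)"
      "sqrt n * \<epsilon> \<ge> 4 * (2 * sqrt K2 + (C + 1) + r + 2 * ((C + 1) * K2) + K2)"
      "sqrt n \<ge> p * (3 * C + r + (real (1 + p * k) + 2) + 1)"
      "sqrt n * \<epsilon> \<ge> 4 * (C + K)" "sqrt n * \<epsilon> \<ge> 4 * ((C + 1) + K2)"
    and ex: "\<And>G. graph_on n G \<Longrightarrow> SF_free p ks n (edge_set G) \<Longrightarrow>
      lam n G \<ge> (1 - 1 / p) * n - (K + 2 * K\<^sup>2) \<Longrightarrow> \<exists>y. near_perron p n G K2 y"
  shows "\<exists>G. graph_on n G \<and> SF_free p ks n (edge_set G) \<and> lam n G > lam n E"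
proof -
  have C: "C \<ge> 0" by (rule structuredD(11)[OF S])
  \<comment> \<open>The choice of \<epsilon> keeps the error terms
    \<open>8 * (C * \<epsilon>)\<close> and \<open>8 * ((C + 1) * \<epsilon>)\<close> of
    \<open>class_weight_gap\<close> at most 8/100; C + 1 is the constant of the graph after the
    move.\<close>
  have \<epsilon>01: "0 < \<epsilon>" "\<epsilon> \<le> 1 / 200" using C by (auto simp: \<epsilon> field_simps)
  have C\<epsilon>: "(C + 1) * \<epsilon> \<le> 1 / 100" "C * \<epsilon> \<le> 1 / 100" using C by (auto simp: \<epsilon> field_simps)
  have neij: "i \<noteq> j" using gap by auto
  note P' = P[unfolded near_perron_def]
  have z: "\<And>i. i < n \<Longrightarrow> 0 \<le> z i \<and> z i \<le> K" "(\<Sum>i<n. (z i)\<^sup>2) = n"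
    "\<And>v. v < n \<Longrightarrow> (\<Sum>j<n. of_bool (E v j) * z j) = lam n E * z v" "quad n E z = lam n E * n"
    "\<bar>lam n E - (1 - 1 / p) * n\<bar> \<le> K" "n \<le> 4 * lam n E"
    using P' by blast+
  note g = structuredD(1)[OF S]
  let ?Sp = "special n E L c"
  have room: "real (card (rest_class n L c j - ?Sp)) \<ge> real (1 + p * k) + 2" if "j < p" for j
    by (rule many_ordinary[OF _ S that n(4)]) (use p in simp)
  have ordI: "ordinary n E L c v \<and> c v = j" if "v \<in> rest_class n L c j - ?Sp" for v j
    using that unfolding special_def rest_class_def by auto
  have "card (rest_class n L c i - ?Sp) \<ge> 2" using room[OF ij(1)] by linarith
  \<comment> \<open>Two ordinary vertices of class i are needed: u is moved, and t stays behind to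
    represent the class when class weights are compared in the new graph.\<close>
  then obtain T where T: "T \<subseteq> rest_class n L c i - ?Sp" "card T = 2"
    by (meson obtain_subset_with_card_n)
  obtain u t where ut: "u \<in> T" "t \<in> T" "u \<noteq> t" using T(2) by (metis card_2_iff insertI1 insertI2)
  have u: "ordinary n E L c u" "c u = i" and t: "ordinary n E L c t" "c t = i"
    using ut T(1) ordI by blast+
  have "card (rest_class n L c j - ?Sp) \<noteq> 0" using room[OF ij(2)] by linarith
  hence "rest_class n L c j - ?Sp \<noteq> {}" by (metis card.empty)
  then obtain w where "w \<in> rest_class n L c j - ?Sp" by blast
  hence w: "ordinary n E L c w" "c w = j" using ordI by blast+
  have u': "u < n" "u \<notin> L" "u \<notin> ?Sp" and t': "t < n" "t \<notin> L" "t \<notin> ?Sp"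
    using u t unfolding ordinary_def special_def by auto
  define c' where "c' = c(u := j)"
  \<comment> \<open>Copying the special vertices onto themselves keeps their pattern and makes all
    other vertices off L, u among them, follow the new colouring.\<close>
  define E' where "E' = transplant n E ?Sp (\<lambda>x. x) L c'"
  have inv: "inv_into ?Sp (\<lambda>x. x) x = x" if "x \<in> ?Sp" for x
    using inv_into_f_f[of "\<lambda>x. x" ?Sp x] that by (simp add: inj_on_def)
  have E': "E' a b \<longleftrightarrow> a \<noteq> b \<and> a < n \<and> b < n \<and> (a \<in> L \<or> b \<in> L \<or> (if a \<in> ?Sp \<and> b \<in> ?Sp then E a b else c' a \<noteq> c' b))" for a b
    unfolding E'_def transplant_def using inv by auto
  have S': "structured p r k n E' L c' (C + 1)"
    unfolding E'_def
  proof (rule transplant_structured(1)[OF S k])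
    show "\<bar>real (card {v. v < n \<and> c' v = h}) - n / p\<bar> \<le> (C + 1) * sqrt n" if h: "h < p" for h
    proof -
      let ?A = "{v. v < n \<and> c v = h}" and ?B = "{v. v < n \<and> c' v = h}"
      have "?B \<subseteq> insert u ?A" "?A \<subseteq> insert u ?B" by (auto simp: c'_def)
      hence "card ?B \<le> card (insert u ?A)" "card ?A \<le> card (insert u ?B)" by (intro card_mono; simp)+
      moreover have "card (insert u ?A) \<le> card ?A + 1" "card (insert u ?B) \<le> card ?B + 1"
        by (simp_all add: card_insert_if)
      ultimately have "\<bar>real (card ?B) - real (card ?A)\<bar> \<le> 1" by linarith
      moreover have "sqrt n \<ge> 1" using n(1) by simp
      moreover have "(C + 1) * sqrt n = C * sqrt n + sqrt n" by (simp add: algebra_simps)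
      ultimately show ?thesis using structuredD(10)[OF S h] by linarith
    qed
    show "card (rest_class n L c h - ?Sp) \<ge> 1 + p * k" if "h < p" for h using room[OF that] by linarith
  qed (use p structuredD(2,4,5)[OF S] ij u' in \<open>auto simp: c'_def special_def\<close>)
  have free': "SF_free p ks n (edge_set E')" by (rule structured_free[OF S' len k ks])
  note g' = structuredD(1)[OF S']
  have ord': "ordinary n E' L c' v" if "v < n" "v \<notin> L" "v \<notin> ?Sp" for v
    using that unfolding ordinary_def E' by auto
  have off: "E' a b = E a b" if "a \<noteq> u" "b \<noteq> u" for a b
  proof (cases "a < n \<and> b < n")
    case True
    have cc: "c' a = c a" "c' b = c b" using that by (auto simp: c'_def)
    show ?thesis
      using structured_adj[OF S, of a b] True graph_onD(4)[OF g, of a b] unfolding E' cc by auto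
  next
    case False thus ?thesis using graph_onD[OF g] unfolding E' by blast
  qed
  have chg: "quad n E' z - quad n E z = 2 * z u * ((\<Sum>b<n. of_bool (E' u b) * z b) - (\<Sum>b<n. of_bool (E u b) * z b))"
  proof (rule quad_change_vertex)
    show "E a b \<Longrightarrow> E b a" "E' a b \<Longrightarrow> E' b a" for a b using graph_onD(1)[OF g] graph_onD(1)[OF g'] by blast+
    show "\<not> E u u" "\<not> E' u u" using graph_onD(4)[OF g] graph_onD(4)[OF g'] by blast+
  qed (use u' off in auto)
  \<comment> \<open>A crude bound suffices: it only ensures that E' has a nearly constant Perron
    vector y as well, which explains the allowance \<open>K + 2 * K\<^sup>2\<close> in
    \<open>ex\<close>.\<close>
  have lam': "lam n E' \<ge> lam n E - 2 * K\<^sup>2"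
  proof -
    have "(\<Sum>b<n. of_bool (E u b) * z b) \<le> (\<Sum>b<n. K)" using z(1) K by (intro sum_mono) auto
    moreover have "0 \<le> (\<Sum>b<n. of_bool (E' u b) * z b)" using z(1) by (intro sum_nonneg) auto
    ultimately have "z u * ((\<Sum>b<n. of_bool (E u b) * z b) - (\<Sum>b<n. of_bool (E' u b) * z b)) \<le> z u * (n * K)"
      using z(1)[OF u'(1)] by (intro mult_left_mono) auto
    also have "\<dots> \<le> K * (n * K)" using z(1)[OF u'(1)] K by (intro mult_right_mono) auto
    finally have "quad n E' z \<ge> quad n E z - 2 * (K * (n * K))" using chg by (simp add: algebra_simps)
    moreover have "quad n E' z \<le> lam n E' * n" using quad_le_lam[OF n(1) g', of z] z(2) by simp
    ultimately have "(lam n E - 2 * K\<^sup>2) * n \<le> lam n E' * n"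
      using z(4) by (simp add: algebra_simps power2_eq_square)
    thus ?thesis using n(1) by simp
  qed
  hence "lam n E' \<ge> (1 - 1 / p) * n - (K + 2 * K\<^sup>2)" using z(5) by linarith
  then obtain y where Py: "near_perron p n E' K2 y" using ex[OF g' free'] by blast
  note Py' = Py[unfolded near_perron_def]
  have y: "\<And>i. i < n \<Longrightarrow> 0 \<le> y i \<and> y i \<le> K2"
    "\<And>v. v < n \<Longrightarrow> (\<Sum>j<n. of_bool (E' v j) * y j) = lam n E' * y v"
    "\<bar>lam n E' - (1 - 1 / p) * n\<bar> \<le> K2" "n \<le> 4 * lam n E'"
    using Py' by blast+
  have nz: "\<bar>z v - 1\<bar> \<le> \<epsilon>" if "v < n" "v \<notin> L" for v
    by (rule perron_nearly_constant[OF p S P \<epsilon>01(1) n(2,1) that])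
  have ny: "\<bar>y v - 1\<bar> \<le> \<epsilon>" if "v < n" "v \<notin> L" for v
    by (rule perron_nearly_constant[OF p S' Py \<epsilon>01(1) n(3,1) that])
  have \<epsilon>1: "0 \<le> \<epsilon>" "\<epsilon> \<le> 1" using \<epsilon>01 by auto
  have half: "x \<ge> 1 / 2" if x: "(2 + \<epsilon>) * x \<ge> real 2 * (1 - \<epsilon>) - 8 * (C * \<epsilon>)" for x :: real
  proof (rule ccontr)
    assume "\<not> ?thesis"
    hence "(2 + \<epsilon>) * x \<le> (2 + \<epsilon>) * (1 / 2)" using \<epsilon>01 by (intro mult_left_mono) auto
    moreover have "(2 + \<epsilon>) * (1 / 2) = 1 + \<epsilon> / 2" by simp
    moreover have "real 2 * (1 - \<epsilon>) = 2 - 2 * \<epsilon>" by simp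
    ultimately show False using x C\<epsilon>(2) \<epsilon>01 by linarith
  qed
  have tiny: "x \<ge> - (8 / 100)" if x: "(2 + \<epsilon>) * x \<ge> - 8 * ((C + 1) * \<epsilon>)" for x :: real
  proof (cases "x \<ge> 0")
    case False
    hence "(2 + \<epsilon>) * x \<le> 1 * x" using \<epsilon>01 by (intro mult_right_mono_neg) auto
    thus ?thesis using x C\<epsilon>(1) by linarith
  qed simp
  let ?D = "sum z (rest_class n L c i) - sum z (rest_class n L c j)"
  let ?D' = "sum y (rest_class n L c' i) - sum y (rest_class n L c' j)"
  have r1: "real (card (rest_class n L c (c w))) \<le> (1 + \<epsilon>) * lam n E"
    by (rule size_ratio[OF p _ rest_class_size(1)[OF S structuredD(5)[OF S]] \<epsilon>01(1) \<epsilon>1(2) C K(1) n(5,1)])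
      (use z(5) in linarith)
  have l0: "lam n E > 0" "lam n E' > 0" using z(6) y(4) n(1) by auto
  have "?D \<ge> real 2 * (1 - \<epsilon>) - 8 * (C * \<epsilon>) \<or> (2 + \<epsilon>) * ?D \<ge> real 2 * (1 - \<epsilon>) - 8 * (C * \<epsilon>)"
    using class_weight_gap[OF S l0(1) z(3) nz u(1) w(1) _ r1 \<epsilon>1, of 2] gap unfolding u(2) w(2) by simp
  hence D: "?D \<ge> 1 / 2"
  proof (elim disjE)
    assume "(2 + \<epsilon>) * ?D \<ge> real 2 * (1 - \<epsilon>) - 8 * (C * \<epsilon>)"
    thus ?thesis by (rule half)
  qed (use C\<epsilon> \<epsilon>01 in simp)
  have ri: "rest_class n L c' i = rest_class n L c i - {u}" using neij u by (auto simp: rest_class_def c'_def)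
  have rj: "rest_class n L c' j = insert u (rest_class n L c j)"
    using neij u u' by (auto simp: rest_class_def c'_def)
  have ui: "u \<in> rest_class n L c i" "u \<notin> rest_class n L c j" using u u' neij by (auto simp: rest_class_def)
  have ct: "c' t = i" "c' u = j" using t(2) ut(3) by (auto simp: c'_def)
  have r2: "real (card (rest_class n L c' (c' u))) \<le> (1 + \<epsilon>) * lam n E'"
    by (rule size_ratio[OF p _ rest_class_size(1)[OF S' structuredD(5)[OF S']] \<epsilon>01(1) \<epsilon>1(2) _ K(2) n(6,1)])
      (use y(3) C in linarith)+
  \<comment> \<open>A gap of 2 leaves class i at least as large as class j after the move, so
    \<open>class_weight_gap\<close> with d = 0 shows that D' is at worst slightly negative.\<close>
  have "card (rest_class n L c' (c' u)) + 0 \<le> card (rest_class n L c' (c' t))"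
    unfolding ct ri rj using ui gap by (simp add: finite_rest_class)
  from class_weight_gap[OF S' l0(2) y(2) ny ord'[OF t'] ord'[OF u'] this r2 \<epsilon>1]
  have "?D' \<ge> - 8 * ((C + 1) * \<epsilon>) \<or> (2 + \<epsilon>) * ?D' \<ge> - 8 * ((C + 1) * \<epsilon>)" unfolding ct by simp
  hence D': "?D' \<ge> - (8 / 100)"
  proof (elim disjE)
    assume A: "(2 + \<epsilon>) * ?D' \<ge> - 8 * ((C + 1) * \<epsilon>)"
    thus ?thesis by (rule tiny)
  qed (use C\<epsilon> in linarith)
  \<comment> \<open>The change of the row at u is written for z with the classes before the move and
    for y with those after it, so that the products \<open>z u * y u\<close> cancel below.\<close>
  have dz: "(\<Sum>b<n. of_bool (E' u b) * z b) - (\<Sum>b<n. of_bool (E u b) * z b) = ?D - z u"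
    using ordinary_row[OF ord'[OF u'], of z] ordinary_row[OF u(1), of z] ui
    unfolding ct u(2) rj by (simp add: finite_rest_class)
  have dy: "(\<Sum>b<n. of_bool (E' u b) * y b) - (\<Sum>b<n. of_bool (E u b) * y b) = ?D' + y u"
    using ordinary_row[OF ord'[OF u'], of y] ordinary_row[OF u(1), of y]
      sum.remove[OF finite_rest_class ui(1), of y]
    unfolding ct u(2) ri by simp
  have "(lam n E' - lam n E) * (\<Sum>i<n. z i * y i) = z u * (?D' + y u) + y u * (?D - z u)"
    using two_eigenvectors[OF g g' u'(1) off z(3) y(2)] unfolding dz dy by blast
  also have "\<dots> = z u * ?D' + y u * ?D" by (simp add: algebra_simps)
  finally have main: "(lam n E' - lam n E) * (\<Sum>i<n. z i * y i) = z u * ?D' + y u * ?D" .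
  have zu: "1 / 2 \<le> z u" "z u \<le> 3 / 2" "1 / 2 \<le> y u" using nz[OF u'(1,2)] ny[OF u'(1,2)] \<epsilon>01 by auto
  have "z u * ?D' \<ge> z u * (- (8 / 100))" using D' zu by (intro mult_left_mono) auto
  moreover have "y u * ?D \<ge> (1 / 2) * (1 / 2)" using D zu by (intro mult_mono) auto
  ultimately have "z u * ?D' + y u * ?D > 0" using zu by linarith
  moreover have "0 \<le> (\<Sum>i<n. z i * y i)" using z(1) y(1) by (intro sum_nonneg mult_nonneg_nonneg) auto
  ultimately have "lam n E' > lam n E"
    using main by (metis linorder_not_less diff_le_0_iff_le mult_nonpos_nonneg)
  thus ?thesis using g' free' by blast
qed

section \<open>Comparing surpluses and counting edges\<close>

lemma near_perron_mono:
  assumes "near_perron p n E K z" "K \<le> K'"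
  shows "near_perron p n E K' z"
proof -
  have "K * n \<le> K' * n" using assms(2) by (intro mult_right_mono) auto
  hence "(1 - 1 / p) * (real n)\<^sup>2 - K' * n \<le> (1 - 1 / p) * (real n)\<^sup>2 - K * n" by simp
  thus ?thesis using assms unfolding near_perron_def by (meson order_trans)
qed

lemma structured_mono:
  assumes S: "structured p r k n E L c C" and "C \<le> C'"
  shows "structured p r k n E L c C'"
proof -
  have "C * sqrt n \<le> C' * sqrt n" using assms(2) by (intro mult_right_mono) auto
  hence "\<bar>real (card {v. v < n \<and> c v = j}) - n / p\<bar> \<le> C' * sqrt n" if "j < p" for j
    using structuredD(10)[OF S that] by linarith
  thus ?thesis
    using structuredD(1-9)[OF S] assms(2) by (intro structuredI) (auto intro: order_trans)
qed

lemma quad_one_nat: "\<exists>m :: nat. quad n D (\<lambda>_. 1) = real m"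
proof
  show "quad n D (\<lambda>_. 1) = real (\<Sum>u<n. \<Sum>v<n. of_bool (D u v))" by (simp add: quad_def)
qed

text \<open>The configuration of E2 is copied onto the classes of E. The copy has the same L and
  colouring as E, so the two weights differ only through extra and lacking pairs, and these have
  weight nearly 1.\<close>

lemma surplus_le:
  fixes C \<epsilon> :: real
  assumes p: "p \<ge> 1" and k: "k \<ge> 1" and len: "length ks = r + 1" and ks: "\<forall>k'\<in>set ks. k \<le> k'"
    and S: "structured p r k n E L c C" and S2: "structured p r k n E2 L2 c2 C"
    and near: "\<And>v. v < n \<Longrightarrow> v \<notin> L \<Longrightarrow> \<bar>z v - 1\<bar> \<le> \<epsilon>" and \<epsilon>: "0 \<le> \<epsilon>" "\<epsilon> \<le> 1" "12 * (C * \<epsilon>) < 1"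
    and max: "\<And>G. graph_on n G \<Longrightarrow> SF_free p ks n (edge_set G) \<Longrightarrow> quad n G z \<le> quad n E z"
    and n: "sqrt n \<ge> p * (3 * C + r + (2 * C + 2 + real (p * k)) + 1)"
  shows "quad n (extra E2 L2 c2) (\<lambda>_. 1) - quad n (lacking E2 L2 c2) (\<lambda>_. 1)
    \<le> quad n (extra E L c) (\<lambda>_. 1) - quad n (lacking E L c) (\<lambda>_. 1)"
proof -
  have C: "C \<ge> 0" by (rule structuredD(11)[OF S])
  let ?Sp = "special n E2 L2 c2"
  have big: "real (card (rest_class n L' c' j)) \<ge> 2 * C + 2 + real (p * k)"
    "card (rest_class n L' c' j - special n E' L' c') \<ge> 1 + p * k"
    if S: "structured p r k n E' L' c' C" and j: "j < p" for E' L' c' j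
  proof -
    have m: "real (card (rest_class n L' c' j - special n E' L' c')) \<ge> 2 * C + 2 + real (p * k)"
      by (rule many_ordinary[OF p S j n])
    have "card (rest_class n L' c' j - special n E' L' c') \<le> card (rest_class n L' c' j)"
      by (intro card_mono finite_rest_class) auto
    thus "real (card (rest_class n L' c' j)) \<ge> 2 * C + 2 + real (p * k)" using m by linarith
    have "real (1 + p * k) \<le> real (card (rest_class n L' c' j - special n E' L' c'))" using m C by simp
    thus "card (rest_class n L' c' j - special n E' L' c') \<ge> 1 + p * k" by (simp only: of_nat_le_iff)
  qed
  have "\<exists>\<phi>. inj_on \<phi> ?Sp \<and> \<phi> ` ?Sp \<subseteq> {..<n} - L \<and> (\<forall>x\<in>?Sp. c (\<phi> x) = c2 x)"
  proof (rule colour_injection[OF finite_special])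
    show "c2 x < p" for x by (rule structuredD(5)[OF S2])
    show "card {b \<in> {..<n} - L. c b = j} \<ge> card ?Sp" if "j < p" for j
    proof -
      have "{b \<in> {..<n} - L. c b = j} = rest_class n L c j" by (auto simp: rest_class_def)
      moreover have "real (card ?Sp) \<le> real (card (rest_class n L c j))"
        using big(1)[OF S that] special_card[OF S2] of_nat_0_le_iff[of "p * k", where 'a = real] by linarith
      ultimately show ?thesis by simp
    qed
  qed simp
  then obtain \<phi> where \<phi>: "inj_on \<phi> ?Sp" "\<phi> ` ?Sp \<subseteq> {..<n} - L" "\<forall>x\<in>?Sp. c (\<phi> x) = c2 x"
    by (elim exE conjE)
  define E' where "E' = transplant n E2 ?Sp \<phi> L c"
  have S': "structured p r k n E' L c C"
    and tr: "quad n (extra E' L c) (\<lambda>_. 1) = quad n (extra E2 L2 c2) (\<lambda>_. 1)"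
      "quad n (lacking E' L c) (\<lambda>_. 1) = quad n (lacking E2 L2 c2) (\<lambda>_. 1)"
    unfolding E'_def
    by (rule transplant_structured[OF S2 k p, where C' = C];
      (rule structuredD(2,4,5,10)[OF S] \<phi>(1,2) \<phi>(3)[rule_format] big(2)[OF S2] order_refl; assumption?))+
  have "SF_free p ks n (edge_set E')" by (rule structured_free[OF S' len k ks])
  hence "quad n E' z \<le> quad n E z" by (rule max[OF structuredD(1)[OF S']])
  hence le: "quad n (extra E' L c) z - quad n (lacking E' L c) z \<le> quad n (extra E L c) z - quad n (lacking E L c) z"
    using quad_difference[OF S S', of z] by linarith
  have nr: "\<bar>quad n D z - quad n D (\<lambda>_. 1)\<bar> \<le> 3 * (C * \<epsilon>)"
    if D: "\<And>a b. D a b \<Longrightarrow> a \<notin> L \<and> b \<notin> L" "quad n D (\<lambda>_. 1) \<le> C" for D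
  proof -
    have "\<bar>quad n D z - quad n D (\<lambda>_. 1)\<bar> \<le> 3 * \<epsilon> * quad n D (\<lambda>_. 1)"
      by (rule quad_near_one[OF near \<epsilon>(1,2) D(1)])
    also have "\<dots> \<le> 3 * \<epsilon> * C" using D(2) \<epsilon> by (intro mult_left_mono) auto
    finally show ?thesis by (simp add: mult_ac)
  qed
  have off: "a \<notin> L \<and> b \<notin> L" if "extra G L c a b \<or> lacking G L c a b" for G a b
    using that by (auto simp: extra_def lacking_def)
  have n1: "\<bar>quad n (extra E' L c) z - quad n (extra E' L c) (\<lambda>_. 1)\<bar> \<le> 3 * (C * \<epsilon>)"
    by (rule nr[OF _ structuredD(8)[OF S']]) (use off in blast)
  have n2: "\<bar>quad n (lacking E' L c) z - quad n (lacking E' L c) (\<lambda>_. 1)\<bar> \<le> 3 * (C * \<epsilon>)"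
    by (rule nr[OF _ structuredD(9)[OF S']]) (use off in blast)
  have n3: "\<bar>quad n (extra E L c) z - quad n (extra E L c) (\<lambda>_. 1)\<bar> \<le> 3 * (C * \<epsilon>)"
    by (rule nr[OF _ structuredD(8)[OF S]]) (use off in blast)
  have n4: "\<bar>quad n (lacking E L c) z - quad n (lacking E L c) (\<lambda>_. 1)\<bar> \<le> 3 * (C * \<epsilon>)"
    by (rule nr[OF _ structuredD(9)[OF S]]) (use off in blast)
  obtain a b a' b' :: nat where nat: "quad n (extra E L c) (\<lambda>_. 1) = a" "quad n (lacking E L c) (\<lambda>_. 1) = b"
    "quad n (extra E' L c) (\<lambda>_. 1) = a'" "quad n (lacking E' L c) (\<lambda>_. 1) = b'"
    using quad_one_nat by metis
  \<comment> \<open>The four approximations cost at most \<open>12 * (C * \<epsilon>)\<close>, which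
    is less than 1, and both surpluses are integers.\<close>
  have "real a' - real b' < real a - real b + 1" using le n1 n2 n3 n4 \<epsilon>(3) unfolding nat by linarith
  hence "int a' - int b' \<le> int a - int b" by linarith
  hence "real a' - real b' \<le> real a - real b" by linarith
  thus ?thesis using tr nat by simp
qed

text \<open>An ordered pair is an edge, a loop at L, a pair inside a class off L, or lacking, and
  only the extra pairs are counted twice. The number of edges thus depends on the class sizes and
  the surplus alone.\<close>

lemma quad_structured_count:
  assumes S: "structured p r k n E L c C"
  shows "quad n E (\<lambda>_. 1) = (real n)\<^sup>2 - r - (\<Sum>j<p. (real (card (rest_class n L c j)))\<^sup>2)
    + (quad n (extra E L c) (\<lambda>_. 1) - quad n (lacking E L c) (\<lambda>_. 1))"
proof -
  let ?V = "{..<n} - L"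
  have LV: "L \<subseteq> {..<n}" by (rule structuredD(2)[OF S])
  have pt: "of_bool (E a b) + of_bool (a \<in> L \<and> b = a) + of_bool (a \<in> ?V \<and> b \<in> ?V \<and> c a = c b) + of_bool (lacking E L c a b)
    = 1 + (of_bool (extra E L c a b) :: real)" if ab: "a < n" "b < n" for a b
  proof (cases "a \<in> L \<or> b \<in> L")
    case True
    thus ?thesis using structured_adj(1)[OF S ab True] by (auto simp: extra_def lacking_def)
  next
    case False thus ?thesis using ab by (auto simp: extra_def lacking_def)
  qed
  have "(\<Sum>a<n. \<Sum>b<n. of_bool (E a b) + of_bool (a \<in> L \<and> b = a) + of_bool (a \<in> ?V \<and> b \<in> ?V \<and> c a = c b) + of_bool (lacking E L c a b))
    = (\<Sum>a<n. \<Sum>b<n. 1 + (of_bool (extra E L c a b) :: real))"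
    by (intro sum.cong refl) (use pt in auto)
  hence main: "quad n E (\<lambda>_. 1) + (\<Sum>a<n. \<Sum>b<n. of_bool (a \<in> L \<and> b = a))
    + (\<Sum>a<n. \<Sum>b<n. of_bool (a \<in> ?V \<and> b \<in> ?V \<and> c a = c b)) + quad n (lacking E L c) (\<lambda>_. 1)
    = (real n)\<^sup>2 + quad n (extra E L c) (\<lambda>_. 1)"
    by (simp add: quad_def sum.distrib power2_eq_square)
  have "(\<Sum>a<n. \<Sum>b<n. of_bool (a \<in> L \<and> b = a)) = (\<Sum>a<n. of_bool (a \<in> L) :: real)"
  proof (intro sum.cong refl)
    fix a assume a: "a \<in> {..<n}"
    have "(\<Sum>b<n. of_bool (a \<in> L \<and> b = a) :: real) = (\<Sum>b<n. if b = a then of_bool (a \<in> L) else 0)"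
      by (intro sum.cong) auto
    thus "(\<Sum>b<n. of_bool (a \<in> L \<and> b = a) :: real) = of_bool (a \<in> L)" using a by (simp add: sum.delta)
  qed
  also have "\<dots> = real r"
  proof -
    have "{u. u < n \<and> u \<in> L} = L" using LV by auto
    thus ?thesis using card_eq_sum_of_bool[of n "\<lambda>u. u \<in> L"] structuredD(4)[OF S] by simp
  qed
  finally have 1: "(\<Sum>a<n. \<Sum>b<n. of_bool (a \<in> L \<and> b = a) :: real) = r" .
  have "(\<Sum>a<n. \<Sum>b<n. of_bool (a \<in> ?V \<and> b \<in> ?V \<and> c a = c b) :: real) = (\<Sum>a\<in>?V. \<Sum>b\<in>?V. of_bool (a \<in> ?V \<and> b \<in> ?V \<and> c a = c b))"
    using quad_supported[of ?V n "\<lambda>a b. a \<in> ?V \<and> b \<in> ?V \<and> c a = c b"] by (simp add: quad_def)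
  also have "\<dots> = (\<Sum>a\<in>?V. \<Sum>b\<in>?V. of_bool (c a = c b))" by (intro sum.cong refl) auto
  also have "\<dots> = (\<Sum>j<p. (real (card {v \<in> ?V. c v = j}))\<^sup>2)"
    using structuredD(5)[OF S] by (intro same_colour_pairs) auto
  also have "\<dots> = (\<Sum>j<p. (real (card (rest_class n L c j)))\<^sup>2)"
  proof (intro sum.cong refl)
    fix j
    have "{v \<in> ?V. c v = j} = rest_class n L c j" by (auto simp: rest_class_def)
    thus "(real (card {v \<in> ?V. c v = j}))\<^sup>2 = (real (card (rest_class n L c j)))\<^sup>2" by simp
  qed
  finally show ?thesis using main 1 by linarith
qed

lemma rest_class_sum:
  assumes S: "structured p r k n E L c C"
  shows "(\<Sum>j<p. real (card (rest_class n L c j))) = real n - r"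
proof -
  have "(\<Sum>j<p. real (card {v \<in> {..<n} - L. c v = j})) = card ({..<n} - L)"
    using structuredD(5)[OF S] by (intro sum_colour_classes) auto
  moreover have "{v \<in> {..<n} - L. c v = j} = rest_class n L c j" for j by (auto simp: rest_class_def)
  moreover have "card ({..<n} - L) = n - r" "r \<le> n"
    using structuredD(2-4)[OF S] card_mono[OF _ structuredD(2)[OF S]] by (auto simp: card_Diff_subset)
  ultimately show ?thesis by (simp add: of_nat_diff)
qed

text \<open>For integers x the product \<open>(x - t) * (x - t - 1)\<close> is nonnegative, and it
  vanishes at t and t + 1, the only values of a balanced family with minimum t. Since the totals
  agree, summing leaves only the squares to compare.\<close>

lemma balanced_sum_squares_le:
  fixes f h :: "nat \<Rightarrow> nat"
  assumes bal: "\<And>i j. i < p \<Longrightarrow> j < p \<Longrightarrow> f i \<le> f j + 1"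
    and sums: "(\<Sum>j<p. real (f j)) = (\<Sum>j<p. real (h j))"
  shows "(\<Sum>j<p. (real (f j))\<^sup>2) \<le> (\<Sum>j<p. (real (h j))\<^sup>2)"
proof (cases "p = 0")
  case False
  define t where "t = Min (f ` {..<p})"
  have "t \<in> f ` {..<p}" unfolding t_def using False by (intro Min_in) auto
  then obtain i where i: "i < p" "t = f i" by auto
  have t: "t \<le> f j" if "j < p" for j unfolding t_def using that by (intro Min_le) auto
  have f: "(real (f j) - t) * (real (f j) - t - 1) = 0" if "j < p" for j
    using t[OF that] bal[OF that i(1)] i(2) by (cases "f j = t") auto
  have h: "(real (h j) - t) * (real (h j) - t - 1) \<ge> 0" for j
    by (cases "h j \<le> t") (auto intro: mult_nonpos_nonpos mult_nonneg_nonneg)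
  have ex: "(\<Sum>j<p. (real (g j) - t) * (real (g j) - t - 1)) =
    (\<Sum>j<p. (real (g j))\<^sup>2) - (2 * real t + 1) * (\<Sum>j<p. real (g j)) + p * (real t * (real t + 1))" for g :: "nat \<Rightarrow> nat"
  proof -
    have "(\<Sum>j<p. (real (g j) - t) * (real (g j) - t - 1)) =
      (\<Sum>j<p. (real (g j))\<^sup>2 - (2 * real t + 1) * real (g j) + real t * (real t + 1))"
      by (intro sum.cong refl) (simp add: algebra_simps power2_eq_square)
    thus ?thesis by (simp add: sum.distrib sum_subtractf sum_distrib_left)
  qed
  have "(\<Sum>j<p. (real (f j) - t) * (real (f j) - t - 1)) = 0" using f by (intro sum.neutral) auto
  moreover have "(\<Sum>j<p. (real (h j) - t) * (real (h j) - t - 1)) \<ge> 0" by (intro sum_nonneg h)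
  ultimately show ?thesis unfolding ex sums by linarith
qed simp

section \<open>Graphs as edge sets, and the conclusion\<close>

lemma simple_graph_edge_set: "graph_on n E \<Longrightarrow> simple_graph n (edge_set E)"
  unfolding simple_graph_def edge_set_def graph_on_def by blast

lemma simple_graph_relation:
  assumes "simple_graph n H"
  shows "graph_on n (\<lambda>u v. {u, v} \<in> H)" and "edge_set (\<lambda>u v. {u, v} \<in> H) = H"
proof -
  have *: "u \<noteq> v \<and> u < n \<and> v < n" if "{u, v} \<in> H" for u v
  proof -
    have "{u, v} \<in> {{x, y} | x y. x \<noteq> y \<and> x < n \<and> y < n}"
      using assms that unfolding simple_graph_def by (rule subsetD)
    then obtain x y where "{u, v} = {x, y}" "x \<noteq> y" "x < n" "y < n" by blast
    thus ?thesis by (auto simp: doubleton_eq_iff)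
  qed
  thus "graph_on n (\<lambda>u v. {u, v} \<in> H)" unfolding graph_on_def by (auto simp: insert_commute)
  show "edge_set (\<lambda>u v. {u, v} \<in> H) = H"
    using assms unfolding edge_set_def simple_graph_def by blast
qed

lemma exists_edge_extremal:
  assumes "graph_on n E" "SF_free p ks n (edge_set E)"
  shows "\<exists>E2. graph_on n E2 \<and> SF_free p ks n (edge_set E2) \<and>
    (\<forall>G. graph_on n G \<and> SF_free p ks n (edge_set G) \<longrightarrow> card (edge_set G) \<le> card (edge_set E2))"
proof -
  have "card (edge_set G) \<le> n * n" if "graph_on n G" for G
  proof -
    have "2 * real (card (edge_set G)) = quad n G (\<lambda>_. 1)" using quad_one_eq_card[OF that] by simp
    also have "\<dots> \<le> (\<Sum>u<n. \<Sum>v<n. 1)" unfolding quad_def by (intro sum_mono) auto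
    finally have "2 * real (card (edge_set G)) \<le> real (n * n)" by simp
    thus ?thesis by linarith
  qed
  thus ?thesis
    using ex_has_greatest_nat[of "\<lambda>G. graph_on n G \<and> SF_free p ks n (edge_set G)" E "\<lambda>G. card (edge_set G)" "n * n + 1"]
      assms by (metis (no_types, lifting) less_add_one order_le_less_trans)
qed

theorem theorem1p1:
  fixes p :: nat and ks :: "nat list"
  assumes "p \<ge> 2" and "length ks \<ge> 1"
    and "sorted_wrt (\<ge>) ks" and "\<forall>k\<in>set ks. k \<ge> 1"
  shows "\<exists>n0. \<forall>n\<ge>n0. \<forall>H. simple_graph n H \<and> SF_free p ks n H \<and>
           (\<forall>G. simple_graph n G \<and> SF_free p ks n G \<longrightarrow>
                 spectral_radius n G \<le> spectral_radius n H)
           \<longrightarrow> H \<in> Ex_SF p ks n"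
proof -
  have p1: "p \<ge> 1" using assms(1) by simp
  have ks: "\<forall>k\<in>set ks. 1 \<le> k" "ks \<noteq> []" using assms(2,4) by auto
  have lst: "\<forall>k\<in>set ks. last ks \<le> k"
  proof -
    have "sorted_wrt (\<ge>) (butlast ks @ [last ks])" using assms(3) ks(2) by simp
    hence "\<forall>k\<in>set (butlast ks). last ks \<le> k" by (simp add: sorted_wrt_append)
    moreover have "set ks = insert (last ks) (set (butlast ks))"
      using ks(2) by (metis append_butlast_last_id list.simps(15) rotate1.simps(2) set_rotate1)
    ultimately show ?thesis by simp
  qed
  define r where "r = length ks - 1"
  define k where "k = last ks"
  have k1: "k \<ge> 1" unfolding k_def using ks by simp
  have len: "length ks = r + 1" using ks(2) by (simp add: r_def)
  have kmin: "\<forall>k'\<in>set ks. k \<le> k'" using lst by (simp add: k_def)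
  \<comment> \<open>The constant 1 is the loss of the residue-class graph: it lacks at most n of the
    ordered pairs in Turan's bound, which costs at most 1 in the spectral radius.\<close>
  obtain K1 n1 where n1: "\<forall>n\<ge>n1. \<forall>E. graph_on n E \<and> SF_free p ks n (edge_set E) \<and>
      lam n E \<ge> (1 - 1 / p) * n - 1 \<longrightarrow> (\<exists>z. near_perron p n E K1 z)"
    using exists_near_perron[OF assms(1) ks(1), of 1] by auto
  define K where "K = max K1 1"
  have K: "K \<ge> 1" "K1 \<le> K" by (auto simp: K_def)
  obtain C0 n2 where n2: "\<forall>n\<ge>n2. \<forall>E z. graph_on n E \<and> SF_free p ks n (edge_set E) \<and>
    quad n E (\<lambda>_. 1) \<ge> (1 - 1 / p) * (real n)\<^sup>2 - K * n \<and>
    (\<forall>i<n. 0 < z i \<and> z i \<le> K) \<and> (\<Sum>i<n. (z i - 1)\<^sup>2) \<le> K \<and>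
    (\<forall>v<n. (\<Sum>u<n. of_bool (E v u) * z u) \<le> n * z v) \<and>
    (\<forall>G. graph_on n G \<and> SF_free p ks n (edge_set G) \<longrightarrow> quad n G z \<le> quad n E z)
    \<longrightarrow> (\<exists>L c. structured p r k n E L c C0)"
    using weighted_extremal_structured[OF assms(1) ks lst K(1)] unfolding r_def k_def by blast
  define C where "C = max C0 0"
  have C: "C \<ge> 0" "C0 \<le> C" by (auto simp: C_def)
  \<comment> \<open>This is the loss allowed for a graph in which one vertex has been moved.\<close>
  have "K + 2 * K\<^sup>2 \<ge> 0" using K by simp
  then obtain K2' n3 where n3: "\<forall>n\<ge>n3. \<forall>E. graph_on n E \<and> SF_free p ks n (edge_set E) \<and>
      lam n E \<ge> (1 - 1 / p) * n - (K + 2 * K\<^sup>2) \<longrightarrow> (\<exists>z. near_perron p n E K2' z)"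
    using exists_near_perron[OF assms(1) ks(1), of "K + 2 * K\<^sup>2"] by auto
  define K2 where "K2 = max K2' 0"
  have K2: "K2 \<ge> 0" "K2' \<le> K2" by (auto simp: K2_def)
  define \<epsilon> where "\<epsilon> = 1 / (100 * (C + 2))"
  have \<epsilon>: "0 < \<epsilon>" "\<epsilon> \<le> 1" "12 * (C * \<epsilon>) < 1" using C by (auto simp: \<epsilon>_def field_simps)
  define Q1 where "Q1 = 4 * (2 * sqrt K + C + r + 2 * (C * K) + K) / \<epsilon>"
  define Q2 where "Q2 = 4 * (2 * sqrt K2 + (C + 1) + r + 2 * ((C + 1) * K2) + K2) / \<epsilon>"
  define Q3 where "Q3 = p * (3 * C + r + (real (1 + p * k) + 2) + 1)"
  define Q4 where "Q4 = 4 * (C + K) / \<epsilon>"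
  define Q5 where "Q5 = 4 * ((C + 1) + K2) / \<epsilon>"
  define Q6 where "Q6 = p * (3 * C + r + (2 * C + 2 + real (p * k)) + 1)"
  \<comment> \<open>The entry 1 guarantees n >= 1.\<close>
  define Q where "Q = Max {Q1, Q2, Q3, Q4, Q5, Q6, 1}"
  obtain n4 where n4: "real n4 \<ge> Q\<^sup>2" using real_arch_simple by blast
  have main: "H \<in> Ex_SF p ks n"
    if n: "n \<ge> n1" "n \<ge> n2" "n \<ge> n3" "n \<ge> n4" and H: "simple_graph n H" "SF_free p ks n H"
      and Hmax: "\<forall>G. simple_graph n G \<and> SF_free p ks n G \<longrightarrow> spectral_radius n G \<le> spectral_radius n H" for n H
  proof -
    have "sqrt (Q\<^sup>2) \<le> sqrt n" using n4 n(4) by (intro real_sqrt_le_mono) linarith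
    hence Qn: "Q \<le> sqrt n" by simp
    have "x \<le> sqrt n" if "x \<in> {Q1, Q2, Q3, Q4, Q5, Q6, 1}" for x
    proof -
      have "x \<le> Q" unfolding Q_def by (rule Max_ge[OF _ that]) simp
      thus ?thesis using Qn by linarith
    qed
    hence sQ: "Q1 \<le> sqrt n" "Q2 \<le> sqrt n" "Q3 \<le> sqrt n" "Q4 \<le> sqrt n" "Q5 \<le> sqrt n" "Q6 \<le> sqrt n" "1 \<le> sqrt n"
      by blast+
    have nn1: "n \<ge> 1" using sQ(7) by simp
    have me: "X \<le> sqrt n * \<epsilon>" if "X / \<epsilon> \<le> sqrt n" for X using that \<epsilon>(1) by (simp add: field_simps)
    define E where "E u v \<longleftrightarrow> {u, v} \<in> H" for u v
    have g: "graph_on n E" and eE: "edge_set E = H"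
      using simple_graph_relation[OF H(1)] unfolding E_def[abs_def] by auto
    have free: "SF_free p ks n (edge_set E)" using H(2) eE by simp
    have lmax: "lam n G \<le> lam n E" if "graph_on n G" "SF_free p ks n (edge_set G)" for G
      using Hmax simple_graph_edge_set[OF that(1)] that(2) unfolding lam_def eE by blast
    obtain T where T: "graph_on n T" "SF_free p ks n (edge_set T)" "quad n T (\<lambda>_. 1) \<ge> (1 - 1 / p) * (real n)\<^sup>2 - n"
      using exists_dense_free_graph[OF p1 ks] by blast
    have lE: "lam n E \<ge> (1 - 1 / p) * n - 1"
    proof -
      have "quad n T (\<lambda>_. 1) \<le> lam n T * n" using quad_le_lam[OF nn1 T(1), of "\<lambda>_. 1"] by simp
      hence "((1 - 1 / p) * n - 1) * n \<le> lam n T * n" using T(3) by (simp add: algebra_simps power2_eq_square)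
      hence "(1 - 1 / p) * n - 1 \<le> lam n T" using nn1 by simp
      thus ?thesis using lmax[OF T(1,2)] by linarith
    qed
    then obtain z where "near_perron p n E K1 z" using n1 n(1) g free by blast
    hence P: "near_perron p n E K z" using near_perron_mono K(2) by blast
    note P' = P[unfolded near_perron_def]
    have z: "\<And>i. i < n \<Longrightarrow> 0 \<le> z i \<and> z i \<le> K" "(\<Sum>i<n. (z i)\<^sup>2) = n" "quad n E z = lam n E * n"
      "\<And>v. v < n \<Longrightarrow> (\<Sum>j<n. of_bool (E v j) * z j) = lam n E * z v" "lam n E \<le> n"
      "(\<Sum>i<n. (z i - 1)\<^sup>2) \<le> K" "quad n E (\<lambda>_. 1) \<ge> (1 - 1 / p) * (real n)\<^sup>2 - K * n"
      using P' by blast+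
    have zpos: "0 < z a" if "a < n" for a
      by (rule perron_vector_positive[OF assms(1) ks(1) nn1 g free lmax _ z(2,3,4) that]) (use z(1) in auto)
    have qmax: "quad n G z \<le> quad n E z" if "graph_on n G" "SF_free p ks n (edge_set G)" for G
    proof -
      have "quad n G z \<le> lam n G * n" using quad_le_lam[OF nn1 that(1), of z] z(2) by simp
      also have "\<dots> \<le> lam n E * n" using lmax[OF that] by (intro mult_right_mono) auto
      finally show ?thesis using z(3) by simp
    qed
    have deg: "\<forall>v<n. (\<Sum>u<n. of_bool (E v u) * z u) \<le> n * z v"
      using z(1,4,5) by (auto intro: mult_right_mono)
    have "\<exists>L c. structured p r k n E L c C0"
      using n2 n(2) g free z(1,6,7) zpos deg qmax by blast
    then obtain L c where S: "structured p r k n E L c C" using structured_mono C(2) by blast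
    obtain E2 where E2: "graph_on n E2" "SF_free p ks n (edge_set E2)"
      "\<And>G. graph_on n G \<Longrightarrow> SF_free p ks n (edge_set G) \<Longrightarrow> card (edge_set G) \<le> card (edge_set E2)"
      using exists_edge_extremal[OF g free] by blast
    have q2: "quad n G (\<lambda>_. 1) \<le> quad n E2 (\<lambda>_. 1)" if "graph_on n G" "SF_free p ks n (edge_set G)" for G
      using E2(3)[OF that] by (simp add: quad_one_eq_card[OF that(1)] quad_one_eq_card[OF E2(1)])
    have "\<exists>L c. structured p r k n E2 L c C0"
    proof -
      have "1 * real n \<le> K * n" using K(1) by (intro mult_right_mono) auto
      hence "quad n E2 (\<lambda>_. 1) \<ge> (1 - 1 / p) * (real n)\<^sup>2 - K * n" using q2[OF T(1,2)] T(3) by linarith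
      moreover have "(\<Sum>u<n. of_bool (E2 v u) * 1) \<le> real n * 1" for v
      proof -
        have "(\<Sum>u<n. of_bool (E2 v u) * 1) \<le> (\<Sum>u<n. 1 :: real)" by (intro sum_mono) auto
        thus ?thesis by simp
      qed
      moreover have "\<forall>i<n. 0 < (1 :: real) \<and> 1 \<le> K" "(\<Sum>i<n. (1 - 1 :: real)\<^sup>2) \<le> K" using K(1) by auto
      ultimately show ?thesis using n2[rule_format, OF n(2), of E2 "\<lambda>_. 1"] E2(1,2) q2 by blast
    qed
    then obtain L2 c2 where S2: "structured p r k n E2 L2 c2 C" using structured_mono C(2) by blast
    have near: "\<bar>z v - 1\<bar> \<le> \<epsilon>" if "v < n" "v \<notin> L" for v
      by (rule perron_nearly_constant[OF assms(1) S P \<epsilon>(1) _ nn1 that]) (use me sQ(1) Q1_def in blast)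
    have surplus: "quad n (extra E2 L2 c2) (\<lambda>_. 1) - quad n (lacking E2 L2 c2) (\<lambda>_. 1)
      \<le> quad n (extra E L c) (\<lambda>_. 1) - quad n (lacking E L c) (\<lambda>_. 1)"
      by (rule surplus_le[OF p1 k1 len kmin S S2 near _ \<epsilon>(2,3) qmax]) (use \<epsilon>(1) sQ(6) in \<open>auto simp: Q6_def\<close>)
    have bal: "card (rest_class n L c i) \<le> card (rest_class n L c j) + 1" if ij: "i < p" "j < p" for i j
    proof (rule ccontr)
      assume "\<not> ?thesis"
      hence gap: "card (rest_class n L c i) \<ge> card (rest_class n L c j) + 2" by simp
      have "\<exists>G. graph_on n G \<and> SF_free p ks n (edge_set G) \<and> lam n G > lam n E"
      proof (rule move_vertex_raises_lam[OF assms(1) k1 len kmin S P _ K2(1) ij gap \<epsilon>_def nn1])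
        show "\<exists>y. near_perron p n G K2 y" if "graph_on n G" "SF_free p ks n (edge_set G)"
          "lam n G \<ge> (1 - 1 / p) * n - (K + 2 * K\<^sup>2)" for G
          using n3 n(3) that near_perron_mono K2(2) by blast
      qed (use K sQ me in \<open>auto simp: Q1_def Q2_def Q3_def Q4_def Q5_def\<close>)
      thus False using lmax by (meson not_le)
    qed
    \<comment> \<open>Only the classes of E are known to be balanced. That is enough, because
      balanced sizes minimise the sum of squares among all sizes with total n - r.\<close>
    have "(\<Sum>j<p. (real (card (rest_class n L c j)))\<^sup>2) \<le> (\<Sum>j<p. (real (card (rest_class n L2 c2 j)))\<^sup>2)"
      by (rule balanced_sum_squares_le) (use bal rest_class_sum[OF S] rest_class_sum[OF S2] in auto)
    hence "quad n E2 (\<lambda>_. 1) \<le> quad n E (\<lambda>_. 1)"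
      using surplus unfolding quad_structured_count[OF S] quad_structured_count[OF S2] by linarith
    hence ee: "card (edge_set E2) \<le> card H"
      using quad_one_eq_card[OF E2(1)] quad_one_eq_card[OF g] eE by simp
    have "card G \<le> card H" if "simple_graph n G" "SF_free p ks n G" for G
    proof -
      have "card (edge_set (\<lambda>u v. {u, v} \<in> G)) \<le> card (edge_set E2)"
        using that simple_graph_relation[OF that(1)] by (intro E2(3)) auto
      thus ?thesis using ee simple_graph_relation(2)[OF that(1)] by simp
    qed
    thus ?thesis using H unfolding Ex_SF_def by blast
  qed
  show ?thesis
    by (intro exI[of _ "max (max n1 n2) (max n3 n4)"] allI impI, elim conjE) (rule main; simp)
qed

end
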